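(* Let $R$ be a commutative Noetherian ring with identity, let $\mathfrak{a}$ be an ideal of $R$ and let $N$ be a weakly Laskerian $R$-module of finite dimension. Let $t$ be a positive integer. If $H^i_{\mathfrak{a}}(N)$ is Artinian for all $i>t$, then $H^t_{\mathfrak{a}}(N)/\mathfrak{a}H^t_{\mathfrak{a}}(N)$ is Artinian.
   Context: All modules are unitary; $H^i_{\mathfrak{a}}(N)$ denotes the $i$-th local cohomology module of $N$ with respect to $\mathfrak{a}$. An $R$-module $N$ is weakly Laskerian if every quotient of $N$ has only finitely many associated prime ideals. The dimension of a (not necessarily finitely generated) $R$-module $N$ is the dimension of $\operatorname{Supp}_R N$. *)

theory Defs
  imports "HOL-Algebra.Ring_Divisibility" "HOL-Algebra.Ideal_Product" "HOL-Algebra.Generated_Groups" "HOL-Library.Extended_Real"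
begin

section \<open>Homomorphisms and quotients of modules\<close>

definition mod_hom ::
  "('a, 'm) ring_scheme \<Rightarrow> ('a, 'b, 'n) module_scheme \<Rightarrow> ('a, 'c, 'k) module_scheme \<Rightarrow> ('b \<Rightarrow> 'c) set"
  where "mod_hom R M N =
    {f. f \<in> carrier M \<rightarrow> carrier N \<and>
        (\<forall>x\<in>carrier M. \<forall>y\<in>carrier M. f (x \<oplus>\<^bsub>M\<^esub> y) = f x \<oplus>\<^bsub>N\<^esub> f y) \<and>
        (\<forall>r\<in>carrier R. \<forall>x\<in>carrier M. f (r \<odot>\<^bsub>M\<^esub> x) = r \<odot>\<^bsub>N\<^esub> f x)}"

text \<open>The elements of \<open>M/K\<close> are the cosets of \<open>K\<close>.  The fields \<open>mult\<close> and \<open>one\<close> play no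
  role in a module and are filled arbitrarily.\<close>

definition quot_module :: "('a, 'b, 'n) module_scheme \<Rightarrow> 'b set \<Rightarrow> ('a, 'b set) module"
  where "quot_module M K =
    \<lparr>carrier = a_rcosets\<^bsub>M\<^esub> K, mult = (\<lambda>_ _. K), one = K, zero = K, add = set_add M,
     smult = (\<lambda>r C. \<Union>x\<in>C. K +>\<^bsub>M\<^esub> (r \<odot>\<^bsub>M\<^esub> x))\<rparr>"

text \<open>The submodule \<open>aM\<close>: all finite sums of products \<open>r \<odot> x\<close>.\<close>

definition ideal_smult :: "'a set \<Rightarrow> ('a, 'b, 'n) module_scheme \<Rightarrow> 'b set"
  where "ideal_smult a M =
    generate (add_monoid M) {r \<odot>\<^bsub>M\<^esub> x | r x. r \<in> a \<and> x \<in> carrier M}"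

locale artinian_module = module +
  assumes descending_chain_condition:
    "\<lbrakk>\<And>n::nat. submodule (K n) R M; \<And>n. K (Suc n) \<subseteq> K n\<rbrakk> \<Longrightarrow> \<exists>n. \<forall>m\<ge>n. K m = K n"


section \<open>Associated primes, support and dimension\<close>

definition assoc_primes :: "('a, 'm) ring_scheme \<Rightarrow> ('a, 'b, 'n) module_scheme \<Rightarrow> 'a set set"
  where "assoc_primes R M =
    {p. primeideal p R \<and> (\<exists>x\<in>carrier M. p = {r \<in> carrier R. r \<odot>\<^bsub>M\<^esub> x = \<zero>\<^bsub>M\<^esub>})}"

definition weakly_laskerian :: "('a, 'm) ring_scheme \<Rightarrow> ('a, 'b, 'n) module_scheme \<Rightarrow> bool"
  where "weakly_laskerian R M \<longleftrightarrow>
    (\<forall>K. submodule K R M \<longrightarrow> finite (assoc_primes R (quot_module M K)))"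

text \<open>The localization \<open>M\<^sub>p\<close>, of which only the underlying set and the zero element are needed
  here: fractions \<open>x/s\<close> with \<open>s \<notin> p\<close>, where \<open>x/s = y/t\<close> iff \<open>u(tx) = u(sy)\<close> for some \<open>u \<notin> p\<close>.\<close>

definition frac_rel ::
  "('a, 'm) ring_scheme \<Rightarrow> ('a, 'b, 'n) module_scheme \<Rightarrow> 'a set \<Rightarrow> (('b \<times> 'a) \<times> ('b \<times> 'a)) set"
  where "frac_rel R M p =
    {((x, s), (y, t)). x \<in> carrier M \<and> y \<in> carrier M \<and>
       s \<in> carrier R - p \<and> t \<in> carrier R - p \<and>
       (\<exists>u \<in> carrier R - p. u \<odot>\<^bsub>M\<^esub> (t \<odot>\<^bsub>M\<^esub> x) = u \<odot>\<^bsub>M\<^esub> (s \<odot>\<^bsub>M\<^esub> y))}"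

definition localization ::
  "('a, 'm) ring_scheme \<Rightarrow> ('a, 'b, 'n) module_scheme \<Rightarrow> 'a set \<Rightarrow> ('b \<times> 'a) set set"
  where "localization R M p = (carrier M \<times> (carrier R - p)) // frac_rel R M p"

definition localization_zero ::
  "('a, 'm) ring_scheme \<Rightarrow> ('a, 'b, 'n) module_scheme \<Rightarrow> 'a set \<Rightarrow> ('b \<times> 'a) set"
  where "localization_zero R M p = frac_rel R M p `` {(\<zero>\<^bsub>M\<^esub>, \<one>\<^bsub>R\<^esub>)}"

definition supp :: "('a, 'm) ring_scheme \<Rightarrow> ('a, 'b, 'n) module_scheme \<Rightarrow> 'a set set"
  where "supp R M = {p. primeideal p R \<and> localization R M p \<noteq> {localization_zero R M p}}"

text \<open>The supremum of the lengths of chains of primes in the support.  The zero module has empty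
  support, hence dimension \<open>-\<infinity>\<close>.\<close>

definition module_dim :: "('a, 'm) ring_scheme \<Rightarrow> ('a, 'b, 'n) module_scheme \<Rightarrow> ereal"
  where "module_dim R M =
    (SUP n \<in> {n::nat. \<exists>p. (\<forall>i\<le>n. p i \<in> supp R M) \<and> (\<forall>i<n. p i \<subset> p (Suc i))}. ereal (real n))"


section \<open>Injective modules\<close>

text \<open>The test modules \<open>A\<close> and \<open>B\<close> have elements of the type of the ring, since a definition
  cannot quantify over types.  This is no restriction: by Baer's criterion (lemma
  \<open>injective_module.extension_any_type\<close> below) the extension property then holds for test modules
  over arbitrary types.\<close>

locale injective_module = module R E
  for R :: "('a, 'm) ring_scheme" (structure) and E :: "('a, 'c, 'k) module_scheme" (structure) +
  assumes extension:
    "\<And>(A :: ('a, 'a) module) (B :: ('a, 'a) module) f g.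
      \<lbrakk>module R A; module R B; f \<in> mod_hom R A B; inj_on f (carrier A); g \<in> mod_hom R A E\<rbrakk>
      \<Longrightarrow> \<exists>h \<in> mod_hom R B E. \<forall>x\<in>carrier A. h (f x) = g x"

lemma (in cring) ring_as_module:
  "module R \<lparr>carrier = carrier R, mult = mult R, one = \<one>, zero = \<zero>, add = add R,
     smult = mult R\<rparr>" (is "module R ?M")
proof (rule moduleI)
  show "cring R" by (rule is_cring)
  show "abelian_group ?M"
    by (rule abelian_groupI) (auto simp: a_ac intro: l_neg)
qed (auto simp: l_distr r_distr m_assoc)

theorem (in injective_module) extension_any_type:
  fixes A :: "('a, 'u, 'p) module_scheme" and B :: "('a, 'v, 'q) module_scheme"
  assumes A: "module R A" and B: "module R B"
    and f: "f \<in> mod_hom R A B" and inj: "inj_on f (carrier A)" and g: "g \<in> mod_hom R A E"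
  shows "\<exists>h \<in> mod_hom R B E. \<forall>x\<in>carrier A. h (f x) = g x"
proof -
  interpret A: module R A by fact
  interpret B: module R B by fact
  define adm where "adm = (\<lambda>G. G \<subseteq> carrier B \<times> carrier E \<and> (\<forall>x\<in>carrier A. (f x, g x) \<in> G) \<and>
    (\<forall>b e b' e'. (b, e) \<in> G \<longrightarrow> (b', e') \<in> G \<longrightarrow> (b \<oplus>\<^bsub>B\<^esub> b', e \<oplus>\<^bsub>E\<^esub> e') \<in> G) \<and>
    (\<forall>r\<in>carrier R. \<forall>b e. (b, e) \<in> G \<longrightarrow> (r \<odot>\<^bsub>B\<^esub> b, r \<odot>\<^bsub>E\<^esub> e) \<in> G) \<and>
    (\<forall>e. (\<zero>\<^bsub>B\<^esub>, e) \<in> G \<longrightarrow> e = \<zero>\<^bsub>E\<^esub>))"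
  have fcl: "f x \<in> carrier B" and gcl: "g x \<in> carrier E" if "x \<in> carrier A" for x
    using f g that by (auto simp: mod_hom_def)
  have fadd: "f (x \<oplus>\<^bsub>A\<^esub> y) = f x \<oplus>\<^bsub>B\<^esub> f y" and gadd: "g (x \<oplus>\<^bsub>A\<^esub> y) = g x \<oplus>\<^bsub>E\<^esub> g y"
    if "x \<in> carrier A" "y \<in> carrier A" for x y
    using f g that by (auto simp: mod_hom_def)
  have fsm: "f (r \<odot>\<^bsub>A\<^esub> x) = r \<odot>\<^bsub>B\<^esub> f x" and gsm: "g (r \<odot>\<^bsub>A\<^esub> x) = r \<odot>\<^bsub>E\<^esub> g x"
    if "r \<in> carrier R" "x \<in> carrier A" for r x
    using f g that by (auto simp: mod_hom_def)
  have f0: "f \<zero>\<^bsub>A\<^esub> = \<zero>\<^bsub>B\<^esub>" and g0: "g \<zero>\<^bsub>A\<^esub> = \<zero>\<^bsub>E\<^esub>"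
    using fsm[of "\<zero>" "\<zero>\<^bsub>A\<^esub>"] gsm[of "\<zero>" "\<zero>\<^bsub>A\<^esub>"] fcl gcl by auto
  have adm0: "adm ((\<lambda>x. (f x, g x)) ` carrier A)"
  proof -
    have "e = \<zero>\<^bsub>E\<^esub>" if "(\<zero>\<^bsub>B\<^esub>, e) \<in> (\<lambda>x. (f x, g x)) ` carrier A" for e
    proof -
      from that obtain x where x: "x \<in> carrier A" "f x = \<zero>\<^bsub>B\<^esub>" "e = g x" by auto
      then have "x = \<zero>\<^bsub>A\<^esub>" using f0 by (intro inj_onD[OF inj]) auto
      then show ?thesis using x g0 by simp
    qed
    then show ?thesis unfolding adm_def
      by (auto simp: fcl gcl fadd[symmetric] gadd[symmetric] fsm[symmetric] gsm[symmetric])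
  qed
  have chain: "adm (\<Union>C)" if "C \<noteq> {}" "subset.chain {G. adm G} C" for C
  proof -
    have mem: "adm G" if "G \<in> C" for G
      using \<open>subset.chain {G. adm G} C\<close> that by (auto simp: subset.chain_def)
    have tot: "G \<subseteq> G' \<or> G' \<subseteq> G" if "G \<in> C" "G' \<in> C" for G G'
      using \<open>subset.chain {G. adm G} C\<close> that by (auto simp: subset.chain_def)
    have "(b \<oplus>\<^bsub>B\<^esub> b', e \<oplus>\<^bsub>E\<^esub> e') \<in> \<Union>C" if "(b, e) \<in> \<Union>C" "(b', e') \<in> \<Union>C" for b e b' e'
    proof -
      from that obtain G G' where G: "G \<in> C" "G' \<in> C" "(b, e) \<in> G" "(b', e') \<in> G'" by auto
      with tot[of G G'] obtain G'' where "G'' \<in> C" "(b, e) \<in> G''" "(b', e') \<in> G''" by blast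
      then show ?thesis using mem[of G''] unfolding adm_def by blast
    qed
    moreover obtain G where "G \<in> C" using \<open>C \<noteq> {}\<close> by auto
    moreover have "(r \<odot>\<^bsub>B\<^esub> b, r \<odot>\<^bsub>E\<^esub> e) \<in> \<Union>C" if "r \<in> carrier R" "(b, e) \<in> \<Union>C" for r b e
      using that mem unfolding adm_def by blast
    moreover have "e = \<zero>\<^bsub>E\<^esub>" if "(\<zero>\<^bsub>B\<^esub>, e) \<in> \<Union>C" for e
      using that mem unfolding adm_def by blast
    moreover have "\<Union>C \<subseteq> carrier B \<times> carrier E"
      using mem unfolding adm_def by blast
    moreover have "\<forall>x\<in>carrier A. (f x, g x) \<in> \<Union>C"
      using mem[OF \<open>G \<in> C\<close>] \<open>G \<in> C\<close> unfolding adm_def by blast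
    ultimately show ?thesis unfolding adm_def by blast
  qed
  have "\<exists>M\<in>{G. adm G}. \<forall>H\<in>{G. adm G}. M \<subseteq> H \<longrightarrow> H = M"
    by (rule subset_Zorn_nonempty) (use adm0 chain in auto)
  then obtain M where M: "adm M" and max: "\<And>H. adm H \<Longrightarrow> M \<subseteq> H \<Longrightarrow> H = M" by auto
  have Mcl: "b \<in> carrier B" "e \<in> carrier E" if "(b, e) \<in> M" for b e
    using M that unfolding adm_def by auto
  have Mext: "(f x, g x) \<in> M" if "x \<in> carrier A" for x
    using M that unfolding adm_def by auto
  have Madd: "(b \<oplus>\<^bsub>B\<^esub> b', e \<oplus>\<^bsub>E\<^esub> e') \<in> M" if "(b, e) \<in> M" "(b', e') \<in> M" for b e b' e'
    using M that unfolding adm_def by auto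
  have Msm: "(r \<odot>\<^bsub>B\<^esub> b, r \<odot>\<^bsub>E\<^esub> e) \<in> M" if "r \<in> carrier R" "(b, e) \<in> M" for r b e
    using M that unfolding adm_def by auto
  have M0: "e = \<zero>\<^bsub>E\<^esub>" if "(\<zero>\<^bsub>B\<^esub>, e) \<in> M" for e
    using M that unfolding adm_def by auto
  have Mneg: "(\<ominus>\<^bsub>B\<^esub> b, \<ominus>\<^bsub>E\<^esub> e) \<in> M" if "(b, e) \<in> M" for b e
    using Msm[of "\<ominus> \<one>", OF _ that] Mcl[OF that] by (simp add: B.smult_l_minus smult_l_minus)
  have Msub: "(b \<ominus>\<^bsub>B\<^esub> b', e \<ominus>\<^bsub>E\<^esub> e') \<in> M" if "(b, e) \<in> M" "(b', e') \<in> M" for b e b' e'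
    using Madd[OF that(1) Mneg[OF that(2)]] by (simp add: a_minus_def)
  have Muniq: "e = e'" if "(b, e) \<in> M" "(b, e') \<in> M" for b e e'
  proof -
    have "(\<zero>\<^bsub>B\<^esub>, e \<ominus>\<^bsub>E\<^esub> e') \<in> M"
      using Msub[OF that] Mcl[OF that(1)] by (simp add: a_minus_def B.r_neg)
    then have "e \<ominus>\<^bsub>E\<^esub> e' = \<zero>\<^bsub>E\<^esub>" by (rule M0)
    then show ?thesis 
      using Mcl(2)[OF that(1)] Mcl(2)[OF that(2)] M.minus_equality[of e "\<ominus>\<^bsub>E\<^esub> e'"] by (simp add: a_minus_def)
  qed
  have tot: "\<exists>e. (b, e) \<in> M" if b: "b \<in> carrier B" for b
  proof -
    define I where "I = {r \<in> carrier R. \<exists>e. (r \<odot>\<^bsub>B\<^esub> b, e) \<in> M}"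
    define \<phi> where "\<phi> = (\<lambda>r. THE e. (r \<odot>\<^bsub>B\<^esub> b, e) \<in> M)"
    have \<phi>: "\<phi> r = e" if "(r \<odot>\<^bsub>B\<^esub> b, e) \<in> M" for r e
      unfolding \<phi>_def using that Muniq by blast
    define RM :: "('a, 'a) module" where "RM = \<lparr>carrier = carrier R, mult = mult R,
      one = \<one>, zero = \<zero>, add = add R, smult = mult R\<rparr>"
    have RM: "module R RM" unfolding RM_def by (rule ring_as_module)
    interpret RM: module R RM by (rule RM)
    have RMs: "carrier RM = carrier R" "\<zero>\<^bsub>RM\<^esub> = \<zero>" "(\<oplus>\<^bsub>RM\<^esub>) = (\<oplus>)" "(\<odot>\<^bsub>RM\<^esub>) = (\<otimes>)"
      by (simp_all add: RM_def)
    have Iadd: "r \<oplus> s \<in> I \<and> \<phi> (r \<oplus> s) = \<phi> r \<oplus>\<^bsub>E\<^esub> \<phi> s" if rs: "r \<in> I" "s \<in> I" for r s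
    proof -
      from rs obtain e e' where *: "(r \<odot>\<^bsub>B\<^esub> b, e) \<in> M" "(s \<odot>\<^bsub>B\<^esub> b, e') \<in> M" by (auto simp: I_def)
      have "((r \<oplus> s) \<odot>\<^bsub>B\<^esub> b, e \<oplus>\<^bsub>E\<^esub> e') \<in> M"
        using Madd[OF *] rs b by (simp add: I_def B.smult_l_distr)
      then show ?thesis using \<phi> * rs by (auto simp: I_def)
    qed
    have Ism: "r \<otimes> s \<in> I \<and> \<phi> (r \<otimes> s) = r \<odot>\<^bsub>E\<^esub> \<phi> s" if rs: "r \<in> carrier R" "s \<in> I" for r s
    proof -
      from rs obtain e where *: "(s \<odot>\<^bsub>B\<^esub> b, e) \<in> M" by (auto simp: I_def)
      have "((r \<otimes> s) \<odot>\<^bsub>B\<^esub> b, r \<odot>\<^bsub>E\<^esub> e) \<in> M"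
        using Msm[OF rs(1) *] rs b by (simp add: I_def B.smult_assoc1)
      then show ?thesis using \<phi> * rs by (auto simp: I_def)
    qed
    have "(\<zero> \<odot>\<^bsub>B\<^esub> b, \<zero>\<^bsub>E\<^esub>) \<in> M"
      using Mext[of "\<zero>\<^bsub>A\<^esub>"] f0 g0 b by simp
    then have I0: "\<zero> \<in> I" by (auto simp: I_def)
    have "submodule I R RM"
    proof (rule RM.submoduleI)
      show "\<ominus>\<^bsub>RM\<^esub> r \<in> I" if "r \<in> I" for r
      proof -
        have r: "r \<in> carrier R" using that by (simp add: I_def)
        have "\<ominus>\<^bsub>RM\<^esub> r = (\<ominus> \<one>) \<odot>\<^bsub>RM\<^esub> r"
          using r by (simp add: RM.smult_l_minus RMs(1) del: RMs(4))
        then show ?thesis using Ism[of "\<ominus> \<one>" r] that by (simp add: RMs)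
      qed
    qed (use Iadd Ism I0 in \<open>auto simp: RMs I_def\<close>)
    then have IM: "module R (RM\<lparr>carrier := I\<rparr>)"
      by (rule submodule.submodule_is_module) (rule RM)
    have "\<phi> \<in> mod_hom R (RM\<lparr>carrier := I\<rparr>) E"
      using Iadd Ism \<phi> Mcl(2) by (auto simp: mod_hom_def RMs) (auto simp: I_def)
    moreover have "(\<lambda>r. r) \<in> mod_hom R (RM\<lparr>carrier := I\<rparr>) RM"
      by (auto simp: mod_hom_def RMs I_def)
    ultimately obtain h where h: "h \<in> mod_hom R RM E" and h\<phi>: "\<And>r. r \<in> I \<Longrightarrow> h r = \<phi> r"
      using extension[OF IM RM, of "\<lambda>r. r" \<phi>] by auto
    define e0 where "e0 = h \<one>"
    have e0: "e0 \<in> carrier E" using h by (auto simp: mod_hom_def e0_def RMs)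
    have hr: "h r = r \<odot>\<^bsub>E\<^esub> e0" if "r \<in> carrier R" for r
    proof -
      have "h (r \<otimes> \<one>) = r \<odot>\<^bsub>E\<^esub> e0"
        using h that unfolding mod_hom_def e0_def RMs by blast
      then show ?thesis using that by simp
    qed
    define G where "G = {(x \<oplus>\<^bsub>B\<^esub> r \<odot>\<^bsub>B\<^esub> b, y \<oplus>\<^bsub>E\<^esub> r \<odot>\<^bsub>E\<^esub> e0) | x y r. (x, y) \<in> M \<and> r \<in> carrier R}"
    have GI: "(x \<oplus>\<^bsub>B\<^esub> r \<odot>\<^bsub>B\<^esub> b, y \<oplus>\<^bsub>E\<^esub> r \<odot>\<^bsub>E\<^esub> e0) \<in> G" if "(x, y) \<in> M" "r \<in> carrier R" for x y r
      using that by (auto simp: G_def)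
    have MG: "M \<subseteq> G"
    proof (rule subrelI)
      fix x y assume xy: "(x, y) \<in> M"
      show "(x, y) \<in> G" using GI[OF xy R.zero_closed] Mcl[OF xy] b e0 by simp
    qed
    have "adm G" unfolding adm_def
    proof (intro conjI ballI allI impI)
      show "G \<subseteq> carrier B \<times> carrier E" using Mcl b e0 by (auto simp: G_def)
    next
      fix x assume "x \<in> carrier A"
      then show "(f x, g x) \<in> G" using Mext MG by auto
    next
      fix u e u' e' assume "(u, e) \<in> G" "(u', e') \<in> G"
      then obtain x y r x' y' r' where
        *: "u = x \<oplus>\<^bsub>B\<^esub> r \<odot>\<^bsub>B\<^esub> b" "e = y \<oplus>\<^bsub>E\<^esub> r \<odot>\<^bsub>E\<^esub> e0" "(x, y) \<in> M" "r \<in> carrier R"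
          "u' = x' \<oplus>\<^bsub>B\<^esub> r' \<odot>\<^bsub>B\<^esub> b" "e' = y' \<oplus>\<^bsub>E\<^esub> r' \<odot>\<^bsub>E\<^esub> e0" "(x', y') \<in> M" "r' \<in> carrier R"
        by (auto simp: G_def)
      have "u \<oplus>\<^bsub>B\<^esub> u' = (x \<oplus>\<^bsub>B\<^esub> x') \<oplus>\<^bsub>B\<^esub> (r \<oplus> r') \<odot>\<^bsub>B\<^esub> b"
        using * Mcl b by (simp add: B.smult_l_distr B.a_ac)
      moreover have "e \<oplus>\<^bsub>E\<^esub> e' = (y \<oplus>\<^bsub>E\<^esub> y') \<oplus>\<^bsub>E\<^esub> (r \<oplus> r') \<odot>\<^bsub>E\<^esub> e0"
        using * Mcl e0 by (simp add: smult_l_distr M.a_ac)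
      ultimately show "(u \<oplus>\<^bsub>B\<^esub> u', e \<oplus>\<^bsub>E\<^esub> e') \<in> G"
        using GI Madd * by simp
    next
      fix s u e assume s: "s \<in> carrier R" and "(u, e) \<in> G"
      then obtain x y r where
        *: "u = x \<oplus>\<^bsub>B\<^esub> r \<odot>\<^bsub>B\<^esub> b" "e = y \<oplus>\<^bsub>E\<^esub> r \<odot>\<^bsub>E\<^esub> e0" "(x, y) \<in> M" "r \<in> carrier R"
        by (auto simp: G_def)
      have "s \<odot>\<^bsub>B\<^esub> u = s \<odot>\<^bsub>B\<^esub> x \<oplus>\<^bsub>B\<^esub> (s \<otimes> r) \<odot>\<^bsub>B\<^esub> b" "s \<odot>\<^bsub>E\<^esub> e = s \<odot>\<^bsub>E\<^esub> y \<oplus>\<^bsub>E\<^esub> (s \<otimes> r) \<odot>\<^bsub>E\<^esub> e0"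
        using * Mcl b e0 s
        by (simp_all add: B.smult_r_distr B.smult_assoc1 smult_r_distr smult_assoc1)
      then show "(s \<odot>\<^bsub>B\<^esub> u, s \<odot>\<^bsub>E\<^esub> e) \<in> G"
        using GI[OF Msm[OF s *(3)]] s * by simp
    next
      fix e assume "(\<zero>\<^bsub>B\<^esub>, e) \<in> G"
      then obtain x y r where
        *: "\<zero>\<^bsub>B\<^esub> = x \<oplus>\<^bsub>B\<^esub> r \<odot>\<^bsub>B\<^esub> b" "e = y \<oplus>\<^bsub>E\<^esub> r \<odot>\<^bsub>E\<^esub> e0" "(x, y) \<in> M" "r \<in> carrier R"
        by (auto simp: G_def)
      have "r \<odot>\<^bsub>B\<^esub> b = \<ominus>\<^bsub>B\<^esub> x"
        using * b Mcl by (metis B.a_comm B.minus_equality B.smult_closed)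
      then have "(r \<odot>\<^bsub>B\<^esub> b, \<ominus>\<^bsub>E\<^esub> y) \<in> M" using Mneg * by simp
      then have "r \<in> I" "\<phi> r = \<ominus>\<^bsub>E\<^esub> y" using * \<phi> by (auto simp: I_def)
      then have "r \<odot>\<^bsub>E\<^esub> e0 = \<ominus>\<^bsub>E\<^esub> y" using h\<phi> hr *(4) by metis
      then show "e = \<zero>\<^bsub>E\<^esub>" using * Mcl by (simp add: M.r_neg)
    qed
    then have "G = M" using max MG by blast
    moreover have "(\<zero>\<^bsub>B\<^esub>, \<zero>\<^bsub>E\<^esub>) \<in> M" using Mext[of "\<zero>\<^bsub>A\<^esub>"] f0 g0 by simp
    then have "(b, e0) \<in> G" using GI[of "\<zero>\<^bsub>B\<^esub>" "\<zero>\<^bsub>E\<^esub>" \<one>] b e0 by simp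
    ultimately show ?thesis by auto
  qed
  define h where "h = (\<lambda>b. THE e. (b, e) \<in> M)"
  have hM: "h b = e" if "(b, e) \<in> M" for b e
    unfolding h_def using that Muniq by blast
  have "h \<in> mod_hom R B E" unfolding mod_hom_def
  proof (intro CollectI conjI ballI funcsetI)
    fix b assume "b \<in> carrier B"
    with tot obtain e where "(b, e) \<in> M" by blast
    then show "h b \<in> carrier E" using hM Mcl by auto
  next
    fix b b' assume "b \<in> carrier B" "b' \<in> carrier B"
    with tot obtain e e' where "(b, e) \<in> M" "(b', e') \<in> M" by blast
    then show "h (b \<oplus>\<^bsub>B\<^esub> b') = h b \<oplus>\<^bsub>E\<^esub> h b'" using hM Madd by metis
  next
    fix r b assume r: "r \<in> carrier R" and "b \<in> carrier B"
    with tot obtain e where "(b, e) \<in> M" by blast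
    then show "h (r \<odot>\<^bsub>B\<^esub> b) = r \<odot>\<^bsub>E\<^esub> h b" using hM Msm[OF r] by metis
  qed
  then show ?thesis using hM Mext by blast
qed


section \<open>Local cohomology\<close>

locale injective_resolution = N: module R N
  for R :: "('a, 'm) ring_scheme" and N :: "('a, 'b, 'n) module_scheme"
    and E :: "nat \<Rightarrow> ('a, 'c) module" and d :: "nat \<Rightarrow> 'c \<Rightarrow> 'c" and \<epsilon> :: "'b \<Rightarrow> 'c" +
  assumes injective: "injective_module R (E i)"
    and augmentation_hom: "\<epsilon> \<in> mod_hom R N (E 0)"
    and differential_hom: "d i \<in> mod_hom R (E i) (E (Suc i))"
    and augmentation_inj: "inj_on \<epsilon> (carrier N)"
    and exact_0: "a_kernel (E 0) (E (Suc 0)) (d 0) = \<epsilon> ` carrier N"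
    and exact_Suc: "a_kernel (E (Suc i)) (E (Suc (Suc i))) (d (Suc i)) = d i ` carrier (E i)"

text \<open>The \<open>a\<close>-torsion functor: the submodule of all elements killed by some power \<open>a\<^sup>n\<close>
  of the ideal \<open>a\<close>.\<close>

definition torsion_module ::
  "('a, 'm) ring_scheme \<Rightarrow> 'a set \<Rightarrow> ('a, 'b, 'n) module_scheme \<Rightarrow> ('a, 'b, 'n) module_scheme"
  where "torsion_module R a M =
    M\<lparr>carrier := {x \<in> carrier M. \<exists>n::nat. \<forall>r \<in> a [^]\<^bsub>ideals_set R\<^esub> n. r \<odot>\<^bsub>M\<^esub> x = \<zero>\<^bsub>M\<^esub>}\<rparr>"

definition coboundaries :: "(nat \<Rightarrow> ('a, 'c) module) \<Rightarrow> (nat \<Rightarrow> 'c \<Rightarrow> 'c) \<Rightarrow> nat \<Rightarrow> 'c set"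
  where "coboundaries C d i =
    (case i of 0 \<Rightarrow> {\<zero>\<^bsub>C 0\<^esub>} | Suc j \<Rightarrow> d j ` carrier (C j))"

definition cohomology ::
  "(nat \<Rightarrow> ('a, 'c) module) \<Rightarrow> (nat \<Rightarrow> 'c \<Rightarrow> 'c) \<Rightarrow> nat \<Rightarrow> ('a, 'c set) module"
  where "cohomology C d i =
    quot_module ((C i)\<lparr>carrier := a_kernel (C i) (C (Suc i)) (d i)\<rparr>) (coboundaries C d i)"

text \<open>The right derived functors of the \<open>a\<close>-torsion functor.  For an injective resolution
  \<open>(E, d)\<close> of \<open>N\<close> this is \<open>H\<^sup>i\<^sub>a(N)\<close>; up to isomorphism it does not depend on the resolution.\<close>

definition local_cohomology ::
  "('a, 'm) ring_scheme \<Rightarrow> 'a set \<Rightarrow> (nat \<Rightarrow> ('a, 'c) module) \<Rightarrow> (nat \<Rightarrow> 'c \<Rightarrow> 'c) \<Rightarrow> nat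
    \<Rightarrow> ('a, 'c set) module"
  where "local_cohomology R a E d i = cohomology (\<lambda>j. torsion_module R a (E j)) d i"

end

theory Submission
  imports Defs
begin

text \<open>Write \<open>\<Gamma>\<close> for the \<open>a\<close>-torsion functor.  The usual proof is by induction on \<open>dim N\<close>.  Dividing by
  \<open>\<Gamma>N\<close> does not change \<open>H\<^sup>i\<^sub>a\<close> for \<open>i > 0\<close>, so \<open>N\<close> may be assumed torsion-free; as \<open>N\<close> has finitely
  many associated primes and none of them contains \<open>a\<close>, prime avoidance yields an \<open>x \<in> a\<close> that is regular on
  \<open>N\<close>.  The long exact sequence of \<open>0 \<rightarrow> N \<rightarrow> N \<rightarrow> N/xN \<rightarrow> 0\<close> shows that \<open>H\<^sup>i\<^sub>a(N/xN)\<close> is Artinian for \<open>i > t\<close>, so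
  by induction \<open>H\<^sup>t\<^sub>a(N/xN)/aH\<^sup>t\<^sub>a(N/xN)\<close> is Artinian.  Since \<open>H\<^sup>t\<^sub>a(N)/xH\<^sup>t\<^sub>a(N)\<close> is a submodule of \<open>H\<^sup>t\<^sub>a(N/xN)\<close>
  with Artinian quotient, and \<open>Tor\<^sub>1(R/a, K)\<close> is Artinian for Artinian \<open>K\<close>, the claim for \<open>N\<close> follows.

  This argument needs injective resolutions of the successive quotients of \<open>N\<close>.  They are avoided by
  passing to the derived category: the given resolution \<open>X\<close> stays, and \<open>N/xN\<close> is replaced by the mapping
  cone of multiplication by \<open>x\<close> on \<open>X\<close>, which is again a complex of injective modules.  The induction
  therefore runs over complexes \<open>X\<close> of injective modules and an index \<open>s < t\<close> such that \<open>H\<^sup>j(X)\<close> is torsion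
  for \<open>j < s\<close> and zero for \<open>j > s\<close>, while \<open>H\<^sup>s(X)\<close> is weakly Laskerian (lemma
  \<open>reduced_torsion_cohomology_artinian\<close>).  Torsion need not be divided out: it is enough that \<open>x\<close> avoids the
  associated primes of \<open>H\<^sup>s(X)\<close> that do not contain \<open>a\<close>, for then the elements killed by \<open>x\<close> are torsion
  (\<open>torsion_mod_if_killed\<close>).  The induction is on the length of chains in the support of \<open>H\<^sup>s(X)\<close> that
  start outside \<open>V(a)\<close>, which the dimension of \<open>N\<close> bounds at the outset; passing from \<open>H\<^sup>s(X)\<close> to \<open>H\<^sup>s(X)/xH\<^sup>s(X)\<close> shortens them
  (\<open>chains_below_quotient\<close>).

  When no chain is left, all cohomology of \<open>X\<close> is torsion, and then \<open>\<Gamma>X\<close> has the same cohomology as \<open>X\<close>,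
  which vanishes in degree \<open>t > s\<close> (\<open>torsion_exact\<close>).  This rests on the fact that over a Noetherian ring the
  torsion submodule of an injective module is a direct summand (\<open>torsion_complement\<close>).

  Quotient modules hardly occur: a statement about \<open>L/K\<close> is made for the pair of submodules
  \<open>K \<subseteq> L\<close>, and all comparisons are instances of one notion of subquotient, which transports
  chain conditions, associated primes and supports alike.\<close>

section \<open>Submodules and linear relations\<close>

context module
begin

lemma submodule_iff:
  "submodule K R M \<longleftrightarrow> K \<subseteq> carrier M \<and> \<zero>\<^bsub>M\<^esub> \<in> K \<and>
    (\<forall>x\<in>K. \<forall>y\<in>K. x \<oplus>\<^bsub>M\<^esub> y \<in> K) \<and> (\<forall>r\<in>carrier R. \<forall>x\<in>K. r \<odot>\<^bsub>M\<^esub> x \<in> K)"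
proof (intro iffI conjI ballI)
  assume K: "submodule K R M"
  show "\<zero>\<^bsub>M\<^esub> \<in> K"
    using submodule.axioms(1)[OF K] subgroup.one_closed by fastforce
next
  assume *: "K \<subseteq> carrier M \<and> \<zero>\<^bsub>M\<^esub> \<in> K \<and> (\<forall>x\<in>K. \<forall>y\<in>K. x \<oplus>\<^bsub>M\<^esub> y \<in> K) \<and>
    (\<forall>r\<in>carrier R. \<forall>x\<in>K. r \<odot>\<^bsub>M\<^esub> x \<in> K)"
  have "\<ominus>\<^bsub>M\<^esub> x \<in> K" if "x \<in> K" for x
  proof -
    have "(\<ominus> \<one>) \<odot>\<^bsub>M\<^esub> x \<in> K" using * that by blast
    moreover have "x \<in> carrier M" using * that by blast
    ultimately show ?thesis by (simp add: smult_l_minus)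
  qed
  then show "submodule K R M" using * by (intro submoduleI) auto
qed (use submoduleE in auto)

lemma submodule_mem:
  assumes "submodule K R M"
  shows "x \<in> K \<Longrightarrow> x \<in> carrier M" "\<zero>\<^bsub>M\<^esub> \<in> K"
    "x \<in> K \<Longrightarrow> y \<in> K \<Longrightarrow> x \<oplus>\<^bsub>M\<^esub> y \<in> K" "x \<in> K \<Longrightarrow> y \<in> K \<Longrightarrow> x \<ominus>\<^bsub>M\<^esub> y \<in> K"
    "r \<in> carrier R \<Longrightarrow> x \<in> K \<Longrightarrow> r \<odot>\<^bsub>M\<^esub> x \<in> K"
  using assms submoduleE[OF assms] by (auto simp: submodule_iff a_minus_def)

lemma diff_add_cancel [simp]:
  assumes "x \<in> carrier M" "y \<in> carrier M"
  shows "(x \<ominus>\<^bsub>M\<^esub> y) \<oplus>\<^bsub>M\<^esub> y = x" "(x \<oplus>\<^bsub>M\<^esub> y) \<ominus>\<^bsub>M\<^esub> y = x" "y \<oplus>\<^bsub>M\<^esub> (x \<ominus>\<^bsub>M\<^esub> y) = x"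
    "(y \<oplus>\<^bsub>M\<^esub> x) \<ominus>\<^bsub>M\<^esub> y = x"
  using assms by (auto simp: a_minus_def M.a_assoc M.l_neg M.r_neg M.a_comm[of y] M.r_neg2)

lemma diff_eq_iff:
  assumes "x \<in> carrier M" "y \<in> carrier M" "z \<in> carrier M"
  shows "x \<ominus>\<^bsub>M\<^esub> y = z \<longleftrightarrow> x = z \<oplus>\<^bsub>M\<^esub> y"
  using assms by auto

lemma diff_self [simp]: "x \<in> carrier M \<Longrightarrow> x \<ominus>\<^bsub>M\<^esub> x = \<zero>\<^bsub>M\<^esub>"
  by (simp add: diff_eq_iff)

lemma diff_zero [simp]: "x \<in> carrier M \<Longrightarrow> x \<ominus>\<^bsub>M\<^esub> \<zero>\<^bsub>M\<^esub> = x"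
  by (simp add: diff_eq_iff)

lemma smult_r_diff:
  assumes "r \<in> carrier R" "x \<in> carrier M" "y \<in> carrier M"
  shows "r \<odot>\<^bsub>M\<^esub> (x \<ominus>\<^bsub>M\<^esub> y) = r \<odot>\<^bsub>M\<^esub> x \<ominus>\<^bsub>M\<^esub> r \<odot>\<^bsub>M\<^esub> y"
  using assms by (simp add: a_minus_def smult_r_distr smult_r_minus)

lemma smult_commute:
  assumes "r \<in> carrier R" "s \<in> carrier R" "x \<in> carrier M"
  shows "r \<odot>\<^bsub>M\<^esub> (s \<odot>\<^bsub>M\<^esub> x) = s \<odot>\<^bsub>M\<^esub> (r \<odot>\<^bsub>M\<^esub> x)"
  using assms by (simp add: smult_assoc1[symmetric] R.m_comm)

lemma submodule_zero: "submodule {\<zero>\<^bsub>M\<^esub>} R M"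
  by (auto simp: submodule_iff)

lemma submodule_Int:
  "submodule K R M \<Longrightarrow> submodule L R M \<Longrightarrow> submodule (K \<inter> L) R M"
  by (auto simp: submodule_iff)

lemma set_addI: "k \<in> K \<Longrightarrow> l \<in> L \<Longrightarrow> k \<oplus>\<^bsub>M\<^esub> l \<in> K <+>\<^bsub>M\<^esub> L"
  by (auto simp: set_add_def')

lemma set_addE:
  assumes "x \<in> K <+>\<^bsub>M\<^esub> L"
  obtains k l where "k \<in> K" "l \<in> L" "x = k \<oplus>\<^bsub>M\<^esub> l"
  using assms by (auto simp: set_add_def')

lemma submodule_set_add:
  assumes K: "submodule K R M" and L: "submodule L R M"
  shows "submodule (K <+>\<^bsub>M\<^esub> L) R M"
proof -
  note mem = submodule_mem[OF K] submodule_mem[OF L]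
  have "\<zero>\<^bsub>M\<^esub> \<in> K <+>\<^bsub>M\<^esub> L"
    using set_addI[OF mem(2,7)] by simp
  moreover have "u \<oplus>\<^bsub>M\<^esub> v \<in> K <+>\<^bsub>M\<^esub> L" if uv: "u \<in> K <+>\<^bsub>M\<^esub> L" "v \<in> K <+>\<^bsub>M\<^esub> L" for u v
  proof -
    obtain k l where *: "k \<in> K" "l \<in> L" "u = k \<oplus>\<^bsub>M\<^esub> l" using uv(1) by (rule set_addE)
    obtain k' l' where **: "k' \<in> K" "l' \<in> L" "v = k' \<oplus>\<^bsub>M\<^esub> l'" using uv(2) by (rule set_addE)
    have "u \<oplus>\<^bsub>M\<^esub> v = (k \<oplus>\<^bsub>M\<^esub> k') \<oplus>\<^bsub>M\<^esub> (l \<oplus>\<^bsub>M\<^esub> l')"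
      using * ** mem(1,6) by (simp add: M.a_ac)
    then show ?thesis using * ** mem(3,8) by (simp add: set_addI)
  qed
  moreover have "r \<odot>\<^bsub>M\<^esub> u \<in> K <+>\<^bsub>M\<^esub> L" if r: "r \<in> carrier R" and u: "u \<in> K <+>\<^bsub>M\<^esub> L" for r u
  proof -
    obtain k l where "k \<in> K" "l \<in> L" "u = k \<oplus>\<^bsub>M\<^esub> l" using u by (rule set_addE)
    then show ?thesis using r mem by (simp add: smult_r_distr set_addI)
  qed
  moreover have "K <+>\<^bsub>M\<^esub> L \<subseteq> carrier M"
    using mem(1,6) by (auto simp: set_add_def')
  ultimately show ?thesis
    by (simp add: submodule_iff)
qed

lemma set_add_ge1:
  assumes K: "submodule K R M" and L: "submodule L R M"
  shows "K \<subseteq> K <+>\<^bsub>M\<^esub> L"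
proof
  fix x assume "x \<in> K"
  then have "x \<oplus>\<^bsub>M\<^esub> \<zero>\<^bsub>M\<^esub> \<in> K <+>\<^bsub>M\<^esub> L" using submodule_mem(2)[OF L] by (rule set_addI)
  then show "x \<in> K <+>\<^bsub>M\<^esub> L" using submodule_mem(1)[OF K \<open>x \<in> K\<close>] by simp
qed

lemma set_add_ge2:
  assumes K: "submodule K R M" and L: "submodule L R M"
  shows "L \<subseteq> K <+>\<^bsub>M\<^esub> L"
proof
  fix x assume "x \<in> L"
  with submodule_mem(2)[OF K] have "\<zero>\<^bsub>M\<^esub> \<oplus>\<^bsub>M\<^esub> x \<in> K <+>\<^bsub>M\<^esub> L" by (rule set_addI)
  then show "x \<in> K <+>\<^bsub>M\<^esub> L" using submodule_mem(1)[OF L \<open>x \<in> L\<close>] by simp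
qed

lemma set_add_least:
  assumes P: "submodule P R M" and "K \<subseteq> P" "L \<subseteq> P"
  shows "K <+>\<^bsub>M\<^esub> L \<subseteq> P"
  using assms(2,3) submodule_mem(3)[OF P] by (auto simp: set_add_def')

end

definition lin_rel ::
  "('a, 'm) ring_scheme \<Rightarrow> ('a, 'b, 'n) module_scheme \<Rightarrow> ('a, 'c, 'k) module_scheme \<Rightarrow>
    ('b \<times> 'c) set \<Rightarrow> bool"
  where "lin_rel R M M' G \<longleftrightarrow> G \<subseteq> carrier M \<times> carrier M' \<and> (\<zero>\<^bsub>M\<^esub>, \<zero>\<^bsub>M'\<^esub>) \<in> G \<and>
    (\<forall>x y x' y'. (x, y) \<in> G \<longrightarrow> (x', y') \<in> G \<longrightarrow> (x \<oplus>\<^bsub>M\<^esub> x', y \<oplus>\<^bsub>M'\<^esub> y') \<in> G) \<and>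
    (\<forall>r\<in>carrier R. \<forall>x y. (x, y) \<in> G \<longrightarrow> (r \<odot>\<^bsub>M\<^esub> x, r \<odot>\<^bsub>M'\<^esub> y) \<in> G)"

lemma lin_relD:
  assumes "lin_rel R M M' G"
  shows "(x, y) \<in> G \<Longrightarrow> x \<in> carrier M" "(x, y) \<in> G \<Longrightarrow> y \<in> carrier M'"
    "(\<zero>\<^bsub>M\<^esub>, \<zero>\<^bsub>M'\<^esub>) \<in> G"
    "(x, y) \<in> G \<Longrightarrow> (x', y') \<in> G \<Longrightarrow> (x \<oplus>\<^bsub>M\<^esub> x', y \<oplus>\<^bsub>M'\<^esub> y') \<in> G"
    "r \<in> carrier R \<Longrightarrow> (x, y) \<in> G \<Longrightarrow> (r \<odot>\<^bsub>M\<^esub> x, r \<odot>\<^bsub>M'\<^esub> y) \<in> G"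
  using assms unfolding lin_rel_def by blast+

lemma lin_rel_diff:
  assumes "module R M" "module R M'" "lin_rel R M M' G" "(x, y) \<in> G" "(x', y') \<in> G"
  shows "(x \<ominus>\<^bsub>M\<^esub> x', y \<ominus>\<^bsub>M'\<^esub> y') \<in> G"
proof -
  interpret M: module R M by fact
  interpret M': module R M' by fact
  note G = lin_relD[OF assms(3)]
  have "((\<ominus>\<^bsub>R\<^esub> \<one>\<^bsub>R\<^esub>) \<odot>\<^bsub>M\<^esub> x', (\<ominus>\<^bsub>R\<^esub> \<one>\<^bsub>R\<^esub>) \<odot>\<^bsub>M'\<^esub> y') \<in> G"
    using assms by (intro G) auto
  then have "(\<ominus>\<^bsub>M\<^esub> x', \<ominus>\<^bsub>M'\<^esub> y') \<in> G"
    using G(1,2)[OF assms(5)] by (simp add: M.smult_l_minus M'.smult_l_minus)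
  then show ?thesis unfolding a_minus_def using assms(4) by (rule G(4)[rotated])
qed

lemma submodule_preimage:
  assumes "module R M" "module R M'" and G: "lin_rel R M M' G"
    and L: "submodule L R M" and S: "submodule S R M'"
  shows "submodule {x \<in> L. \<exists>y\<in>S. (x, y) \<in> G} R M"
proof -
  interpret M: module R M by fact
  interpret M': module R M' by fact
  note Lmem = M.submodule_mem[OF L] and Smem = M'.submodule_mem[OF S]
  show ?thesis
    unfolding M.submodule_iff
  proof (intro conjI ballI)
    show "{x \<in> L. \<exists>y\<in>S. (x, y) \<in> G} \<subseteq> carrier M" using Lmem(1) by blast
    show "\<zero>\<^bsub>M\<^esub> \<in> {x \<in> L. \<exists>y\<in>S. (x, y) \<in> G}" using Lmem(2) Smem(2) lin_relD(3)[OF G] by blast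
  next
    fix u v assume "u \<in> {x \<in> L. \<exists>y\<in>S. (x, y) \<in> G}" "v \<in> {x \<in> L. \<exists>y\<in>S. (x, y) \<in> G}"
    then obtain y z where *: "u \<in> L" "v \<in> L" "y \<in> S" "(u, y) \<in> G" "z \<in> S" "(v, z) \<in> G" by blast
    then show "u \<oplus>\<^bsub>M\<^esub> v \<in> {x \<in> L. \<exists>y\<in>S. (x, y) \<in> G}"
      using Lmem(3) Smem(3)[OF *(3,5)] lin_relD(4)[OF G *(4,6)] by blast
  next
    fix r u assume r: "r \<in> carrier R" and "u \<in> {x \<in> L. \<exists>y\<in>S. (x, y) \<in> G}"
    then obtain y where *: "u \<in> L" "y \<in> S" "(u, y) \<in> G" by blast
    then show "r \<odot>\<^bsub>M\<^esub> u \<in> {x \<in> L. \<exists>y\<in>S. (x, y) \<in> G}"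
      using Lmem(5)[OF r] Smem(5)[OF r *(2)] lin_relD(5)[OF G r *(3)] by blast
  qed
qed

definition interval ::
  "('a, 'm) ring_scheme \<Rightarrow> ('a, 'b, 'n) module_scheme \<Rightarrow> 'b set \<Rightarrow> 'b set \<Rightarrow> bool"
  where "interval R M K L \<longleftrightarrow> module R M \<and> submodule K R M \<and> submodule L R M \<and> K \<subseteq> L"

text \<open>The module \<open>L'/K'\<close> is a quotient of a submodule of \<open>L/K\<close>, as witnessed by an additive
  relation.  Speaking of relations between intervals of submodules instead of maps between quotient
  modules covers submodules, quotients and connecting homomorphisms at once, and no cosets have to
  be handled.\<close>

definition subquotient ::
  "('a, 'm) ring_scheme \<Rightarrow> ('a, 'b, 'n) module_scheme \<Rightarrow> 'b set \<Rightarrow> 'b set \<Rightarrow>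
    ('a, 'c, 'k) module_scheme \<Rightarrow> 'c set \<Rightarrow> 'c set \<Rightarrow> bool"
  where "subquotient R M K L M' K' L' \<longleftrightarrow> interval R M K L \<and> interval R M' K' L' \<and>
    (\<exists>G. lin_rel R M M' G \<and> (\<forall>y\<in>L'. \<exists>x\<in>L. (x, y) \<in> G) \<and>
      (\<forall>x y. (x, y) \<in> G \<longrightarrow> x \<in> K \<longrightarrow> y \<in> L' \<longrightarrow> y \<in> K'))"

lemma subquotientI:
  assumes "interval R M K L" "interval R M' K' L'" "lin_rel R M M' G"
    "\<And>y. y \<in> L' \<Longrightarrow> \<exists>x\<in>L. (x, y) \<in> G"
    "\<And>x y. (x, y) \<in> G \<Longrightarrow> x \<in> K \<Longrightarrow> y \<in> L' \<Longrightarrow> y \<in> K'"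
  shows "subquotient R M K L M' K' L'"
  using assms unfolding subquotient_def by blast

lemma subquotient_same:
  assumes "interval R M K L" "interval R M K' L'" "L' \<subseteq> L" "K \<inter> L' \<subseteq> K'"
  shows "subquotient R M K L M K' L'"
proof (rule subquotientI[where G = "{(x, x) | x. x \<in> carrier M}"])
  interpret module R M using assms(1) by (simp add: interval_def)
  show "lin_rel R M M {(x, x) | x. x \<in> carrier M}" by (auto simp: lin_rel_def)
  show "\<exists>x\<in>L. (x, y) \<in> {(x, x) | x. x \<in> carrier M}" if "y \<in> L'" for y
    using that assms submodule_mem(1)[of L y] by (auto simp: interval_def)
qed (use assms in auto)

section \<open>Artinian intervals of submodules\<close>

definition artinian_between ::
  "('a, 'm) ring_scheme \<Rightarrow> ('a, 'b, 'n) module_scheme \<Rightarrow> 'b set \<Rightarrow> 'b set \<Rightarrow> bool"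
  where "artinian_between R M K L \<longleftrightarrow>
    (\<forall>S. (\<forall>n::nat. submodule (S n) R M \<and> K \<subseteq> S n \<and> S n \<subseteq> L \<and> S (Suc n) \<subseteq> S n) \<longrightarrow>
      (\<exists>n. \<forall>m\<ge>n. S m = S n))"

lemma artinian_between_same: "artinian_between R M K K"
  unfolding artinian_between_def by blast

text \<open>A descending chain in \<open>L'/K'\<close> is pulled back along the relation to a chain in \<open>L/K\<close>, from which it can be
  recovered.\<close>

lemma artinian_between_subquotient:
  assumes art: "artinian_between R M K L" and sq: "subquotient R M K L M' K' L'"
  shows "artinian_between R M' K' L'"
  unfolding artinian_between_def
proof (intro allI impI)
  fix S :: "nat \<Rightarrow> _"
  assume "\<forall>n. submodule (S n) R M' \<and> K' \<subseteq> S n \<and> S n \<subseteq> L' \<and> S (Suc n) \<subseteq> S n"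
  then have S: "submodule (S n) R M'" "K' \<subseteq> S n" "S n \<subseteq> L'" "S (Suc n) \<subseteq> S n" for n
    by auto
  obtain G where G: "lin_rel R M M' G" and tot: "\<And>y. y \<in> L' \<Longrightarrow> \<exists>x\<in>L. (x, y) \<in> G"
    and KK': "\<And>x y. (x, y) \<in> G \<Longrightarrow> x \<in> K \<Longrightarrow> y \<in> L' \<Longrightarrow> y \<in> K'"
    using sq unfolding subquotient_def by blast
  have i: "module R M" "submodule K R M" "submodule L R M" "K \<subseteq> L" "module R M'" "submodule L' R M'"
    using sq by (auto simp: subquotient_def interval_def)
  interpret M: module R M by fact
  interpret M': module R M' by fact
  note G' = lin_relD[OF G]
  note Kmem = M.submodule_mem[OF i(2)] and Lmem = M.submodule_mem[OF i(3)]
    and Smem = M'.submodule_mem[OF S(1)]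
  have dec: "S m \<subseteq> S n" if "n \<le> m" for n m
    using that S(4) by (rule lift_Suc_antimono_le[rotated])
  define T where "T n = {x \<in> L. \<exists>y\<in>S n. (x, y) \<in> G} <+>\<^bsub>M\<^esub> K" for n
  have sub: "submodule {x \<in> L. \<exists>y\<in>S n. (x, y) \<in> G} R M" for n
    by (rule submodule_preimage[OF i(1,5) G i(3) S(1)])
  have "\<exists>n. \<forall>m\<ge>n. T m = T n"
  proof -
    have "submodule (T n) R M \<and> K \<subseteq> T n \<and> T n \<subseteq> L \<and> T (Suc n) \<subseteq> T n" for n
    proof (intro conjI)
      show "submodule (T n) R M" unfolding T_def by (rule M.submodule_set_add[OF sub i(2)])
      show "K \<subseteq> T n" unfolding T_def by (rule M.set_add_ge2[OF sub i(2)])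
      show "T n \<subseteq> L" unfolding T_def using i by (intro M.set_add_least) auto
      show "T (Suc n) \<subseteq> T n" unfolding T_def set_add_def' using S(4)[of n] by blast
    qed
    then show ?thesis using art unfolding artinian_between_def by blast
  qed
  then obtain n where n: "\<And>m. m \<ge> n \<Longrightarrow> T m = T n" by blast
  have "S n \<subseteq> S m" if m: "m \<ge> n" for m
  proof
    fix y assume y: "y \<in> S n"
    then obtain x where x: "x \<in> L" "(x, y) \<in> G" using tot S(3) by blast
    then have "x \<in> T n" unfolding T_def using y M.set_add_ge1[OF sub i(2), of n] by blast
    then have "x \<in> T m" using n[OF m] by simp
    then obtain z k y' where z: "z \<in> L" "k \<in> K" "x = z \<oplus>\<^bsub>M\<^esub> k" "y' \<in> S m" "(z, y') \<in> G"
      unfolding T_def set_add_def' by blast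
    have cl: "z \<in> carrier M" "k \<in> carrier M" "y \<in> carrier M'" "y' \<in> carrier M'"
      using z x G' Lmem Kmem by auto
    have "(x \<ominus>\<^bsub>M\<^esub> z, y \<ominus>\<^bsub>M'\<^esub> y') \<in> G"
      by (rule lin_rel_diff[OF i(1) i(5) G x(2) z(5)])
    moreover have "x \<ominus>\<^bsub>M\<^esub> z = k" using z cl by simp
    moreover have "y \<ominus>\<^bsub>M'\<^esub> y' \<in> L'"
      using y z(4) S(3) M'.submodule_mem(4)[OF i(6)] by blast
    ultimately have "y \<ominus>\<^bsub>M'\<^esub> y' \<in> K'" using KK' z(2) by auto
    then have "(y \<ominus>\<^bsub>M'\<^esub> y') \<oplus>\<^bsub>M'\<^esub> y' \<in> S m" using S(2) z(4) Smem(3) by blast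
    then show "y \<in> S m" using cl by simp
  qed
  then show "\<exists>n. \<forall>m\<ge>n. S m = S n" using dec by blast
qed

text \<open>By the modular law, a chain member \<open>S\<close> is determined among its own submodules by \<open>S \<inter> L\<close> and \<open>S + L\<close>.\<close>

lemma artinian_between_trans:
  assumes KL: "artinian_between R M K L" and LP: "artinian_between R M L P"
    and i: "interval R M K L" "interval R M L P"
  shows "artinian_between R M K P"
  unfolding artinian_between_def
proof (intro allI impI)
  fix S :: "nat \<Rightarrow> _"
  assume "\<forall>n. submodule (S n) R M \<and> K \<subseteq> S n \<and> S n \<subseteq> P \<and> S (Suc n) \<subseteq> S n"
  then have S: "submodule (S n) R M" "K \<subseteq> S n" "S n \<subseteq> P" "S (Suc n) \<subseteq> S n" for n
    by auto
  have i': "module R M" "submodule K R M" "submodule L R M" "K \<subseteq> L" "submodule P R M" "L \<subseteq> P"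
    using i by (auto simp: interval_def)
  interpret M: module R M by fact
  have dec: "S m \<subseteq> S n" if "n \<le> m" for n m
    using that S(4) by (rule lift_Suc_antimono_le[rotated])
  have "submodule (S n \<inter> L) R M \<and> K \<subseteq> S n \<inter> L \<and> S n \<inter> L \<subseteq> L \<and> S (Suc n) \<inter> L \<subseteq> S n \<inter> L" for n
    using S i' M.submodule_Int by blast
  then obtain n1 where n1: "\<And>m. m \<ge> n1 \<Longrightarrow> S m \<inter> L = S n1 \<inter> L"
    using KL[unfolded artinian_between_def, rule_format, of "\<lambda>n. S n \<inter> L"] by blast
  have "submodule (S n <+>\<^bsub>M\<^esub> L) R M \<and> L \<subseteq> S n <+>\<^bsub>M\<^esub> L \<and> S n <+>\<^bsub>M\<^esub> L \<subseteq> P \<and>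
    S (Suc n) <+>\<^bsub>M\<^esub> L \<subseteq> S n <+>\<^bsub>M\<^esub> L" for n
  proof (intro conjI)
    show "submodule (S n <+>\<^bsub>M\<^esub> L) R M" by (rule M.submodule_set_add[OF S(1) i'(3)])
    show "L \<subseteq> S n <+>\<^bsub>M\<^esub> L" by (rule M.set_add_ge2[OF S(1) i'(3)])
    show "S n <+>\<^bsub>M\<^esub> L \<subseteq> P" by (rule M.set_add_least[OF i'(5) S(3) i'(6)])
    show "S (Suc n) <+>\<^bsub>M\<^esub> L \<subseteq> S n <+>\<^bsub>M\<^esub> L"
      unfolding set_add_def' using S(4)[of n] by blast
  qed
  then obtain n2 where n2: "\<And>m. m \<ge> n2 \<Longrightarrow> S m <+>\<^bsub>M\<^esub> L = S n2 <+>\<^bsub>M\<^esub> L"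
    using LP[unfolded artinian_between_def, rule_format, of "\<lambda>n. S n <+>\<^bsub>M\<^esub> L"] by blast
  define n where "n = max n1 n2"
  have "S n \<subseteq> S m" if m: "m \<ge> n" for m
  proof
    fix x assume x: "x \<in> S n"
    have "S n <+>\<^bsub>M\<^esub> L = S m <+>\<^bsub>M\<^esub> L" using n2[of n] n2[of m] m by (simp add: n_def)
    then have "x \<in> S m <+>\<^bsub>M\<^esub> L" using x M.set_add_ge1[OF S(1) i'(3)] by blast
    then obtain s l where sl: "s \<in> S m" "l \<in> L" "x = s \<oplus>\<^bsub>M\<^esub> l" by (auto simp: set_add_def')
    have cl: "s \<in> carrier M" "l \<in> carrier M" 
      using M.submodule_mem(1)[OF S(1) sl(1)] M.submodule_mem(1)[OF i'(3) sl(2)] by auto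
    have "s \<in> S n" using dec m sl by blast
    then have "x \<ominus>\<^bsub>M\<^esub> s \<in> S n" using M.submodule_mem(4)[OF S(1)] x by blast
    then have "l \<in> S n \<inter> L" using sl cl by simp
    also have "S n \<inter> L = S m \<inter> L" using n1[of n] n1[of m] m by (simp add: n_def)
    finally show "x \<in> S m" using sl M.submodule_mem(3)[OF S(1)] by blast
  qed
  then show "\<exists>n. \<forall>m\<ge>n. S m = S n" using dec by blast
qed

lemma (in cring) ideal_iff:
  "ideal I R \<longleftrightarrow> I \<subseteq> carrier R \<and> \<zero> \<in> I \<and> (\<forall>x\<in>I. \<forall>y\<in>I. x \<oplus> y \<in> I) \<and>
    (\<forall>r\<in>carrier R. \<forall>x\<in>I. r \<otimes> x \<in> I)"
proof
  assume "ideal I R"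
  then interpret ideal I R .
  show "I \<subseteq> carrier R \<and> \<zero> \<in> I \<and> (\<forall>x\<in>I. \<forall>y\<in>I. x \<oplus> y \<in> I) \<and> (\<forall>r\<in>carrier R. \<forall>x\<in>I. r \<otimes> x \<in> I)"
    using a_subset I_l_closed by auto
next
  assume *: "I \<subseteq> carrier R \<and> \<zero> \<in> I \<and> (\<forall>x\<in>I. \<forall>y\<in>I. x \<oplus> y \<in> I) \<and>
    (\<forall>r\<in>carrier R. \<forall>x\<in>I. r \<otimes> x \<in> I)"
  show "ideal I R"
  proof (rule idealI[OF ring_axioms])
    have "\<ominus> x \<in> I" if "x \<in> I" for x
    proof -
      have "(\<ominus> \<one>) \<otimes> x \<in> I" using * that by blast
      moreover have "x \<in> carrier R" using * that by blast
      ultimately show ?thesis by (simp add: l_minus)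
    qed
    then show "subgroup I (add_monoid R)"
      using * by (intro add.subgroupI) auto
    show "\<And>x r. x \<in> I \<Longrightarrow> r \<in> carrier R \<Longrightarrow> r \<otimes> x \<in> I" using * by blast
    show "x \<otimes> r \<in> I" if "x \<in> I" "r \<in> carrier R" for x r
      using * that m_comm[of x r] by auto
  qed
qed

section \<open>The product of an ideal and a submodule\<close>

definition ideal_times ::
  "('a, 'm) ring_scheme \<Rightarrow> ('a, 'b, 'n) module_scheme \<Rightarrow> 'a set \<Rightarrow> 'b set \<Rightarrow> 'b set"
  where "ideal_times R M a Z = \<Inter>{P. submodule P R M \<and> (\<forall>r\<in>a. \<forall>z\<in>Z. r \<odot>\<^bsub>M\<^esub> z \<in> P)}"

context module
begin

lemma ideal_times_least:
  "submodule P R M \<Longrightarrow> (\<And>r z. r \<in> a \<Longrightarrow> z \<in> Z \<Longrightarrow> r \<odot>\<^bsub>M\<^esub> z \<in> P) \<Longrightarrow> ideal_times R M a Z \<subseteq> P"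
  unfolding ideal_times_def by blast

lemma ideal_timesI: "r \<in> a \<Longrightarrow> z \<in> Z \<Longrightarrow> r \<odot>\<^bsub>M\<^esub> z \<in> ideal_times R M a Z"
  unfolding ideal_times_def by blast

lemma submodule_ideal_times:
  assumes "a \<subseteq> carrier R" "Z \<subseteq> carrier M"
  shows "submodule (ideal_times R M a Z) R M"
proof -
  have "ideal_times R M a Z \<subseteq> carrier M"
    using assms by (intro ideal_times_least carrier_is_submodule) auto
  then show ?thesis
    unfolding submodule_iff by (auto simp: ideal_times_def submodule_mem)
qed

lemma submodule_smult_image:
  assumes f: "f \<in> carrier R" and B: "submodule B R M"
  shows "submodule ((\<lambda>b. f \<odot>\<^bsub>M\<^esub> b) ` B) R M"
  unfolding submodule_iff
proof (intro conjI ballI)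
  note mem = submodule_mem[OF B]
  show "(\<lambda>b. f \<odot>\<^bsub>M\<^esub> b) ` B \<subseteq> carrier M" using f mem by auto
  show "\<zero>\<^bsub>M\<^esub> \<in> (\<lambda>b. f \<odot>\<^bsub>M\<^esub> b) ` B" using f mem by (intro image_eqI[of _ _ "\<zero>\<^bsub>M\<^esub>"]) auto
next
  note mem = submodule_mem[OF B]
  fix u v assume "u \<in> (\<lambda>b. f \<odot>\<^bsub>M\<^esub> b) ` B" "v \<in> (\<lambda>b. f \<odot>\<^bsub>M\<^esub> b) ` B"
  then obtain x y where "x \<in> B" "y \<in> B" "u = f \<odot>\<^bsub>M\<^esub> x" "v = f \<odot>\<^bsub>M\<^esub> y" by blast
  then show "u \<oplus>\<^bsub>M\<^esub> v \<in> (\<lambda>b. f \<odot>\<^bsub>M\<^esub> b) ` B"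
    using f mem by (intro image_eqI[of _ _ "x \<oplus>\<^bsub>M\<^esub> y"]) (auto simp: smult_r_distr)
next
  note mem = submodule_mem[OF B]
  fix r u assume r: "r \<in> carrier R" and "u \<in> (\<lambda>b. f \<odot>\<^bsub>M\<^esub> b) ` B"
  then obtain x where "x \<in> B" "u = f \<odot>\<^bsub>M\<^esub> x" by blast
  then show "r \<odot>\<^bsub>M\<^esub> u \<in> (\<lambda>b. f \<odot>\<^bsub>M\<^esub> b) ` B"
    using f r mem by (intro image_eqI[of _ _ "r \<odot>\<^bsub>M\<^esub> x"]) (auto simp: smult_commute)
qed

text \<open>In homological terms: from \<open>Tor\<^sub>1(R/a, B/A) \<rightarrow> A/aA \<rightarrow> B/aB\<close> and the Artinian \<open>B/A\<close>.  In place of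
  the \<open>Tor\<close> term, \<open>A \<inter> aB\<close> is filtered by the finitely many generators of \<open>a\<close>: the step that
  adjoins \<open>fB\<close> to \<open>W\<close> contributes a subquotient of \<open>B/A\<close>, since \<open>fb\<close> for \<open>b \<in> A\<close> already lies in
  \<open>aA\<close>.\<close>

lemma artinian_between_ideal_times:
  assumes B: "submodule B R M" and A: "submodule A R M" "A \<subseteq> B" and K: "submodule K R M" "K \<subseteq> A"
    and F: "finite F" "F \<subseteq> carrier R"
    and AB: "artinian_between R M A B"
    and aB: "artinian_between R M (ideal_times R M (Idl F) B <+>\<^bsub>M\<^esub> K) B"
  shows "artinian_between R M (ideal_times R M (Idl F) A <+>\<^bsub>M\<^esub> K) A"
proof -
  let ?a = "Idl F" and ?P = "ideal_times R M (Idl F) A <+>\<^bsub>M\<^esub> K"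
    and ?Q = "ideal_times R M (Idl F) B <+>\<^bsub>M\<^esub> K"
  note Amem = submodule_mem[OF A(1)] and Bmem = submodule_mem[OF B]
  have a: "ideal ?a R" by (rule R.genideal_ideal[OF F(2)])
  have ac: "?a \<subseteq> carrier R" using ideal.Icarr[OF a] by blast
  have aA: "submodule (ideal_times R M ?a A) R M" using ac Amem(1) by (intro submodule_ideal_times) auto
  have aBs: "submodule (ideal_times R M ?a B) R M" using ac Bmem(1) by (intro submodule_ideal_times) auto
  have P: "submodule ?P R M" by (rule submodule_set_add[OF aA K(1)])
  have Q: "submodule ?Q R M" by (rule submodule_set_add[OF aBs K(1)])
  have PA: "?P \<subseteq> A"
    using ac Amem(5) K(2) by (intro set_add_least A ideal_times_least) auto
  have aAP: "ideal_times R M ?a A \<subseteq> ?P" by (rule set_add_ge1[OF aA K(1)])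
  have "\<exists>W. submodule W R M \<and> ?P \<subseteq> W \<and> (\<forall>f\<in>F'. \<forall>b\<in>B. f \<odot>\<^bsub>M\<^esub> b \<in> W) \<and>
    artinian_between R M ?P (A \<inter> W)" (is "\<exists>W. ?good F' W") if "F' \<subseteq> F" for F'
    using finite_subset[OF that F(1)] that
  proof (induction F' rule: finite_induct)
    case empty
    have "A \<inter> ?P = ?P" using PA by blast
    then show ?case using P artinian_between_same by (intro exI[of _ ?P]) auto
  next
    case (insert f F')
    then obtain W where W: "submodule W R M" "?P \<subseteq> W" "\<And>f b. f \<in> F' \<Longrightarrow> b \<in> B \<Longrightarrow> f \<odot>\<^bsub>M\<^esub> b \<in> W"
      "artinian_between R M ?P (A \<inter> W)" by auto
    have f: "f \<in> carrier R" "f \<in> ?a" using insert.prems F R.genideal_self[OF F(2)] by auto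
    note Wmem = submodule_mem[OF W(1)]
    define fB where "fB = (\<lambda>b. f \<odot>\<^bsub>M\<^esub> b) ` B"
    have fB: "submodule fB R M" unfolding fB_def by (rule submodule_smult_image[OF f(1) B])
    define W' where "W' = W <+>\<^bsub>M\<^esub> fB"
    have W': "submodule W' R M" "W \<subseteq> W'" "fB \<subseteq> W'"
      unfolding W'_def using submodule_set_add[OF W(1) fB] set_add_ge1[OF W(1) fB] set_add_ge2[OF W(1) fB]
      by auto
    have i1: "interval R M ?P (A \<inter> W)" and i2: "interval R M (A \<inter> W) (A \<inter> W')"
      using W W' PA P module_axioms submodule_Int[OF A(1)] by (auto simp: interval_def)
    define G where "G = {(b, w \<oplus>\<^bsub>M\<^esub> f \<odot>\<^bsub>M\<^esub> b) | w b. w \<in> W \<and> b \<in> carrier M}"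
    have "subquotient R M A B M (A \<inter> W) (A \<inter> W')"
    proof (rule subquotientI[where G = G])
      show "interval R M A B" using A B module_axioms by (simp add: interval_def)
      show "lin_rel R M M G"
        unfolding lin_rel_def
      proof (intro conjI allI impI ballI)
        show "(\<zero>\<^bsub>M\<^esub>, \<zero>\<^bsub>M\<^esub>) \<in> G"
          unfolding G_def using Wmem(2) f by force
        show "G \<subseteq> carrier M \<times> carrier M"
          unfolding G_def using Wmem(1) f by auto
      next
        fix x y x' y'
        assume "(x, y) \<in> G"
          "(x', y') \<in> G"
        then obtain w w' where *: "w \<in> W" "w' \<in> W" "x \<in> carrier M" "x' \<in> carrier M"
          "y = w \<oplus>\<^bsub>M\<^esub> f \<odot>\<^bsub>M\<^esub> x" "y' = w' \<oplus>\<^bsub>M\<^esub> f \<odot>\<^bsub>M\<^esub> x'" unfolding G_def by blast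
        then have "y \<oplus>\<^bsub>M\<^esub> y' = (w \<oplus>\<^bsub>M\<^esub> w') \<oplus>\<^bsub>M\<^esub> f \<odot>\<^bsub>M\<^esub> (x \<oplus>\<^bsub>M\<^esub> x')"
          using f Wmem(1) by (simp add: smult_r_distr M.a_ac)
        then show "(x \<oplus>\<^bsub>M\<^esub> x', y \<oplus>\<^bsub>M\<^esub> y') \<in> G"
          unfolding G_def using * Wmem(3) by blast
      next
        fix r x y
        assume r: "r \<in> carrier R" and "(x, y) \<in> G"
        then obtain w where *: "w \<in> W" "x \<in> carrier M" "y = w \<oplus>\<^bsub>M\<^esub> f \<odot>\<^bsub>M\<^esub> x" unfolding G_def by blast
        then have "r \<odot>\<^bsub>M\<^esub> y = (r \<odot>\<^bsub>M\<^esub> w) \<oplus>\<^bsub>M\<^esub> f \<odot>\<^bsub>M\<^esub> (r \<odot>\<^bsub>M\<^esub> x)"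
          using f r Wmem(1) by (simp add: smult_r_distr smult_commute[of r f])
        then show "(r \<odot>\<^bsub>M\<^esub> x, r \<odot>\<^bsub>M\<^esub> y) \<in> G"
          unfolding G_def using * r Wmem(5) by blast
      qed
    next
      fix y assume "y \<in> A \<inter> W'"
      then have "y \<in> W <+>\<^bsub>M\<^esub> fB" by (simp add: W'_def)
      then obtain w b where "w \<in> W" "b \<in> B" "y = w \<oplus>\<^bsub>M\<^esub> f \<odot>\<^bsub>M\<^esub> b"
        unfolding fB_def by (blast elim: set_addE)
      then show "\<exists>x\<in>B. (x, y) \<in> G"
        unfolding G_def using Bmem(1) by blast
    next
      fix x y assume "(x, y) \<in> G"
        and x: "x \<in> A" and y: "y \<in> A \<inter> W'"
      then obtain w where w: "w \<in> W" "y = w \<oplus>\<^bsub>M\<^esub> f \<odot>\<^bsub>M\<^esub> x" unfolding G_def by blast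
      have "f \<odot>\<^bsub>M\<^esub> x \<in> W" using ideal_timesI[OF f(2) x] aAP W(2) by blast
      then show "y \<in> A \<inter> W" using w y Wmem(3) by blast
    qed (use i2 in auto)
    then have "artinian_between R M (A \<inter> W) (A \<inter> W')"
      by (rule artinian_between_subquotient[OF AB])
    then have "artinian_between R M ?P (A \<inter> W')"
      by (rule artinian_between_trans[OF W(4) _ i1 i2])
    moreover have "\<forall>f'\<in>insert f F'. \<forall>b\<in>B. f' \<odot>\<^bsub>M\<^esub> b \<in> W'"
      using W(3) W'(2,3) by (auto simp: fB_def)
    ultimately show ?case using W(2) W' by blast
  qed
  from this[OF subset_refl] obtain W where "?good F W" by (rule exE)
  then have W: "submodule W R M" "?P \<subseteq> W" "\<And>f b. f \<in> F \<Longrightarrow> b \<in> B \<Longrightarrow> f \<odot>\<^bsub>M\<^esub> b \<in> W"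
    "artinian_between R M ?P (A \<inter> W)" by auto
  note Wmem = submodule_mem[OF W(1)]
  have "ideal {r \<in> carrier R. \<forall>b\<in>B. r \<odot>\<^bsub>M\<^esub> b \<in> W} R"
    unfolding R.ideal_iff using Bmem(1) Wmem by (auto simp: smult_l_distr smult_assoc1)
  then have "?a \<subseteq> {r \<in> carrier R. \<forall>b\<in>B. r \<odot>\<^bsub>M\<^esub> b \<in> W}"
    using W(3) F(2) by (intro R.genideal_minimal) auto
  then have "ideal_times R M ?a B \<subseteq> W" by (intro ideal_times_least[OF W(1)]) blast
  moreover have "K \<subseteq> W" using W(2) set_add_ge2[OF aA K(1)] by blast
  ultimately have QW: "?Q \<subseteq> W" by (rule set_add_least[OF W(1)])
  have QB: "?Q \<subseteq> B" using ac Bmem(5) K(2) A(2) by (intro set_add_least B ideal_times_least) auto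
  have "subquotient R M ?Q B M (A \<inter> W) A"
    using module_axioms Q B A QW QB submodule_Int[OF A(1) W(1)]
    by (intro subquotient_same) (auto simp: interval_def)
  from artinian_between_subquotient[OF aB this] have "artinian_between R M (A \<inter> W) A" .
  then show ?thesis
    using module_axioms P PA A W submodule_Int[OF A(1) W(1)]
    by (intro artinian_between_trans[OF W(4)]) (auto simp: interval_def)
qed

end

section \<open>Associated primes and support of intervals\<close>

definition colon :: "('a, 'm) ring_scheme \<Rightarrow> ('a, 'b, 'n) module_scheme \<Rightarrow> 'b set \<Rightarrow> 'b \<Rightarrow> 'a set"
  where "colon R M K x = {r \<in> carrier R. r \<odot>\<^bsub>M\<^esub> x \<in> K}"

definition ass_between ::
  "('a, 'm) ring_scheme \<Rightarrow> ('a, 'b, 'n) module_scheme \<Rightarrow> 'b set \<Rightarrow> 'b set \<Rightarrow> 'a set set"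
  where "ass_between R M K L = {p. primeideal p R \<and> (\<exists>x\<in>L. p = colon R M K x)}"

definition supp_between ::
  "('a, 'm) ring_scheme \<Rightarrow> ('a, 'b, 'n) module_scheme \<Rightarrow> 'b set \<Rightarrow> 'b set \<Rightarrow> 'a set set"
  where "supp_between R M K L = {p. primeideal p R \<and> (\<exists>x\<in>L. colon R M K x \<subseteq> p)}"

definition laskerian_between ::
  "('a, 'm) ring_scheme \<Rightarrow> ('a, 'b, 'n) module_scheme \<Rightarrow> 'b set \<Rightarrow> 'b set \<Rightarrow> bool"
  where "laskerian_between R M K L \<longleftrightarrow>
    (\<forall>S. submodule S R M \<longrightarrow> K \<subseteq> S \<longrightarrow> S \<subseteq> L \<longrightarrow> finite (ass_between R M S L))"

text \<open>The part of the dimension of \<open>L/K\<close> that is seen outside \<open>V(a)\<close>: chains in the support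
  that start at a prime not containing \<open>a\<close> have at most \<open>n\<close> members.\<close>

definition chains_below ::
  "('a, 'm) ring_scheme \<Rightarrow> 'a set \<Rightarrow> nat \<Rightarrow> ('a, 'b, 'n) module_scheme \<Rightarrow> 'b set \<Rightarrow> 'b set \<Rightarrow> bool"
  where "chains_below R a n M K L \<longleftrightarrow>
    \<not> (\<exists>p. (\<forall>i\<le>n. p i \<in> supp_between R M K L) \<and> (\<forall>i<n. p i \<subset> p (Suc i)) \<and> \<not> a \<subseteq> p 0)"

text \<open>Torsion modulo \<open>K\<close> is tested on the single elements of \<open>a\<close> and not on powers of \<open>a\<close>; over a
  Noetherian ring this is the same (lemma \<open>carrier_torsion_module\<close> below).\<close>

definition torsion_mod ::
  "('a, 'm) ring_scheme \<Rightarrow> 'a set \<Rightarrow> ('a, 'b, 'n) module_scheme \<Rightarrow> 'b set \<Rightarrow> 'b \<Rightarrow> bool"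
  where "torsion_mod R a M K x \<longleftrightarrow> (\<forall>f\<in>a. \<exists>k::nat. (f [^]\<^bsub>R\<^esub> k) \<odot>\<^bsub>M\<^esub> x \<in> K)"

text \<open>Passing from \<open>S'\<close> to the sum of its preimage and \<open>K\<close> preserves the annihilators of
  related elements, so every associated prime of \<open>L'/S'\<close> is one of \<open>L/S\<close>.\<close>

lemma laskerian_between_subquotient:
  assumes wl: "laskerian_between R M K L" and sq: "subquotient R M K L M' K' L'"
  shows "laskerian_between R M' K' L'"
  unfolding laskerian_between_def
proof (intro allI impI)
  fix S' assume S': "submodule S' R M'" "K' \<subseteq> S'" "S' \<subseteq> L'"
  obtain G where G: "lin_rel R M M' G" and tot: "\<And>y. y \<in> L' \<Longrightarrow> \<exists>x\<in>L. (x, y) \<in> G"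
    and KK': "\<And>x y. (x, y) \<in> G \<Longrightarrow> x \<in> K \<Longrightarrow> y \<in> L' \<Longrightarrow> y \<in> K'"
    using sq unfolding subquotient_def by blast
  have i: "module R M" "submodule K R M" "submodule L R M" "K \<subseteq> L" "module R M'" "submodule L' R M'"
    using sq by (auto simp: subquotient_def interval_def)
  interpret M: module R M by fact
  interpret M': module R M' by fact
  have pre: "submodule {x \<in> L. \<exists>y\<in>S'. (x, y) \<in> G} R M"
    by (rule submodule_preimage[OF i(1,5) G i(3) S'(1)])
  define S where "S = {x \<in> L. \<exists>y\<in>S'. (x, y) \<in> G} <+>\<^bsub>M\<^esub> K"
  have S: "submodule S R M" "K \<subseteq> S" "S \<subseteq> L"
    unfolding S_def using M.submodule_set_add[OF pre i(2)] M.set_add_ge2[OF pre i(2)]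
      M.set_add_least[OF i(3) _ i(4)] by auto
  have "colon R M' S' y = colon R M S x" if x: "x \<in> L" and y: "y \<in> L'" and xy: "(x, y) \<in> G" for x y
  proof (rule equalityI; rule subsetI)
    fix r assume "r \<in> colon R M' S' y"
    then have r: "r \<in> carrier R" "r \<odot>\<^bsub>M'\<^esub> y \<in> S'" by (auto simp: colon_def)
    then have "r \<odot>\<^bsub>M\<^esub> x \<in> {x \<in> L. \<exists>y\<in>S'. (x, y) \<in> G}"
      using M.submodule_mem(5)[OF i(3) r(1) x] lin_relD(5)[OF G r(1) xy] by blast
    then show "r \<in> colon R M S x"
      using r(1) M.set_add_ge1[OF pre i(2)] by (auto simp: colon_def S_def)
  next
    fix r assume "r \<in> colon R M S x"
    then have r: "r \<in> carrier R" "r \<odot>\<^bsub>M\<^esub> x \<in> S" by (auto simp: colon_def)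
    then obtain z k y' where z: "z \<in> L" "k \<in> K" "r \<odot>\<^bsub>M\<^esub> x = z \<oplus>\<^bsub>M\<^esub> k" "y' \<in> S'" "(z, y') \<in> G"
      unfolding S_def by (auto elim!: M.set_addE)
    have cl: "z \<in> carrier M" "k \<in> carrier M" "y \<in> carrier M'" "y' \<in> carrier M'"
      using M.submodule_mem(1)[OF i(3) z(1)] M.submodule_mem(1)[OF i(2) z(2)]
        lin_relD(2)[OF G xy] lin_relD(2)[OF G z(5)] by auto
    have "(r \<odot>\<^bsub>M\<^esub> x \<ominus>\<^bsub>M\<^esub> z, r \<odot>\<^bsub>M'\<^esub> y \<ominus>\<^bsub>M'\<^esub> y') \<in> G"
      by (rule lin_rel_diff[OF i(1,5) G lin_relD(5)[OF G r(1) xy] z(5)])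
    moreover have "r \<odot>\<^bsub>M\<^esub> x \<ominus>\<^bsub>M\<^esub> z = k" using z cl by simp
    moreover have "r \<odot>\<^bsub>M'\<^esub> y \<ominus>\<^bsub>M'\<^esub> y' \<in> L'"
      using y z(4) S'(3) r(1) M'.submodule_mem(4,5)[OF i(6)] by blast
    ultimately have "r \<odot>\<^bsub>M'\<^esub> y \<ominus>\<^bsub>M'\<^esub> y' \<in> S'" using KK' z(2) S'(2) by auto
    then have "(r \<odot>\<^bsub>M'\<^esub> y \<ominus>\<^bsub>M'\<^esub> y') \<oplus>\<^bsub>M'\<^esub> y' \<in> S'"
      using z(4) M'.submodule_mem(3)[OF S'(1)] by blast
    then show "r \<in> colon R M' S' y" using cl r(1) by (simp add: colon_def)
  qed
  then have "ass_between R M' S' L' \<subseteq> ass_between R M S L"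
    unfolding ass_between_def using tot by blast
  moreover have "finite (ass_between R M S L)"
    using wl S unfolding laskerian_between_def by blast
  ultimately show "finite (ass_between R M' S' L')" by (rule finite_subset)
qed

lemma supp_between_subquotient:
  assumes sq: "subquotient R M K L M' K' L'"
  shows "supp_between R M' K' L' \<subseteq> supp_between R M K L"
proof
  fix p assume "p \<in> supp_between R M' K' L'"
  then obtain y where p: "primeideal p R" and y: "y \<in> L'" "colon R M' K' y \<subseteq> p"
    by (auto simp: supp_between_def)
  obtain G where G: "lin_rel R M M' G" and tot: "\<And>y. y \<in> L' \<Longrightarrow> \<exists>x\<in>L. (x, y) \<in> G"
    and KK': "\<And>x y. (x, y) \<in> G \<Longrightarrow> x \<in> K \<Longrightarrow> y \<in> L' \<Longrightarrow> y \<in> K'"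
    using sq unfolding subquotient_def by blast
  have M': "module R M'" and L': "submodule L' R M'"
    using sq by (auto simp: subquotient_def interval_def)
  obtain x where x: "x \<in> L" "(x, y) \<in> G" using tot y(1) by blast
  have "colon R M K x \<subseteq> colon R M' K' y"
    using KK' lin_relD(5)[OF G _ x(2)] module.submodule_mem(5)[OF M' L' _ y(1)]
    unfolding colon_def by blast
  then show "p \<in> supp_between R M K L" using p x(1) y(2) by (auto simp: supp_between_def)
qed

lemma chains_below_mono:
  assumes "chains_below R a n M K L" "supp_between R M' K' L' \<subseteq> supp_between R M K L"
  shows "chains_below R a n M' K' L'"
  using assms unfolding chains_below_def by blast

lemma (in module) ideal_colon:
  assumes K: "submodule K R M" and x: "x \<in> carrier M"
  shows "ideal (colon R M K x) R"
  unfolding R.ideal_iff colon_def using submodule_mem[OF K] x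
  by (auto simp: smult_l_distr smult_assoc1)

text \<open>The ascending chain condition in the form in which it is used for Noetherian induction.\<close>

lemma (in noetherian_ring) maximal_ideal_in_family:
  assumes "I \<in> C" and C: "\<And>I. I \<in> C \<Longrightarrow> ideal I R"
  shows "\<exists>J\<in>C. I \<subseteq> J \<and> (\<forall>J'\<in>C. J \<subseteq> J' \<longrightarrow> J' = J)"
proof -
  let ?C = "{J \<in> C. I \<subseteq> J}"
  have "\<exists>J\<in>?C. \<forall>J'\<in>?C. J \<subseteq> J' \<longrightarrow> J' = J"
  proof (rule subset_Zorn_nonempty)
    show "?C \<noteq> {}" using assms(1) by blast
    fix D assume D: "D \<noteq> {}" "subset.chain ?C D"
    then have "subset.chain {I. ideal I R} D" using C by (auto simp: subset.chain_def)
    then have "\<Union>D \<in> D" using D(1) by (rule ideal_chain_is_trivial[rotated])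
    then show "\<Union>D \<in> ?C" using D(2) by (auto simp: subset.chain_def)
  qed
  then obtain J where "J \<in> ?C" "\<forall>J'\<in>?C. J \<subseteq> J' \<longrightarrow> J' = J" by (rule bexE)
  then show ?thesis by (intro bexI[of _ J]) auto
qed

locale noetherian_module_base = module R M + R?: noetherian_ring R
  for R :: "('a, 'm) ring_scheme" (structure) and M :: "('a, 'b, 'n) module_scheme" (structure)
begin

text \<open>A maximal member \<open>(K : z)\<close> among the colon ideals of elements that \<open>S\<close> does not kill is prime:
  if \<open>rs \<in> (K : z)\<close>, then \<open>(K : rz)\<close> is either again of this kind, hence equal to \<open>(K : z)\<close>, or some
  \<open>u \<in> S\<close> kills \<open>rz\<close>, and then \<open>r \<in> (K : uz) = (K : z)\<close>.\<close>

lemma ass_between_avoiding: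
  assumes K: "submodule K R M" and L: "submodule L R M"
    and S: "S \<subseteq> carrier R" "\<one> \<in> S" "\<And>s t. s \<in> S \<Longrightarrow> t \<in> S \<Longrightarrow> s \<otimes> t \<in> S"
    and y: "y \<in> L" "\<And>s. s \<in> S \<Longrightarrow> s \<odot>\<^bsub>M\<^esub> y \<notin> K"
  obtains p where "p \<in> ass_between R M K L" "p \<inter> S = {}"
proof -
  note Lmem = submodule_mem[OF L] and Kmem = submodule_mem[OF K]
  define C where "C = {colon R M K z | z. z \<in> L \<and> (\<forall>s\<in>S. s \<odot>\<^bsub>M\<^esub> z \<notin> K)}"
  have "colon R M K y \<in> C" using y by (auto simp: C_def)
  moreover have "\<And>I. I \<in> C \<Longrightarrow> ideal I R" using ideal_colon[OF K] Lmem(1) by (auto simp: C_def)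
  ultimately have "\<exists>p\<in>C. colon R M K y \<subseteq> p \<and> (\<forall>J\<in>C. p \<subseteq> J \<longrightarrow> J = p)"
    by (rule maximal_ideal_in_family)
  then obtain p where p: "p \<in> C" and max: "\<And>J. J \<in> C \<Longrightarrow> p \<subseteq> J \<Longrightarrow> J = p" by auto
  obtain z where z: "z \<in> L" "\<And>s. s \<in> S \<Longrightarrow> s \<odot>\<^bsub>M\<^esub> z \<notin> K" "p = colon R M K z"
    using p by (auto simp: C_def)
  have zc: "z \<in> carrier M" using z Lmem by blast
  have larger: "colon R M K z \<subseteq> colon R M K (r \<odot>\<^bsub>M\<^esub> z)" if "r \<in> carrier R" for r
    using that zc Kmem(5)[OF that] by (auto simp: colon_def smult_commute[of _ r])
  have "primeideal p R"
  proof (rule primeidealI)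
    show "ideal p R" using ideal_colon[OF K zc] z by simp
    show "carrier R \<noteq> p" 
    proof
      assume "carrier R = p"
      then have "\<one> \<in> colon R M K z" using z(3) R.one_closed by blast
      then show False using z(2)[OF S(2)] by (simp add: colon_def)
    qed
    show "r \<in> p \<or> s \<in> p" if rs: "r \<in> carrier R" "s \<in> carrier R" "r \<otimes> s \<in> p" for r s
    proof (cases "\<exists>u\<in>S. u \<odot>\<^bsub>M\<^esub> (r \<odot>\<^bsub>M\<^esub> z) \<in> K")
      case True
      then obtain u where u: "u \<in> S" "u \<in> carrier R" "u \<odot>\<^bsub>M\<^esub> (r \<odot>\<^bsub>M\<^esub> z) \<in> K" using S(1) by blast
      have "v \<odot>\<^bsub>M\<^esub> (u \<odot>\<^bsub>M\<^esub> z) \<notin> K" if "v \<in> S" for v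
        using z(2)[OF S(3)[OF that u(1)]] that S(1) u zc by (auto simp: smult_assoc1)
      then have "colon R M K (u \<odot>\<^bsub>M\<^esub> z) \<in> C" using Lmem(5)[OF u(2) z(1)] unfolding C_def by blast
      then have "colon R M K (u \<odot>\<^bsub>M\<^esub> z) = p" using max larger[OF u(2)] z(3) by blast
      moreover have "r \<in> colon R M K (u \<odot>\<^bsub>M\<^esub> z)"
        using u rs zc by (simp add: colon_def smult_commute[of r u])
      ultimately show ?thesis by simp
    next
      case False
      then have "colon R M K (r \<odot>\<^bsub>M\<^esub> z) \<in> C" using Lmem(5)[OF rs(1) z(1)] unfolding C_def by blast
      then have "colon R M K (r \<odot>\<^bsub>M\<^esub> z) = p" using max larger[OF rs(1)] z(3) by blast
      moreover have "s \<in> colon R M K (r \<odot>\<^bsub>M\<^esub> z)"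
        using rs zc z(3) by (simp add: colon_def smult_assoc1 smult_commute[of s r])
      ultimately show ?thesis by simp
    qed
  qed (rule R.is_cring)
  then have "p \<in> ass_between R M K L" using z by (auto simp: ass_between_def)
  moreover have "p \<inter> S = {}" using z by (auto simp: colon_def)
  ultimately show ?thesis by (rule that)
qed

lemma ass_between_avoiding_powers:
  assumes K: "submodule K R M" and L: "submodule L R M" and f: "f \<in> carrier R"
    and y: "y \<in> L" "\<And>k::nat. (f [^] k) \<odot>\<^bsub>M\<^esub> y \<notin> K"
  obtains p where "p \<in> ass_between R M K L" "f \<notin> p"
proof (rule ass_between_avoiding[OF K L _ _ _ y(1), of "range (\<lambda>k::nat. f [^] k)"])
  fix s t assume "s \<in> range (\<lambda>k::nat. f [^] k)" "t \<in> range (\<lambda>k::nat. f [^] k)"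
  then show "s \<otimes> t \<in> range (\<lambda>k::nat. f [^] k)" using f by (auto simp: R.nat_pow_mult)
next
  fix p assume "p \<in> ass_between R M K L" "p \<inter> range (\<lambda>k::nat. f [^] k) = {}"
  moreover have "f = f [^] (1::nat)" using f by simp
  ultimately show thesis using that by (metis disjoint_iff rangeI)
next
  show "\<one> \<in> range (\<lambda>k::nat. f [^] k)" by (intro range_eqI[of _ _ 0]) simp
qed (use f y in auto)

lemma ass_subset_supp: "ass_between R M K L \<subseteq> supp_between R M K L"
  by (auto simp: ass_between_def supp_between_def)

lemma torsion_mod_if_supp:
  assumes K: "submodule K R M" and L: "submodule L R M" and a: "a \<subseteq> carrier R"
    and supp: "\<And>p. p \<in> supp_between R M K L \<Longrightarrow> a \<subseteq> p" and y: "y \<in> L"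
  shows "torsion_mod R a M K y"
  unfolding torsion_mod_def
proof (rule ballI, rule ccontr)
  fix f assume f: "f \<in> a" and "\<nexists>k::nat. (f [^] k) \<odot>\<^bsub>M\<^esub> y \<in> K"
  then obtain p where "p \<in> ass_between R M K L" "f \<notin> p"
    using ass_between_avoiding_powers[OF K L _ y, of f] a by blast
  then show False using supp ass_subset_supp f by blast
qed

text \<open>Elements killed by \<open>x\<close> modulo \<open>K\<close> form an interval whose associated primes all contain
  \<open>x\<close>, hence \<open>a\<close>.\<close>

lemma torsion_mod_if_killed:
  assumes K: "submodule K R M" and L: "submodule L R M" and "K \<subseteq> L" and a: "a \<subseteq> carrier R" and x: "x \<in> a"
    and ass: "\<And>p. p \<in> ass_between R M K L \<Longrightarrow> \<not> a \<subseteq> p \<Longrightarrow> x \<notin> p"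
    and z: "z \<in> L" "x \<odot>\<^bsub>M\<^esub> z \<in> K"
  shows "torsion_mod R a M K z"
  unfolding torsion_mod_def
proof (rule ballI, rule ccontr)
  fix f assume f: "f \<in> a" and no: "\<nexists>k::nat. (f [^] k) \<odot>\<^bsub>M\<^esub> z \<in> K"
  define L1 where "L1 = {y \<in> L. x \<odot>\<^bsub>M\<^esub> y \<in> K}"
  have xc: "x \<in> carrier R" using x a by blast
  have "submodule L1 R M"
    unfolding submodule_iff L1_def using submodule_mem[OF K] submodule_mem[OF L] xc
    by (auto simp: smult_r_distr smult_commute[of x])
  then obtain p where p: "p \<in> ass_between R M K L1" "f \<notin> p"
    using ass_between_avoiding_powers[OF K, of L1 f z] a no f z by (auto simp: L1_def)
  then have "p \<in> ass_between R M K L" "x \<in> p"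
    using xc by (auto simp: ass_between_def L1_def colon_def)
  then show False using ass f p(2) by blast
qed

text \<open>The smallest prime \<open>p\<close> of a chain in the support of \<open>L/K'\<close> contains \<open>x\<close>.  Below it lies an associated
  prime of \<open>L/K\<close>, which does not contain \<open>x\<close>; adding it makes the chain longer.\<close>

lemma chains_below_quotient:
  assumes K: "submodule K R M" and L: "submodule L R M" and "K \<subseteq> L" and a: "a \<subseteq> carrier R" and x: "x \<in> a"
    and ass: "\<And>p. p \<in> ass_between R M K L \<Longrightarrow> \<not> a \<subseteq> p \<Longrightarrow> x \<notin> p"
    and chains: "chains_below R a (Suc n) M K L"
    and K': "K \<subseteq> K'" "K' \<subseteq> L" "\<And>y. y \<in> L \<Longrightarrow> x \<odot>\<^bsub>M\<^esub> y \<in> K'"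
  shows "chains_below R a n M K' L"
  unfolding chains_below_def
proof
  assume "\<exists>p. (\<forall>i\<le>n. p i \<in> supp_between R M K' L) \<and> (\<forall>i<n. p i \<subset> p (Suc i)) \<and> \<not> a \<subseteq> p 0"
  then obtain p where p: "\<And>i. i \<le> n \<Longrightarrow> p i \<in> supp_between R M K' L" "\<And>i. i < n \<Longrightarrow> p i \<subset> p (Suc i)"
    "\<not> a \<subseteq> p 0" by auto
  have pK: "p i \<in> supp_between R M K L" if "i \<le> n" for i
    using p(1)[OF that] K'(1) by (auto simp: supp_between_def colon_def)
  obtain y where y: "y \<in> L" "colon R M K' y \<subseteq> p 0" using p(1)[of 0] by (auto simp: supp_between_def)
  have prime: "primeideal (p 0) R" using p(1)[of 0] by (auto simp: supp_between_def)
  interpret p0: primeideal "p 0" R by (rule prime)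
  have xp: "x \<in> p 0" using y K'(3)[OF y(1)] x a by (auto simp: colon_def)
  obtain q where q: "q \<in> ass_between R M K L" "q \<inter> (carrier R - p 0) = {}"
  proof (rule ass_between_avoiding[OF K L _ _ _ y(1), of "carrier R - p 0"])
    show "\<one> \<in> carrier R - p 0" using p0.I_notcarr p0.one_imp_carrier by auto
    show "\<And>s t. s \<in> carrier R - p 0 \<Longrightarrow> t \<in> carrier R - p 0 \<Longrightarrow> s \<otimes> t \<in> carrier R - p 0"
      using p0.I_prime by auto
    show "\<And>s. s \<in> carrier R - p 0 \<Longrightarrow> s \<odot>\<^bsub>M\<^esub> y \<notin> K"
      using y(2) K'(1) by (auto simp: colon_def)
  qed auto
  have "primeideal q R" using q(1) by (simp add: ass_between_def)
  then have "q \<subseteq> carrier R" using ideal.Icarr[OF primeideal.axioms(1)] by auto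
  then have "q \<subseteq> p 0" using q(2) by auto
  then have qp: "q \<subset> p 0" "\<not> a \<subseteq> q" using ass[OF q(1)] xp p(3) by auto
  define p' where "p' i = (case i of 0 \<Rightarrow> q | Suc j \<Rightarrow> p j)" for i
  have "\<forall>i\<le>Suc n. p' i \<in> supp_between R M K L"
    using q(1) ass_subset_supp pK by (auto simp: p'_def split: nat.split)
  moreover have "\<forall>i<Suc n. p' i \<subset> p' (Suc i)"
    using qp p(2) by (auto simp: p'_def split: nat.split)
  moreover have "\<not> a \<subseteq> p' 0" using qp by (simp add: p'_def)
  ultimately show False using chains unfolding chains_below_def by blast
qed

end

lemma (in cring) prime_avoidance:
  assumes "finite P" "\<And>p. p \<in> P \<Longrightarrow> primeideal p R" "ideal a R" "\<And>p. p \<in> P \<Longrightarrow> \<not> a \<subseteq> p"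
  obtains x where "x \<in> a" "\<And>p. p \<in> P \<Longrightarrow> x \<notin> p"
proof -
  interpret a: ideal a R by fact
  have "\<exists>x\<in>a. \<forall>p\<in>P. x \<notin> p"
    using assms(1,2,4)
  proof (induction P rule: finite_psubset_induct)
    case (psubset P)
    show ?case
    proof (cases "P = {}")
      case True
      then show ?thesis using a.zero_closed by blast
    next
      case False
      then obtain q where q: "q \<in> P" by blast
      then interpret q: primeideal q R using psubset.prems by blast
      \<comment> \<open>If \<open>x\<close> avoids every prime but \<open>q\<close>, correct it by an element \<open>y\<close> of all the others that is not in \<open>q\<close>;
        such a \<open>y\<close> exists unless \<open>q\<close> contains one of them, which can then be dropped.\<close>
      obtain x where x: "x \<in> a" "\<And>p. p \<in> P - {q} \<Longrightarrow> x \<notin> p"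
        using psubset.IH[of "P - {q}"] psubset.prems q by blast
      show ?thesis
      proof (cases "\<exists>p\<in>P - {q}. p \<subseteq> q")
        case True
        then obtain p where p: "p \<in> P" "p \<noteq> q" "p \<subseteq> q" by blast
        have "\<exists>y\<in>a. \<forall>p'\<in>P - {p}. y \<notin> p'"
          using psubset.prems p(1) by (intro psubset.IH) auto
        then obtain y where y: "y \<in> a" "\<forall>p'\<in>P - {p}. y \<notin> p'" by (rule bexE)
        then have "\<forall>p'\<in>P. y \<notin> p'" using p q by auto
        then show ?thesis using y(1) by (rule rev_bexI[rotated])
      next
        case False
        have "\<exists>y\<in>a. y \<notin> q \<and> (\<forall>p\<in>P'. y \<in> p)" if "P' \<subseteq> P - {q}" for P'
          using finite_subset[OF that] psubset.hyps that
        proof (induction P' rule: infinite_finite_induct)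
          case (insert p P')
          then obtain y where y: "y \<in> a" "y \<notin> q" "\<And>p. p \<in> P' \<Longrightarrow> y \<in> p" by auto
          have "\<not> p \<subseteq> q" using False insert.prems by blast
          then obtain z where z: "z \<in> p" "z \<notin> q" by blast
          have ideal: "ideal p' R" if "p' \<in> insert p P'" for p'
            using psubset.prems(1) primeideal.axioms(1) insert.prems that by blast
          have zc: "z \<in> carrier R" using ideal.Icarr[OF ideal z(1)] by simp
          have "z \<otimes> y \<in> a" using a.I_l_closed[OF y(1) zc] .
          moreover have "z \<otimes> y \<notin> q" using q.I_prime[OF zc] y z a.Icarr by blast
          moreover have "z \<otimes> y \<in> p'" if "p' \<in> insert p P'" for p'
          proof (cases "p' = p")
            case True
            then show ?thesis using ideal.I_r_closed[OF ideal, of p z y] z y(1) a.Icarr by simp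
          next
            case False
            then show ?thesis using that y(3) zc ideal.I_l_closed[OF ideal, of p' y z] by auto
          qed
          ultimately show ?case by blast
        next
          case empty
          then show ?case using psubset.prems(2)[OF q] by blast
        qed auto
        from this[OF subset_refl] obtain y where
          y: "y \<in> a" "y \<notin> q" "\<And>p. p \<in> P - {q} \<Longrightarrow> y \<in> p" by blast
        have c: "x \<in> carrier R" "y \<in> carrier R" using x y a.Icarr by auto
        show ?thesis
        proof (cases "x \<in> q")
          case True
          have "x \<oplus> y \<notin> p" if p: "p \<in> P" for p
          proof
            assume s: "x \<oplus> y \<in> p"
            interpret p: primeideal p R using psubset.prems(1) p by blast
            show False
            proof (cases "p = q")
              case True
              have "\<ominus> x \<oplus> (x \<oplus> y) \<in> q" using s \<open>x \<in> q\<close> True by blast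
              then show False using y(2) c by (simp add: r_neg1)
            next
              case False
              then have "(x \<oplus> y) \<oplus> \<ominus> y \<in> p" using s p y(3) by blast
              then show False using x(2) p False c by (simp add: a_assoc r_neg)
            qed
          qed
          then show ?thesis using x(1) y(1) a.a_closed by blast
        next
          case False
          then show ?thesis using x by blast
        qed
      qed
    qed
  qed
  then show ?thesis using that by blast
qed

section \<open>Module homomorphisms\<close>

lemma mod_homD:
  assumes "f \<in> mod_hom R M N"
  shows "x \<in> carrier M \<Longrightarrow> f x \<in> carrier N"
    "x \<in> carrier M \<Longrightarrow> y \<in> carrier M \<Longrightarrow> f (x \<oplus>\<^bsub>M\<^esub> y) = f x \<oplus>\<^bsub>N\<^esub> f y"
    "r \<in> carrier R \<Longrightarrow> x \<in> carrier M \<Longrightarrow> f (r \<odot>\<^bsub>M\<^esub> x) = r \<odot>\<^bsub>N\<^esub> f x"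
  using assms unfolding mod_hom_def by blast+

lemma mod_homI:
  assumes "\<And>x. x \<in> carrier M \<Longrightarrow> f x \<in> carrier N"
    "\<And>x y. x \<in> carrier M \<Longrightarrow> y \<in> carrier M \<Longrightarrow> f (x \<oplus>\<^bsub>M\<^esub> y) = f x \<oplus>\<^bsub>N\<^esub> f y"
    "\<And>r x. r \<in> carrier R \<Longrightarrow> x \<in> carrier M \<Longrightarrow> f (r \<odot>\<^bsub>M\<^esub> x) = r \<odot>\<^bsub>N\<^esub> f x"
  shows "f \<in> mod_hom R M N"
  using assms unfolding mod_hom_def by blast

lemma mod_hom_zero:
  assumes "module R M" "module R N" and f: "f \<in> mod_hom R M N"
  shows "f \<zero>\<^bsub>M\<^esub> = \<zero>\<^bsub>N\<^esub>"
proof -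
  interpret M: module R M by fact
  interpret N: module R N by fact
  have "f (\<zero>\<^bsub>R\<^esub> \<odot>\<^bsub>M\<^esub> \<zero>\<^bsub>M\<^esub>) = \<zero>\<^bsub>R\<^esub> \<odot>\<^bsub>N\<^esub> f \<zero>\<^bsub>M\<^esub>" by (rule mod_homD(3)[OF f]) auto
  then show ?thesis using mod_homD(1)[OF f, of "\<zero>\<^bsub>M\<^esub>"] by simp
qed

lemma mod_hom_diff:
  assumes "module R M" "module R N" and f: "f \<in> mod_hom R M N"
    and xy: "x \<in> carrier M" "y \<in> carrier M"
  shows "f (x \<ominus>\<^bsub>M\<^esub> y) = f x \<ominus>\<^bsub>N\<^esub> f y"
proof -
  interpret M: module R M by fact
  interpret N: module R N by fact
  have "f x = f ((x \<ominus>\<^bsub>M\<^esub> y) \<oplus>\<^bsub>M\<^esub> y)" using xy by simp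
  also have "\<dots> = f (x \<ominus>\<^bsub>M\<^esub> y) \<oplus>\<^bsub>N\<^esub> f y" using xy by (intro mod_homD(2)[OF f]) auto
  finally show ?thesis using xy mod_homD(1)[OF f] by (simp add: N.diff_eq_iff)
qed

lemma submodule_image:
  assumes "module R M" "module R N" and f: "f \<in> mod_hom R M N" and K: "submodule K R M"
  shows "submodule (f ` K) R N"
proof -
  interpret M: module R M by fact
  interpret N: module R N by fact
  note mem = M.submodule_mem[OF K] and fD = mod_homD[OF f]
  show ?thesis
    unfolding N.submodule_iff
  proof (intro conjI ballI)
    show "\<zero>\<^bsub>N\<^esub> \<in> f ` K" using mem(2) mod_hom_zero[OF assms(1-3)] by force
    show "f ` K \<subseteq> carrier N" using mem(1) fD(1) by auto
  next
    fix u v assume "u \<in> f ` K" "v \<in> f ` K"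
    then obtain x y where "x \<in> K" "y \<in> K" "u = f x" "v = f y" by auto
    then show "u \<oplus>\<^bsub>N\<^esub> v \<in> f ` K"
      using fD(2)[of x y] mem(1,3) by (intro image_eqI[of _ _ "x \<oplus>\<^bsub>M\<^esub> y"]) auto
  next
    fix r u assume "r \<in> carrier R" "u \<in> f ` K"
    then obtain x where "x \<in> K" "u = f x" by auto
    with \<open>r \<in> carrier R\<close> show "r \<odot>\<^bsub>N\<^esub> u \<in> f ` K"
      using fD(3)[of r x] mem(1,5) by (intro image_eqI[of _ _ "r \<odot>\<^bsub>M\<^esub> x"]) auto
  qed
qed

lemma submodule_kernel:
  assumes "module R M" "module R N" and f: "f \<in> mod_hom R M N"
  shows "submodule (a_kernel M N f) R M"
proof -
  interpret M: module R M by fact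
  interpret N: module R N by fact
  show ?thesis
    unfolding M.submodule_iff a_kernel_def' using mod_homD[OF f] mod_hom_zero[OF assms] by auto
qed

section \<open>The torsion submodule\<close>

lemma (in cring) pow_in_ideal_pow:
  assumes "ideal a R" "f \<in> a"
  shows "f [^] (n::nat) \<in> a [^]\<^bsub>ideals_set R\<^esub> n"
proof (induction n)
  case 0
  then show ?case by (simp add: ideals_set_def nat_pow_def)
next
  case (Suc n)
  then have "f [^] n \<otimes> f \<in> ideal_prod R (a [^]\<^bsub>ideals_set R\<^esub> n) a"
    using assms(2) by (rule ideal_prod.prod)
  then show ?case by (simp add: ideals_set_def nat_pow_def)
qed

lemma (in cring) ideal_prod_subset:
  assumes "ideal K R" "\<And>i j. i \<in> I \<Longrightarrow> j \<in> J \<Longrightarrow> i \<otimes> j \<in> K"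
  shows "ideal_prod R I J \<subseteq> K"
proof
  interpret ideal K R by fact
  fix x assume "x \<in> ideal_prod R I J"
  then show "x \<in> K" by induction (use assms in auto)
qed

text \<open>Noetherian induction on \<open>J\<close>: a maximal counterexample would be a prime ideal.\<close>

lemma (in noetherian_ring) ideal_pow_subset:
  assumes "cring R" and a: "ideal a R" and "ideal J R" "\<And>f. f \<in> a \<Longrightarrow> \<exists>k::nat. f [^] k \<in> J"
  shows "\<exists>n::nat. a [^]\<^bsub>ideals_set R\<^esub> n \<subseteq> J"
proof (rule ccontr)
  assume no: "\<nexists>n::nat. a [^]\<^bsub>ideals_set R\<^esub> n \<subseteq> J"
  interpret cring R by fact
  interpret S: comm_monoid "ideals_set R" by (rule ideals_set_is_comm_monoid)
  let ?pow = "\<lambda>n::nat. a [^]\<^bsub>ideals_set R\<^esub> n"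
  have ac: "a \<in> carrier (ideals_set R)" "\<And>f. f \<in> a \<Longrightarrow> f \<in> carrier R"
    using a ideal.Icarr[OF a] by (auto simp: ideals_set_def)
  define C where "C = {J. ideal J R \<and> (\<forall>f\<in>a. \<exists>k::nat. f [^] k \<in> J) \<and> \<not> (\<exists>n. ?pow n \<subseteq> J)}"
  have "J \<in> C" using assms no by (auto simp: C_def)
  then have "\<exists>P\<in>C. J \<subseteq> P \<and> (\<forall>J'\<in>C. P \<subseteq> J' \<longrightarrow> J' = P)"
    by (rule maximal_ideal_in_family) (simp add: C_def)
  then obtain P where PC: "P \<in> C" and max: "\<And>J'. J' \<in> C \<Longrightarrow> P \<subseteq> J' \<Longrightarrow> J' = P" by auto
  have P: "ideal P R" "\<And>f. f \<in> a \<Longrightarrow> \<exists>k::nat. f [^] k \<in> P" and Pno: "\<And>n. \<not> ?pow n \<subseteq> P"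
    using PC by (auto simp: C_def)
  interpret P: ideal P R by (rule P(1))
  have bigger: "\<exists>n. ?pow n \<subseteq> P <+>\<^bsub>R\<^esub> PIdl b" if b: "b \<in> carrier R" "b \<notin> P" for b
  proof (rule ccontr)
    assume *: "\<nexists>n. ?pow n \<subseteq> P <+>\<^bsub>R\<^esub> PIdl b"
    have I: "ideal (P <+>\<^bsub>R\<^esub> PIdl b) R" by (rule add_ideals[OF P(1) cgenideal_ideal[OF b(1)]])
    have sub: "P \<subseteq> P <+>\<^bsub>R\<^esub> PIdl b"
    proof
      fix x assume x: "x \<in> P"
      have "\<zero> \<in> PIdl b" using additive_subgroup.zero_closed[OF ideal.axioms(1)[OF cgenideal_ideal[OF b(1)]]] .
      then have "x \<oplus> \<zero> \<in> P <+>\<^bsub>R\<^esub> PIdl b" using x unfolding set_add_def' by blast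
      then show "x \<in> P <+>\<^bsub>R\<^esub> PIdl b" using x P.Icarr by simp
    qed
    have "\<forall>f\<in>a. \<exists>k::nat. f [^] k \<in> P <+>\<^bsub>R\<^esub> PIdl b" using P(2) sub by (meson subsetD)
    then have "P <+>\<^bsub>R\<^esub> PIdl b \<in> C" using I * by (simp add: C_def)
    then have "P <+>\<^bsub>R\<^esub> PIdl b = P" using max sub by blast
    moreover have "\<zero> \<oplus> b \<in> P <+>\<^bsub>R\<^esub> PIdl b"
      using P.zero_closed cgenideal_self[OF b(1)] unfolding set_add_def' by blast
    ultimately show False using b by simp
  qed
  have "primeideal P R"
  proof (rule primeidealI[OF P(1) assms(1)])
    show "carrier R \<noteq> P" using Pno[of 0] by (simp add: ideals_set_def nat_pow_def)
    show "b \<in> P \<or> c \<in> P" if bc: "b \<in> carrier R" "c \<in> carrier R" "b \<otimes> c \<in> P" for b c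
    proof (rule ccontr)
      assume "\<not> (b \<in> P \<or> c \<in> P)"
      then obtain n m where n: "?pow n \<subseteq> P <+>\<^bsub>R\<^esub> PIdl b" and m: "?pow m \<subseteq> P <+>\<^bsub>R\<^esub> PIdl c"
        using bigger[OF bc(1)] bigger[OF bc(2)] by auto
      have "?pow (n + m) = ideal_prod R (?pow n) (?pow m)"
        using S.nat_pow_mult[OF ac(1), of n m] by (simp add: ideals_set_def)
      moreover have "ideal_prod R (?pow n) (?pow m) \<subseteq> P"
      proof (rule ideal_prod_subset[OF P(1)])
        fix i j assume "i \<in> ?pow n" "j \<in> ?pow m"
        then have "i \<in> P <+>\<^bsub>R\<^esub> PIdl b" "j \<in> P <+>\<^bsub>R\<^esub> PIdl c" using n m by auto
        then obtain p r q s where *: "p \<in> P" "r \<in> carrier R" "i = p \<oplus> r \<otimes> b" "q \<in> P" "s \<in> carrier R"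
          "j = q \<oplus> s \<otimes> c" by (auto simp: set_add_def' cgenideal_def)
        have c: "p \<in> carrier R" "q \<in> carrier R" using * P.Icarr by auto
        have "i \<otimes> j = p \<otimes> j \<oplus> ((r \<otimes> b) \<otimes> q \<oplus> (r \<otimes> s) \<otimes> (b \<otimes> c))"
          using * c bc by (simp add: l_distr r_distr m_ac a_ac)
        then show "i \<otimes> j \<in> P" using * c bc by (simp add: P.I_l_closed P.I_r_closed)
      qed
      ultimately show False using Pno[of "n + m"] by simp
    qed
  qed
  then interpret P: primeideal P R .
  have "f \<in> P" if f: "f \<in> a" for f
  proof -
    obtain k :: nat where "f [^] k \<in> P" using P(2) f by blast
    then show ?thesis
    proof (induction k)
      case 0
      then show ?case using P.one_imp_carrier P.I_notcarr by simp
    next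
      case (Suc k)
      then show ?case using P.I_prime[of "f [^] k" f] ac(2)[OF f] by auto
    qed
  qed
  then have "?pow 1 \<subseteq> P" using S.nat_pow_eone[OF ac(1)] by auto
  then show False using Pno by blast
qed

context module
begin

lemma torsion_mod_mem:
  "submodule K R M \<Longrightarrow> x \<in> K \<Longrightarrow> torsion_mod R a M K x"
  unfolding torsion_mod_def
  by (intro ballI exI[of _ 0]) (use submodule_mem(1) in auto)

lemma submodule_torsion_mod:
  assumes K: "submodule K R M" and a: "a \<subseteq> carrier R"
  shows "submodule {x \<in> carrier M. torsion_mod R a M K x} R M"
  unfolding submodule_iff
proof (intro conjI ballI)
  note mem = submodule_mem[OF K]
  show "\<zero>\<^bsub>M\<^esub> \<in> {x \<in> carrier M. torsion_mod R a M K x}" using torsion_mod_mem[OF K] mem(2) by auto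
  fix x y
  assume x: "x \<in> {x \<in> carrier M. torsion_mod R a M K x}" and y: "y \<in> {x \<in> carrier M. torsion_mod R a M K x}"
  have "\<exists>k::nat. (f [^] k) \<odot>\<^bsub>M\<^esub> (x \<oplus>\<^bsub>M\<^esub> y) \<in> K" if f: "f \<in> a" for f
  proof -
    obtain k l :: nat where kl: "(f [^] k) \<odot>\<^bsub>M\<^esub> x \<in> K" "(f [^] l) \<odot>\<^bsub>M\<^esub> y \<in> K"
      using x y f unfolding torsion_mod_def by blast
    have fc: "f \<in> carrier R" using f a by blast
    have "(f [^] (k + l)) \<odot>\<^bsub>M\<^esub> (x \<oplus>\<^bsub>M\<^esub> y) =
      (f [^] l) \<odot>\<^bsub>M\<^esub> ((f [^] k) \<odot>\<^bsub>M\<^esub> x) \<oplus>\<^bsub>M\<^esub> (f [^] k) \<odot>\<^bsub>M\<^esub> ((f [^] l) \<odot>\<^bsub>M\<^esub> y)"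
      using fc x y by (simp add: smult_r_distr smult_assoc1[symmetric] R.nat_pow_mult add.commute)
    then show ?thesis using kl fc mem by (intro exI[of _ "k + l"]) simp
  qed
  then show "x \<oplus>\<^bsub>M\<^esub> y \<in> {x \<in> carrier M. torsion_mod R a M K x}"
    using x y by (auto simp: torsion_mod_def)
next
  note mem = submodule_mem[OF K]
  fix r x
  assume r: "r \<in> carrier R" and x: "x \<in> {x \<in> carrier M. torsion_mod R a M K x}"
  have "\<exists>k::nat. (f [^] k) \<odot>\<^bsub>M\<^esub> (r \<odot>\<^bsub>M\<^esub> x) \<in> K" if f: "f \<in> a" for f
  proof -
    obtain k :: nat where k: "(f [^] k) \<odot>\<^bsub>M\<^esub> x \<in> K"
      using x f unfolding torsion_mod_def by blast
    have fc: "f \<in> carrier R" using f a by blast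
    then have "(f [^] k) \<odot>\<^bsub>M\<^esub> (r \<odot>\<^bsub>M\<^esub> x) = r \<odot>\<^bsub>M\<^esub> ((f [^] k) \<odot>\<^bsub>M\<^esub> x)"
      using x r by (simp add: smult_commute)
    then have "(f [^] k) \<odot>\<^bsub>M\<^esub> (r \<odot>\<^bsub>M\<^esub> x) \<in> K" using mem(5)[OF r k] by simp
    then show ?thesis ..
  qed
  then show "r \<odot>\<^bsub>M\<^esub> x \<in> {x \<in> carrier M. torsion_mod R a M K x}"
    using x r by (auto simp: torsion_mod_def)
qed auto

lemma torsion_mod_powers:
  assumes a: "a \<subseteq> carrier R" and x: "x \<in> carrier M"
    and pow: "\<And>f. f \<in> a \<Longrightarrow> \<exists>k::nat. torsion_mod R a M K ((f [^] k) \<odot>\<^bsub>M\<^esub> x)"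
  shows "torsion_mod R a M K x"
  unfolding torsion_mod_def
proof
  fix f assume f: "f \<in> a"
  then obtain k l :: nat where kl: "(f [^] l) \<odot>\<^bsub>M\<^esub> ((f [^] k) \<odot>\<^bsub>M\<^esub> x) \<in> K"
    using pow unfolding torsion_mod_def by blast
  have "f \<in> carrier R" using f a by blast
  then have "(f [^] (l + k)) \<odot>\<^bsub>M\<^esub> x \<in> K" using kl x by (simp add: smult_assoc1 R.nat_pow_mult[symmetric])
  then show "\<exists>k::nat. (f [^] k) \<odot>\<^bsub>M\<^esub> x \<in> K" by blast
qed

end

context noetherian_module_base
begin

text \<open>As \<open>a\<close> is finitely generated, an element is killed by a power of \<open>a\<close> as soon as every element of
  \<open>a\<close> has a power that kills it.  All later arguments use this elementwise description.\<close>

lemma carrier_torsion_module: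
  assumes a: "ideal a R"
  shows "carrier (torsion_module R a M) = {x \<in> carrier M. torsion_mod R a M {\<zero>\<^bsub>M\<^esub>} x}"
proof -
  have "(\<exists>n::nat. \<forall>r \<in> a [^]\<^bsub>ideals_set R\<^esub> n. r \<odot>\<^bsub>M\<^esub> x = \<zero>\<^bsub>M\<^esub>) \<longleftrightarrow> torsion_mod R a M {\<zero>\<^bsub>M\<^esub>} x"
    if x: "x \<in> carrier M" for x
  proof
    assume "\<exists>n::nat. \<forall>r \<in> a [^]\<^bsub>ideals_set R\<^esub> n. r \<odot>\<^bsub>M\<^esub> x = \<zero>\<^bsub>M\<^esub>"
    then show "torsion_mod R a M {\<zero>\<^bsub>M\<^esub>} x"
      using R.pow_in_ideal_pow[OF a] unfolding torsion_mod_def by blast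
  next
    assume tors: "torsion_mod R a M {\<zero>\<^bsub>M\<^esub>} x"
    have "\<exists>n::nat. a [^]\<^bsub>ideals_set R\<^esub> n \<subseteq> colon R M {\<zero>\<^bsub>M\<^esub>} x"
    proof (rule R.ideal_pow_subset[OF R.is_cring a ideal_colon[OF submodule_zero x]])
      fix f assume "f \<in> a"
      then show "\<exists>k::nat. f [^] k \<in> colon R M {\<zero>\<^bsub>M\<^esub>} x"
        using tors ideal.Icarr[OF a] by (auto simp: torsion_mod_def colon_def)
    qed
    then show "\<exists>n::nat. \<forall>r \<in> a [^]\<^bsub>ideals_set R\<^esub> n. r \<odot>\<^bsub>M\<^esub> x = \<zero>\<^bsub>M\<^esub>"
      unfolding colon_def by blast
  qed
  then show ?thesis unfolding torsion_module_def by auto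
qed

lemma submodule_torsion_module:
  assumes a: "ideal a R"
  shows "submodule (carrier (torsion_module R a M)) R M"
  unfolding carrier_torsion_module[OF a] using ideal.Icarr[OF a]
  by (intro submodule_torsion_mod submodule_zero) auto

end

section \<open>Torsion in injective modules\<close>

lemma (in injective_module) hom_from_ideal_extends:
  assumes J: "ideal J R"
    and add: "\<And>r s. r \<in> J \<Longrightarrow> s \<in> J \<Longrightarrow> \<phi> (r \<oplus> s) = \<phi> r \<oplus>\<^bsub>E\<^esub> \<phi> s"
    and smult: "\<And>r s. r \<in> carrier R \<Longrightarrow> s \<in> J \<Longrightarrow> \<phi> (r \<otimes> s) = r \<odot>\<^bsub>E\<^esub> \<phi> s"
    and closed: "\<And>r. r \<in> J \<Longrightarrow> \<phi> r \<in> carrier E"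
  shows "\<exists>e\<in>carrier E. \<forall>r\<in>J. \<phi> r = r \<odot>\<^bsub>E\<^esub> e"
proof -
  define RM :: "('a, 'a) module" where "RM = \<lparr>carrier = carrier R, mult = mult R,
    one = \<one>, zero = \<zero>, add = add R, smult = mult R\<rparr>"
  have RM: "module R RM" unfolding RM_def by (rule ring_as_module)
  interpret RM: module R RM by (rule RM)
  have RMs: "carrier RM = carrier R" "\<zero>\<^bsub>RM\<^esub> = \<zero>" "(\<oplus>\<^bsub>RM\<^esub>) = (\<oplus>)" "(\<odot>\<^bsub>RM\<^esub>) = (\<otimes>)"
    by (simp_all add: RM_def)
  note J' = J[unfolded ideal_iff]
  have "submodule J R RM" unfolding RM.submodule_iff RMs using J' by auto
  then have A: "module R (RM\<lparr>carrier := J\<rparr>)" by (rule submodule.submodule_is_module) (rule RM)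
  have "\<phi> \<in> mod_hom R (RM\<lparr>carrier := J\<rparr>) E"
    by (rule mod_homI) (use add smult closed RMs in auto)
  moreover have "(\<lambda>r. r) \<in> mod_hom R (RM\<lparr>carrier := J\<rparr>) RM"
    by (rule mod_homI) (use RMs J' in auto)
  ultimately have "\<exists>h\<in>mod_hom R RM E. \<forall>x\<in>carrier (RM\<lparr>carrier := J\<rparr>). h x = \<phi> x"
    using extension[OF A RM, of "\<lambda>r. r" \<phi>] by auto
  then obtain h where h: "h \<in> mod_hom R RM E" "\<And>x. x \<in> J \<Longrightarrow> h x = \<phi> x" by auto
  show ?thesis
  proof (rule bexI[of _ "h \<one>"], rule ballI)
    show "h \<one> \<in> carrier E" using mod_homD(1)[OF h(1)] RMs by simp
    fix r assume r: "r \<in> J"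
    then have rc: "r \<in> carrier R" using J' by blast
    have "h (r \<odot>\<^bsub>RM\<^esub> \<one>) = r \<odot>\<^bsub>E\<^esub> h \<one>" using mod_homD(3)[OF h(1) rc, of \<one>] RMs by simp
    then show "\<phi> r = r \<odot>\<^bsub>E\<^esub> h \<one>" using h(2)[OF r] rc RMs by simp
  qed
qed

text \<open>A weak form of the Artin--Rees lemma.  Among the ideals \<open>L\<close> with \<open>L \<inter> I \<subseteq> J\<close> choose a maximal
  one.  Once \<open>(L : f\<^sup>m)\<close> is stationary, \<open>f\<^sup>nI \<subseteq> J \<subseteq> L\<close> forces \<open>L + (f\<^sup>m)\<close> to meet \<open>I\<close> inside \<open>J\<close> as well, so
  \<open>f\<^sup>m \<in> L\<close>.\<close>

lemma (in noetherian_ring) artin_rees_weak: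
  assumes "cring R" and I: "ideal I R" and J: "ideal J R" "J \<subseteq> I" and a: "a \<subseteq> carrier R"
    and fI: "\<And>f. f \<in> a \<Longrightarrow> \<exists>n::nat. \<forall>i\<in>I. f [^] n \<otimes> i \<in> J"
  obtains L where "ideal L R" "L \<inter> I \<subseteq> J" "\<And>f. f \<in> a \<Longrightarrow> \<exists>m::nat. f [^] m \<in> L"
proof -
  interpret cring R by fact
  define C where "C = {L. ideal L R \<and> L \<inter> I \<subseteq> J}"
  have "J \<in> C" using J by (auto simp: C_def)
  then have "\<exists>L\<in>C. J \<subseteq> L \<and> (\<forall>L'\<in>C. L \<subseteq> L' \<longrightarrow> L' = L)"
    by (rule maximal_ideal_in_family) (simp add: C_def)
  then obtain L where L: "ideal L R" "L \<inter> I \<subseteq> J" "J \<subseteq> L"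
    and max: "\<And>L'. ideal L' R \<Longrightarrow> L' \<inter> I \<subseteq> J \<Longrightarrow> L \<subseteq> L' \<Longrightarrow> L' = L"
    unfolding C_def by auto
  interpret L: ideal L R by (rule L(1))
  interpret I: ideal I R by (rule I)
  have "\<exists>m::nat. f [^] m \<in> L" if f: "f \<in> a" for f
  proof -
    have fc: "f \<in> carrier R" using f a by blast
    define D where "D k = {r \<in> carrier R. r \<otimes> f [^] k \<in> L}" for k :: nat
    have D: "ideal (D k) R" for k
      unfolding ideal_iff
    proof (intro conjI ballI)
      show "\<zero> \<in> D k" using fc by (simp add: D_def)
      show "D k \<subseteq> carrier R" by (auto simp: D_def)
      show "r \<oplus> s \<in> D k" if "r \<in> D k" "s \<in> D k" for r s
        using that fc L.a_closed by (simp add: D_def l_distr)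
      show "s \<otimes> r \<in> D k" if "s \<in> carrier R" "r \<in> D k" for s r
        using that fc L.I_l_closed[of "r \<otimes> f [^] k" s] by (simp add: D_def m_assoc)
    qed
    have Dmono: "D k \<subseteq> D (k + n)" for k n
    proof
      fix r assume r: "r \<in> D k"
      then have "(r \<otimes> f [^] k) \<otimes> f [^] n \<in> L" using fc by (auto simp: D_def intro: L.I_r_closed[of "r \<otimes> f [^] k"])
      then show "r \<in> D (k + n)" using r fc by (simp add: D_def m_assoc nat_pow_mult)
    qed
    have "\<exists>E\<in>range D. D 0 \<subseteq> E \<and> (\<forall>E'\<in>range D. E \<subseteq> E' \<longrightarrow> E' = E)"
      by (rule maximal_ideal_in_family) (use D in auto)
    then obtain m where m: "\<And>k. D m \<subseteq> D k \<Longrightarrow> D k = D m" by auto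
    have stat: "r \<otimes> f [^] m \<in> L" if "r \<in> carrier R" "r \<otimes> f [^] (m + n) \<in> L" for r n
    proof -
      have "r \<in> D (m + n)" using that by (simp add: D_def)
      then have "r \<in> D m" using m[OF Dmono] by blast
      then show ?thesis by (simp add: D_def)
    qed
    obtain n :: nat where n: "\<And>i. i \<in> I \<Longrightarrow> f [^] n \<otimes> i \<in> J" using fI[OF f] by blast
    define L' where "L' = L <+>\<^bsub>R\<^esub> PIdl (f [^] m)"
    have memL': "y \<in> L' \<longleftrightarrow> (\<exists>l\<in>L. \<exists>r\<in>carrier R. y = l \<oplus> r \<otimes> f [^] m)" for y
      by (auto simp: L'_def set_add_def' cgenideal_def)
    have "L' = L"
    proof (rule max)
      show "ideal L' R" unfolding L'_def using fc by (intro add_ideals L(1) cgenideal_ideal) simp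
      show "L \<subseteq> L'"
      proof
        fix l assume "l \<in> L"
        then have "l = l \<oplus> \<zero> \<otimes> f [^] m" using fc L.Icarr by simp
        then show "l \<in> L'" unfolding memL' using \<open>l \<in> L\<close> zero_closed by blast
      qed
      show "L' \<inter> I \<subseteq> J"
      proof
        fix y assume y: "y \<in> L' \<inter> I"
        then obtain l r where lr: "l \<in> L" "r \<in> carrier R" "y = l \<oplus> r \<otimes> f [^] m" by (auto simp: memL')
        have lc: "l \<in> carrier R" using lr L.Icarr by blast
        have "f [^] n \<otimes> y \<in> L" using n y L(3) by blast
        moreover have "f [^] n \<otimes> y = r \<otimes> f [^] (m + n) \<oplus> f [^] n \<otimes> l"
          using lr(2,3) lc fc by (simp add: r_distr nat_pow_mult[symmetric] m_ac a_comm)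
        moreover have "f [^] n \<otimes> l \<in> L" using fc lr(1) by (intro L.I_l_closed) auto
        ultimately have "(r \<otimes> f [^] (m + n) \<oplus> f [^] n \<otimes> l) \<oplus> \<ominus> (f [^] n \<otimes> l) \<in> L"
          by (simp add: L.a_closed)
        then have "r \<otimes> f [^] (m + n) \<in> L" using lr(2) lc fc by (simp add: a_assoc r_neg)
        then have "r \<otimes> f [^] m \<in> L" by (rule stat[OF lr(2)])
        then show "y \<in> J" using lr L(2) y by blast
      qed
    qed
    moreover have "f [^] m = \<zero> \<oplus> \<one> \<otimes> f [^] m" using fc by simp
    then have "f [^] m \<in> L'" unfolding memL' using L.zero_closed one_closed by blast
    ultimately show ?thesis by blast
  qed
  then show ?thesis using that L by blast
qed

locale noetherian_injective = injective_module R E + R?: noetherian_ring R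
  for R :: "('a, 'm) ring_scheme" (structure) and E :: "('a, 'c, 'k) module_scheme" (structure)

sublocale noetherian_injective \<subseteq> noetherian_module_base R E
  by unfold_locales

context noetherian_injective
begin

text \<open>This is Baer's criterion for the torsion submodule.  A homomorphism \<open>\<phi>\<close> with torsion values
  vanishes on \<open>L \<inter> I\<close> for some \<open>L\<close> that contains a power of each element of \<open>a\<close>; extend it by zero
  to \<open>I + L\<close> and then to the ring.\<close>

lemma hom_to_torsion_extends:
  assumes a: "ideal a R" and I: "ideal I R"
    and add: "\<And>r s. r \<in> I \<Longrightarrow> s \<in> I \<Longrightarrow> \<phi> (r \<oplus>\<^bsub>R\<^esub> s) = \<phi> r \<oplus>\<^bsub>E\<^esub> \<phi> s"
    and smult: "\<And>r s. r \<in> carrier R \<Longrightarrow> s \<in> I \<Longrightarrow> \<phi> (r \<otimes>\<^bsub>R\<^esub> s) = r \<odot>\<^bsub>E\<^esub> \<phi> s"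
    and closed: "\<And>r. r \<in> I \<Longrightarrow> \<phi> r \<in> carrier (torsion_module R a E)"
  shows "\<exists>e\<in>carrier (torsion_module R a E). \<forall>r\<in>I. \<phi> r = r \<odot>\<^bsub>E\<^esub> e"
proof -
  have ac: "a \<subseteq> carrier R" using ideal.Icarr[OF a] by blast
  note T = carrier_torsion_module[OF a]
  have cl: "\<phi> r \<in> carrier E" and tors: "torsion_mod R a E {\<zero>\<^bsub>E\<^esub>} (\<phi> r)" if "r \<in> I" for r
    using closed[OF that] T by auto
  interpret I: ideal I R by (rule I)
  have \<phi>0: "\<phi> \<zero> = \<zero>\<^bsub>E\<^esub>" using smult[OF R.zero_closed I.zero_closed] cl[OF I.zero_closed] by simp
  define J where "J = {r \<in> I. \<phi> r = \<zero>\<^bsub>E\<^esub>}"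
  have J: "ideal J R" "J \<subseteq> I"
    unfolding R.ideal_iff J_def using add smult \<phi>0 I.Icarr I.I_l_closed by auto
  obtain F where F: "F \<subseteq> carrier R" "finite F" "I = Idl F" using R.finetely_gen[OF I] by blast
  have FI: "F \<subseteq> I" using F R.genideal_self by blast
  have "\<exists>n::nat. \<forall>i\<in>I. f [^] n \<otimes> i \<in> J" if f: "f \<in> a" for f
  proof -
    have fc: "f \<in> carrier R" using f ac by blast
    have "\<exists>n::nat. \<forall>i\<in>F'. (f [^] n) \<odot>\<^bsub>E\<^esub> \<phi> i = \<zero>\<^bsub>E\<^esub>" if "F' \<subseteq> F" for F'
      using finite_subset[OF that F(2)] that
    proof (induction F' rule: finite_induct)
      case (insert i F')
      then obtain n :: nat where n: "\<And>i. i \<in> F' \<Longrightarrow> (f [^] n) \<odot>\<^bsub>E\<^esub> \<phi> i = \<zero>\<^bsub>E\<^esub>" by auto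
      obtain k :: nat where k: "(f [^] k) \<odot>\<^bsub>E\<^esub> \<phi> i = \<zero>\<^bsub>E\<^esub>"
        using tors[of i] insert.prems FI f unfolding torsion_mod_def by auto
      have "(f [^] (n + k)) \<odot>\<^bsub>E\<^esub> \<phi> j = \<zero>\<^bsub>E\<^esub>" if j: "j \<in> insert i F'" for j
      proof (cases "j = i")
        case True
        then show ?thesis using k fc cl insert.prems FI
          by (auto simp: R.nat_pow_mult[symmetric] smult_assoc1)
      next
        case False
        then have "j \<in> F'" "j \<in> I" using j insert.prems FI by auto
        then show ?thesis using n[of j] fc cl[of j]
          by (simp add: R.nat_pow_mult[symmetric] smult_assoc1 smult_commute[of "f [^] n"])
      qed
      then show ?case by blast
    qed auto
    from this[OF subset_refl] obtain n :: nat where n: "\<forall>i\<in>F. (f [^] n) \<odot>\<^bsub>E\<^esub> \<phi> i = \<zero>\<^bsub>E\<^esub>" ..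
    have "ideal {r \<in> I. (f [^] n) \<odot>\<^bsub>E\<^esub> \<phi> r = \<zero>\<^bsub>E\<^esub>} R"
      unfolding R.ideal_iff using fc add smult \<phi>0 I.Icarr I.I_l_closed cl
      by (auto simp: smult_r_distr smult_commute[of "f [^] n"])
    then have "I \<subseteq> {r \<in> I. (f [^] n) \<odot>\<^bsub>E\<^esub> \<phi> r = \<zero>\<^bsub>E\<^esub>}"
      unfolding F(3) using n FI F(1,3) by (intro R.genideal_minimal) auto
    then have "\<forall>i\<in>I. f [^] n \<otimes> i \<in> J"
      using fc I.I_l_closed by (auto simp: J_def smult)
    then show ?thesis ..
  qed
  from R.artin_rees_weak[OF R.is_cring I J ac this]
  obtain L where L: "ideal L R" "L \<inter> I \<subseteq> J" "\<And>f. f \<in> a \<Longrightarrow> \<exists>m::nat. f [^] m \<in> L" by blast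
  interpret L: ideal L R by (rule L(1))
  define \<psi> where "\<psi> r = \<phi> (SOME i. i \<in> I \<and> (\<exists>l\<in>L. r = i \<oplus> l))" for r
  have \<psi>: "\<psi> (i \<oplus> l) = \<phi> i" if il: "i \<in> I" "l \<in> L" for i l
  proof -
    define i' where "i' = (SOME i'. i' \<in> I \<and> (\<exists>l'\<in>L. i \<oplus> l = i' \<oplus> l'))"
    have "i' \<in> I \<and> (\<exists>l'\<in>L. i \<oplus> l = i' \<oplus> l')" unfolding i'_def by (rule someI) (use il in blast)
    then obtain l' where l': "i' \<in> I" "l' \<in> L" "i \<oplus> l = i' \<oplus> l'" by blast
    have c: "i \<in> carrier R" "i' \<in> carrier R" "l \<in> carrier R" "l' \<in> carrier R"
      using il l' I.Icarr L.Icarr by auto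
    have "i \<oplus> \<ominus> i' = l' \<oplus> \<ominus> l"
    proof -
      have "i \<oplus> \<ominus> i' = (i \<oplus> l) \<oplus> (\<ominus> l \<oplus> \<ominus> i')" using c by (simp add: R.a_assoc R.r_neg2)
      also have "\<dots> = (l' \<oplus> \<ominus> l) \<oplus> (i' \<oplus> \<ominus> i')" unfolding l'(3) using c by (simp add: R.a_ac)
      also have "\<dots> = l' \<oplus> \<ominus> l" using c by (simp add: R.r_neg)
      finally show ?thesis .
    qed
    then have "i \<oplus> \<ominus> i' \<in> L \<inter> I" using il l' by (metis IntI I.a_closed I.a_inv_closed L.a_closed L.a_inv_closed)
    then have d: "i \<oplus> \<ominus> i' \<in> I" "\<phi> (i \<oplus> \<ominus> i') = \<zero>\<^bsub>E\<^esub>" using L(2) by (auto simp: J_def)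
    have "\<phi> i = \<phi> ((i \<oplus> \<ominus> i') \<oplus> i')" using c by (simp add: R.a_assoc R.l_neg)
    also have "\<dots> = \<phi> i'" using add[OF d(1) l'(1)] d(2) cl[OF l'(1)] by simp
    finally show ?thesis by (simp add: \<psi>_def i'_def)
  qed
  have IL: "ideal (I <+>\<^bsub>R\<^esub> L) R" by (rule R.add_ideals[OF I L(1)])
  have mem: "r \<in> I <+>\<^bsub>R\<^esub> L \<longleftrightarrow> (\<exists>i\<in>I. \<exists>l\<in>L. r = i \<oplus> l)" for r by (auto simp: set_add_def')
  have "\<exists>e\<in>carrier E. \<forall>r\<in>I <+>\<^bsub>R\<^esub> L. \<psi> r = r \<odot>\<^bsub>E\<^esub> e"
  proof (rule hom_from_ideal_extends[OF IL, of \<psi>])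
    fix r s assume "r \<in> I <+>\<^bsub>R\<^esub> L" "s \<in> I <+>\<^bsub>R\<^esub> L"
    then obtain i l j k where *: "i \<in> I" "l \<in> L" "r = i \<oplus> l" "j \<in> I" "k \<in> L" "s = j \<oplus> k"
      unfolding mem by blast
    then have "r \<oplus> s = (i \<oplus> j) \<oplus> (l \<oplus> k)" using I.Icarr L.Icarr by (simp add: R.a_ac)
    then show "\<psi> (r \<oplus> s) = \<psi> r \<oplus>\<^bsub>E\<^esub> \<psi> s" using * add by (simp add: \<psi>)
  next
    fix r s assume r: "r \<in> carrier R" and "s \<in> I <+>\<^bsub>R\<^esub> L"
    then obtain j k where *: "j \<in> I" "k \<in> L" "s = j \<oplus> k"
      unfolding mem by blast
    then have "r \<otimes> s = r \<otimes> j \<oplus> r \<otimes> k" using I.Icarr L.Icarr r by (simp add: R.r_distr)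
    then show "\<psi> (r \<otimes> s) = r \<odot>\<^bsub>E\<^esub> \<psi> s"
      using * smult r I.I_l_closed L.I_l_closed by (simp add: \<psi>)
  next
    fix r assume "r \<in> I <+>\<^bsub>R\<^esub> L"
    then show "\<psi> r \<in> carrier E" unfolding mem using \<psi> cl by auto
  qed
  then obtain e where e: "e \<in> carrier E" "\<And>r. r \<in> I <+>\<^bsub>R\<^esub> L \<Longrightarrow> \<psi> r = r \<odot>\<^bsub>E\<^esub> e" by auto
  show ?thesis
  proof (rule bexI[of _ e], rule ballI)
    fix r assume r: "r \<in> I"
    show "\<phi> r = r \<odot>\<^bsub>E\<^esub> e"
    proof -
      have "r = r \<oplus> \<zero>" using r I.Icarr by simp
      then have "r \<in> I <+>\<^bsub>R\<^esub> L" unfolding mem using r L.zero_closed by blast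
      then show ?thesis using e(2)[of r] \<psi>[OF r L.zero_closed] r I.Icarr by simp
    qed
  next
    have Le: "l \<odot>\<^bsub>E\<^esub> e = \<zero>\<^bsub>E\<^esub>" if l: "l \<in> L" for l
    proof -
      have "l = \<zero> \<oplus> l" using l L.Icarr by simp
      then have "l \<in> I <+>\<^bsub>R\<^esub> L" unfolding mem using l I.zero_closed by blast
      then show ?thesis using e(2)[of l] \<psi>[OF I.zero_closed l] \<phi>0 l L.Icarr by simp
    qed
    show "e \<in> carrier (torsion_module R a E)"
      unfolding T torsion_mod_def using e(1) Le L(3) by blast
  qed
qed

text \<open>A submodule \<open>F\<close> that is maximal among those meeting the torsion submodule trivially is a
  complement of it: the torsion component of an element \<open>v\<close>, defined on the ideal of all \<open>r\<close> with
  \<open>rv \<in> \<Gamma> + F\<close>, is multiplication by some torsion \<open>e\<close>, and then \<open>v - e\<close> can be added to \<open>F\<close>.\<close>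

lemma torsion_complement:
  assumes a: "ideal a R"
  obtains F where "submodule F R E" "F \<inter> carrier (torsion_module R a E) = {\<zero>\<^bsub>E\<^esub>}"
    "carrier E = carrier (torsion_module R a E) <+>\<^bsub>E\<^esub> F"
proof -
  let ?T = "carrier (torsion_module R a E)"
  note T = submodule_torsion_module[OF a]
  note Tmem = submodule_mem[OF T]
  let ?A = "{F. submodule F R E \<and> F \<inter> ?T = {\<zero>\<^bsub>E\<^esub>}}"
  have "\<exists>F\<in>?A. \<forall>F'\<in>?A. F \<subseteq> F' \<longrightarrow> F' = F"
  proof (rule subset_Zorn_nonempty)
    show "?A \<noteq> {}" using submodule_zero Tmem(2) by blast
    fix C assume C: "C \<noteq> {}" "subset.chain ?A C"
    then have mem: "submodule F R E" "F \<inter> ?T = {\<zero>\<^bsub>E\<^esub>}" if "F \<in> C" for F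
      using that by (auto simp: subset.chain_def)
    have "submodule (\<Union>C) R E"
      unfolding submodule_iff
    proof (intro conjI ballI)
      show "\<Union>C \<subseteq> carrier E" using mem(1) submodule_mem(1) by blast
      show "\<zero>\<^bsub>E\<^esub> \<in> \<Union>C" using C(1) mem(1) submodule_mem(2) by blast
      fix x y assume "x \<in> \<Union>C" "y \<in> \<Union>C"
      then obtain F F' where "F \<in> C" "F' \<in> C" "x \<in> F" "y \<in> F'" by blast
      moreover then have "F \<subseteq> F' \<or> F' \<subseteq> F" using C(2) by (auto simp: subset.chain_def)
      ultimately obtain F'' where "F'' \<in> C" "x \<in> F''" "y \<in> F''" by blast
      then show "x \<oplus>\<^bsub>E\<^esub> y \<in> \<Union>C" using submodule_mem(3)[OF mem(1)] by blast
    next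
      fix r x assume "r \<in> carrier R" "x \<in> \<Union>C"
      then show "r \<odot>\<^bsub>E\<^esub> x \<in> \<Union>C" using submodule_mem(5)[OF mem(1)] by blast
    qed
    moreover have "\<Union>C \<inter> ?T = {\<zero>\<^bsub>E\<^esub>}" using C(1) mem(2) by blast
    ultimately show "\<Union>C \<in> ?A" by blast
  qed
  then obtain F where "F \<in> ?A" "\<forall>F'\<in>?A. F \<subseteq> F' \<longrightarrow> F' = F" by (rule bexE)
  then have F: "submodule F R E" "F \<inter> ?T = {\<zero>\<^bsub>E\<^esub>}"
    and max: "\<And>F'. submodule F' R E \<Longrightarrow> F' \<inter> ?T = {\<zero>\<^bsub>E\<^esub>} \<Longrightarrow> F \<subseteq> F' \<Longrightarrow> F' = F" by auto
  note Fmem = submodule_mem[OF F(1)]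
  have TF: "submodule (?T <+>\<^bsub>E\<^esub> F) R E" by (rule submodule_set_add[OF T F(1)])
  have uniq: "g = g'" if "g \<in> ?T" "g' \<in> ?T" "w \<in> F" "w' \<in> F" "g \<oplus>\<^bsub>E\<^esub> w = g' \<oplus>\<^bsub>E\<^esub> w'" for g g' w w'
  proof -
    have c: "g \<in> carrier E" "g' \<in> carrier E" "w \<in> carrier E" "w' \<in> carrier E" 
      using that Tmem(1) Fmem(1) by auto
    have "(g \<ominus>\<^bsub>E\<^esub> g') \<oplus>\<^bsub>E\<^esub> w = (g \<oplus>\<^bsub>E\<^esub> w) \<ominus>\<^bsub>E\<^esub> g'" using c by (simp add: a_minus_def M.a_ac)
    also have "\<dots> = w'" using that(5) c by simp
    finally have "w' \<ominus>\<^bsub>E\<^esub> w = g \<ominus>\<^bsub>E\<^esub> g'" using c by (simp add: diff_eq_iff)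
    moreover have "g \<ominus>\<^bsub>E\<^esub> g' \<in> ?T" "w' \<ominus>\<^bsub>E\<^esub> w \<in> F" using that Tmem(4) Fmem(4) by auto
    ultimately have "g \<ominus>\<^bsub>E\<^esub> g' = \<zero>\<^bsub>E\<^esub>" using F(2) by auto
    then show ?thesis using c by (simp add: diff_eq_iff)
  qed
  have "carrier E \<subseteq> ?T <+>\<^bsub>E\<^esub> F"
  proof
    fix v assume v: "v \<in> carrier E"
    define I where "I = {r \<in> carrier R. r \<odot>\<^bsub>E\<^esub> v \<in> ?T <+>\<^bsub>E\<^esub> F}"
    have I: "ideal I R" using ideal_colon[OF TF v] by (simp add: colon_def I_def)
    define \<phi> where "\<phi> r = (THE g. g \<in> ?T \<and> (\<exists>w\<in>F. r \<odot>\<^bsub>E\<^esub> v = g \<oplus>\<^bsub>E\<^esub> w))" for r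
    have \<phi>eq: "\<phi> r = g" if "g \<in> ?T" "w \<in> F" "r \<odot>\<^bsub>E\<^esub> v = g \<oplus>\<^bsub>E\<^esub> w" for r g w
      unfolding \<phi>_def
    proof (rule the_equality)
      show "g \<in> ?T \<and> (\<exists>w\<in>F. r \<odot>\<^bsub>E\<^esub> v = g \<oplus>\<^bsub>E\<^esub> w)" using that by blast
      fix g' assume "g' \<in> ?T \<and> (\<exists>w\<in>F. r \<odot>\<^bsub>E\<^esub> v = g' \<oplus>\<^bsub>E\<^esub> w)"
      then show "g' = g" using uniq[of g' g _ w] that by auto
    qed
    have Idec: "\<exists>g w. g \<in> ?T \<and> w \<in> F \<and> r \<odot>\<^bsub>E\<^esub> v = g \<oplus>\<^bsub>E\<^esub> w \<and> \<phi> r = g" if r: "r \<in> I" for r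
    proof -
      have "r \<odot>\<^bsub>E\<^esub> v \<in> ?T <+>\<^bsub>E\<^esub> F" using r by (simp add: I_def)
      then obtain g w where "g \<in> ?T" "w \<in> F" "r \<odot>\<^bsub>E\<^esub> v = g \<oplus>\<^bsub>E\<^esub> w" by (rule set_addE)
      then show ?thesis using \<phi>eq by blast
    qed
    have Ic: "r \<in> carrier R" if "r \<in> I" for r using that by (simp add: I_def)
    have "\<exists>e\<in>?T. \<forall>r\<in>I. \<phi> r = r \<odot>\<^bsub>E\<^esub> e"
    proof (rule hom_to_torsion_extends[OF a I, of \<phi>])
      fix r s assume rs: "r \<in> I" "s \<in> I"
      obtain g w where gw: "g \<in> ?T" "w \<in> F" "r \<odot>\<^bsub>E\<^esub> v = g \<oplus>\<^bsub>E\<^esub> w" "\<phi> r = g" using Idec rs by blast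
      obtain g' w' where gw': "g' \<in> ?T" "w' \<in> F" "s \<odot>\<^bsub>E\<^esub> v = g' \<oplus>\<^bsub>E\<^esub> w'" "\<phi> s = g'" using Idec rs by blast
      have "(r \<oplus>\<^bsub>R\<^esub> s) \<odot>\<^bsub>E\<^esub> v = (g \<oplus>\<^bsub>E\<^esub> g') \<oplus>\<^bsub>E\<^esub> (w \<oplus>\<^bsub>E\<^esub> w')"
        using rs Ic v gw gw' Tmem(1) Fmem(1) by (simp add: smult_l_distr M.a_ac)
      then show "\<phi> (r \<oplus>\<^bsub>R\<^esub> s) = \<phi> r \<oplus>\<^bsub>E\<^esub> \<phi> s" 
        using \<phi>eq[OF Tmem(3)[OF gw(1) gw'(1)] Fmem(3)[OF gw(2) gw'(2)]] gw gw' by simp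
    next
      fix r s assume rs: "r \<in> carrier R" "s \<in> I"
      obtain g w where gw: "g \<in> ?T" "w \<in> F" "s \<odot>\<^bsub>E\<^esub> v = g \<oplus>\<^bsub>E\<^esub> w" "\<phi> s = g" using Idec rs by blast
      have "(r \<otimes>\<^bsub>R\<^esub> s) \<odot>\<^bsub>E\<^esub> v = (r \<odot>\<^bsub>E\<^esub> g) \<oplus>\<^bsub>E\<^esub> (r \<odot>\<^bsub>E\<^esub> w)"
        using rs Ic v gw Tmem(1) Fmem(1) by (simp add: smult_assoc1 smult_r_distr)
      then show "\<phi> (r \<otimes>\<^bsub>R\<^esub> s) = r \<odot>\<^bsub>E\<^esub> \<phi> s" 
        using \<phi>eq[OF Tmem(5)[OF rs(1) gw(1)] Fmem(5)[OF rs(1) gw(2)]] gw by simp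
    next
      fix r assume "r \<in> I"
      then show "\<phi> r \<in> ?T" using Idec by blast
    qed
    then obtain e where e: "e \<in> ?T" "\<And>r. r \<in> I \<Longrightarrow> \<phi> r = r \<odot>\<^bsub>E\<^esub> e" by auto
    have ec: "e \<in> carrier E" using e Tmem by blast
    define u where "u = v \<ominus>\<^bsub>E\<^esub> e"
    have uc: "u \<in> carrier E" using v ec by (simp add: u_def)
    have Iu: "r \<odot>\<^bsub>E\<^esub> u \<in> F" if r: "r \<in> I" for r
    proof -
      obtain g w where gw: "g \<in> ?T" "w \<in> F" "r \<odot>\<^bsub>E\<^esub> v = g \<oplus>\<^bsub>E\<^esub> w" "\<phi> r = g" using Idec r by blast
      have "r \<odot>\<^bsub>E\<^esub> u = (g \<oplus>\<^bsub>E\<^esub> w) \<ominus>\<^bsub>E\<^esub> g"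
        using gw e(2)[OF r] Ic[OF r] v ec by (simp add: u_def smult_r_diff)
      then show ?thesis using gw Tmem(1) Fmem(1) by simp
    qed
    define F' where "F' = F <+>\<^bsub>E\<^esub> (\<lambda>r. r \<odot>\<^bsub>E\<^esub> u) ` carrier R"
    have Ru: "submodule ((\<lambda>r. r \<odot>\<^bsub>E\<^esub> u) ` carrier R) R E"
      unfolding submodule_iff
    proof (intro conjI ballI)
      show "\<zero>\<^bsub>E\<^esub> \<in> (\<lambda>r. r \<odot>\<^bsub>E\<^esub> u) ` carrier R" using uc by (intro image_eqI[of _ _ "\<zero>"]) auto
      fix x y assume "x \<in> (\<lambda>r. r \<odot>\<^bsub>E\<^esub> u) ` carrier R" "y \<in> (\<lambda>r. r \<odot>\<^bsub>E\<^esub> u) ` carrier R"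
      then show "x \<oplus>\<^bsub>E\<^esub> y \<in> (\<lambda>r. r \<odot>\<^bsub>E\<^esub> u) ` carrier R"
        using uc by (auto simp: smult_l_distr[symmetric])
    next
      fix r x assume "r \<in> carrier R" "x \<in> (\<lambda>r. r \<odot>\<^bsub>E\<^esub> u) ` carrier R"
      then show "r \<odot>\<^bsub>E\<^esub> x \<in> (\<lambda>r. r \<odot>\<^bsub>E\<^esub> u) ` carrier R"
        using uc by (auto simp: smult_assoc1[symmetric])
    qed (use uc in auto)
    have F': "submodule F' R E" "F \<subseteq> F'" "(\<lambda>r. r \<odot>\<^bsub>E\<^esub> u) ` carrier R \<subseteq> F'"
      unfolding F'_def by (rule submodule_set_add[OF F(1) Ru] set_add_ge1[OF F(1) Ru] set_add_ge2[OF F(1) Ru])+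
    have "F' \<inter> ?T \<subseteq> {\<zero>\<^bsub>E\<^esub>}"
    proof
      fix g assume g: "g \<in> F' \<inter> ?T"
      then have "g \<in> F <+>\<^bsub>E\<^esub> (\<lambda>r. r \<odot>\<^bsub>E\<^esub> u) ` carrier R" by (simp add: F'_def)
      then obtain w x where wx: "w \<in> F" "x \<in> (\<lambda>r. r \<odot>\<^bsub>E\<^esub> u) ` carrier R" "g = w \<oplus>\<^bsub>E\<^esub> x"
        by (rule set_addE)
      then obtain r where r: "r \<in> carrier R" "x = r \<odot>\<^bsub>E\<^esub> u" by blast
      have c: "w \<in> carrier E" "g \<in> carrier E" "x \<in> carrier E" using wx g r uc Fmem(1) Tmem(1) by auto
      have "r \<odot>\<^bsub>E\<^esub> v = r \<odot>\<^bsub>E\<^esub> u \<oplus>\<^bsub>E\<^esub> r \<odot>\<^bsub>E\<^esub> e"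
        using r v ec uc by (simp add: smult_r_distr[symmetric] u_def)
      also have "r \<odot>\<^bsub>E\<^esub> u = g \<ominus>\<^bsub>E\<^esub> w" using wx(3) c r(2) by simp
      also have "(g \<ominus>\<^bsub>E\<^esub> w) \<oplus>\<^bsub>E\<^esub> r \<odot>\<^bsub>E\<^esub> e = (g \<oplus>\<^bsub>E\<^esub> r \<odot>\<^bsub>E\<^esub> e) \<oplus>\<^bsub>E\<^esub> (\<zero>\<^bsub>E\<^esub> \<ominus>\<^bsub>E\<^esub> w)"
        using c r ec by (simp add: a_minus_def M.a_ac)
      also have "\<dots> \<in> ?T <+>\<^bsub>E\<^esub> F"
        using g e(1) wx(1) r(1) Tmem Fmem by (intro set_addI) auto
      finally have "r \<in> I" using r by (simp add: I_def)
      then have "g \<in> F" using Iu wx r Fmem(3) by simp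
      then show "g \<in> {\<zero>\<^bsub>E\<^esub>}" using F(2) g by blast
    qed
    then have "F' = F" using F' Tmem(2) submodule_mem(2)[OF F'(1)] by (intro max) auto
    moreover have "u \<in> F'"
    proof -
      have "\<one> \<odot>\<^bsub>E\<^esub> u \<in> (\<lambda>r. r \<odot>\<^bsub>E\<^esub> u) ` carrier R" by (rule imageI) simp
      then show ?thesis using F'(3) uc by auto
    qed
    ultimately have "e \<oplus>\<^bsub>E\<^esub> u \<in> ?T <+>\<^bsub>E\<^esub> F" using e(1) by (intro set_addI) auto
    then show "v \<in> ?T <+>\<^bsub>E\<^esub> F" using v ec by (simp add: u_def)
  qed
  moreover have "?T <+>\<^bsub>E\<^esub> F \<subseteq> carrier E" using submodule_mem(1)[OF TF] by blast
  ultimately show ?thesis using F by (intro that) auto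
qed

lemma torsion_free_projection:
  assumes a: "ideal a R"
  obtains \<rho> where "\<rho> \<in> mod_hom R E E"
    "\<And>v. v \<in> carrier (torsion_module R a E) \<Longrightarrow> \<rho> v = \<zero>\<^bsub>E\<^esub>"
    "\<And>v. v \<in> carrier E \<Longrightarrow> v \<ominus>\<^bsub>E\<^esub> \<rho> v \<in> carrier (torsion_module R a E)"
proof -
  let ?T = "carrier (torsion_module R a E)"
  note T = submodule_torsion_module[OF a]
  note Tmem = submodule_mem[OF T]
  obtain F where F: "submodule F R E" "F \<inter> ?T = {\<zero>\<^bsub>E\<^esub>}" "carrier E = ?T <+>\<^bsub>E\<^esub> F"
    by (rule torsion_complement[OF a])
  note Fmem = submodule_mem[OF F(1)]
  define \<rho> where "\<rho> v = (THE w. w \<in> F \<and> v \<ominus>\<^bsub>E\<^esub> w \<in> ?T)" for v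
  have \<rho>: "\<rho> (g \<oplus>\<^bsub>E\<^esub> w) = w" if "g \<in> ?T" "w \<in> F" for g w
    unfolding \<rho>_def
  proof (rule the_equality)
    have c: "g \<in> carrier E" "w \<in> carrier E" using that Tmem(1) Fmem(1) by auto
    show "w \<in> F \<and> g \<oplus>\<^bsub>E\<^esub> w \<ominus>\<^bsub>E\<^esub> w \<in> ?T" using that c by simp
    fix w' assume w': "w' \<in> F \<and> g \<oplus>\<^bsub>E\<^esub> w \<ominus>\<^bsub>E\<^esub> w' \<in> ?T"
    then have c': "w' \<in> carrier E" using Fmem(1) by blast
    have "(g \<oplus>\<^bsub>E\<^esub> w \<ominus>\<^bsub>E\<^esub> w') \<ominus>\<^bsub>E\<^esub> g \<in> ?T" using w' that Tmem(4) by blast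
    moreover have "(g \<oplus>\<^bsub>E\<^esub> w \<ominus>\<^bsub>E\<^esub> w') \<ominus>\<^bsub>E\<^esub> g = w \<ominus>\<^bsub>E\<^esub> w'"
    proof -
      have "g \<oplus>\<^bsub>E\<^esub> w \<ominus>\<^bsub>E\<^esub> w' = g \<oplus>\<^bsub>E\<^esub> (w \<ominus>\<^bsub>E\<^esub> w')" using c c' by (simp add: a_minus_def M.a_assoc)
      then show ?thesis using c c' by simp
    qed
    moreover have "w \<ominus>\<^bsub>E\<^esub> w' \<in> F" using w' that Fmem(4) by blast
    ultimately have "w \<ominus>\<^bsub>E\<^esub> w' = \<zero>\<^bsub>E\<^esub>" using F(2) by auto
    then show "w' = w" using c c' by (simp add: diff_eq_iff)
  qed
  have dec: "\<exists>g w. g \<in> ?T \<and> w \<in> F \<and> v = g \<oplus>\<^bsub>E\<^esub> w" if v: "v \<in> carrier E" for v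
  proof -
    have "v \<in> ?T <+>\<^bsub>E\<^esub> F" using v F(3) by simp
    then obtain g w where "g \<in> ?T" "w \<in> F" "v = g \<oplus>\<^bsub>E\<^esub> w" by (rule set_addE)
    then show ?thesis by blast
  qed
  show ?thesis
  proof (rule that)
    show "\<rho> \<in> mod_hom R E E"
    proof (rule mod_homI)
      fix v assume "v \<in> carrier E"
      then show "\<rho> v \<in> carrier E" using dec[of v] \<rho> Fmem(1) by auto
    next
      fix v v' assume v: "v \<in> carrier E" "v' \<in> carrier E"
      obtain g w where 1: "g \<in> ?T" "w \<in> F" "v = g \<oplus>\<^bsub>E\<^esub> w" using dec[OF v(1)] by auto
      obtain g' w' where 2: "g' \<in> ?T" "w' \<in> F" "v' = g' \<oplus>\<^bsub>E\<^esub> w'" using dec[OF v(2)] by auto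
      note * = 1 2
      have "v \<oplus>\<^bsub>E\<^esub> v' = (g \<oplus>\<^bsub>E\<^esub> g') \<oplus>\<^bsub>E\<^esub> (w \<oplus>\<^bsub>E\<^esub> w')"
        using * Tmem(1) Fmem(1) by (simp add: M.a_ac)
      then show "\<rho> (v \<oplus>\<^bsub>E\<^esub> v') = \<rho> v \<oplus>\<^bsub>E\<^esub> \<rho> v'" using * \<rho> Tmem(3) Fmem(3) by simp
    next
      fix r v assume r: "r \<in> carrier R" and v: "v \<in> carrier E"
      obtain g w where *: "g \<in> ?T" "w \<in> F" "v = g \<oplus>\<^bsub>E\<^esub> w" using dec[OF v] by auto
      then have "r \<odot>\<^bsub>E\<^esub> v = r \<odot>\<^bsub>E\<^esub> g \<oplus>\<^bsub>E\<^esub> r \<odot>\<^bsub>E\<^esub> w"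
        using Tmem(1) Fmem(1) r by (simp add: smult_r_distr)
      then show "\<rho> (r \<odot>\<^bsub>E\<^esub> v) = r \<odot>\<^bsub>E\<^esub> \<rho> v" using * \<rho> Tmem(5) Fmem(5) r by simp
    qed
    show "\<rho> v = \<zero>\<^bsub>E\<^esub>" if "v \<in> ?T" for v
      using \<rho>[OF that Fmem(2)] Tmem(1)[OF that] by simp
    show "v \<ominus>\<^bsub>E\<^esub> \<rho> v \<in> ?T" if "v \<in> carrier E" for v
    proof -
      obtain g w where *: "g \<in> ?T" "w \<in> F" "v = g \<oplus>\<^bsub>E\<^esub> w" using dec[OF \<open>v \<in> carrier E\<close>] by auto
      then show ?thesis using \<rho>[OF *(1,2)] Tmem(1) Fmem(1) by simp
    qed
  qed
qed

end

section \<open>Cochain complexes and their torsion subcomplexes\<close>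

abbreviation cocycles :: "(nat \<Rightarrow> ('a, 'c) module) \<Rightarrow> (nat \<Rightarrow> 'c \<Rightarrow> 'c) \<Rightarrow> nat \<Rightarrow> 'c set"
  where "cocycles X d j \<equiv> a_kernel (X j) (X (Suc j)) (d j)"

locale cochain_complex =
  fixes R :: "('a, 'm) ring_scheme" and X :: "nat \<Rightarrow> ('a, 'c) module" and d :: "nat \<Rightarrow> 'c \<Rightarrow> 'c"
  assumes module: "module R (X j)"
    and hom: "d j \<in> mod_hom R (X j) (X (Suc j))"
    and square: "x \<in> carrier (X j) \<Longrightarrow> d (Suc j) (d j x) = \<zero>\<^bsub>X (Suc (Suc j))\<^esub>"
begin

lemma cocycles_iff: "z \<in> cocycles X d j \<longleftrightarrow> z \<in> carrier (X j) \<and> d j z = \<zero>\<^bsub>X (Suc j)\<^esub>"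
  by (simp add: a_kernel_def')

lemma submodule_cocycles: "submodule (cocycles X d j) R (X j)"
  by (rule submodule_kernel[OF module module hom])

lemma submodule_coboundaries: "submodule (coboundaries X d j) R (X j)"
proof (cases j)
  case 0
  then show ?thesis using module.submodule_zero[OF module] by (simp add: coboundaries_def)
next
  case (Suc i)
  then show ?thesis
    using submodule_image[OF module module hom module.carrier_is_submodule[OF module], of i]
    by (simp add: coboundaries_def)
qed

lemma coboundaries_le_cocycles: "coboundaries X d j \<subseteq> cocycles X d j"
proof (cases j)
  case 0
  then show ?thesis using module.submodule_mem(2)[OF module submodule_cocycles] by (simp add: coboundaries_def)
next
  case (Suc i)
  then show ?thesis using mod_homD(1)[OF hom] square by (auto simp: coboundaries_def cocycles_iff)
qed

lemma cohomology_interval: "interval R (X j) (coboundaries X d j) (cocycles X d j)"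
  using module submodule_cocycles submodule_coboundaries coboundaries_le_cocycles
  by (simp add: interval_def)

lemma reduced_interval:
  assumes a: "a \<subseteq> carrier R"
  shows "submodule (ideal_times R (X j) a (cocycles X d j)) R (X j)"
    and "interval R (X j) (ideal_times R (X j) a (cocycles X d j) <+>\<^bsub>X j\<^esub> coboundaries X d j) (cocycles X d j)"
proof -
  interpret M: module R "X j" by (rule module)
  let ?aZ = "ideal_times R (X j) a (cocycles X d j)"
  note Z = submodule_cocycles[of j] and B = submodule_coboundaries[of j]
  show aZ: "submodule ?aZ R (X j)"
    using a M.submodule_mem(1)[OF Z] by (intro M.submodule_ideal_times) auto
  have "?aZ \<subseteq> cocycles X d j"
    using a M.submodule_mem(5)[OF Z] by (intro M.ideal_times_least Z) auto
  then have "?aZ <+>\<^bsub>X j\<^esub> coboundaries X d j \<subseteq> cocycles X d j"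
    using coboundaries_le_cocycles by (rule M.set_add_least[OF Z])
  then show "interval R (X j) (?aZ <+>\<^bsub>X j\<^esub> coboundaries X d j) (cocycles X d j)"
    using module M.submodule_set_add[OF aZ B] Z by (simp add: interval_def)
qed

end

lemma torsion_module_simps [simp]:
  "\<zero>\<^bsub>torsion_module R a M\<^esub> = \<zero>\<^bsub>M\<^esub>" "(\<oplus>\<^bsub>torsion_module R a M\<^esub>) = (\<oplus>\<^bsub>M\<^esub>)"
  "(\<odot>\<^bsub>torsion_module R a M\<^esub>) = (\<odot>\<^bsub>M\<^esub>)"
  by (simp_all add: torsion_module_def)

lemma carrier_torsion_module_subset: "carrier (torsion_module R a M) \<subseteq> carrier M"
  by (auto simp: torsion_module_def)

lemma torsion_mod_hom:
  assumes f: "f \<in> mod_hom R M N" and R: "cring R" and a: "a \<subseteq> carrier R"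
    and x: "x \<in> carrier M" "torsion_mod R a M K x" and K: "f ` K \<subseteq> K'"
  shows "torsion_mod R a N K' (f x)"
  unfolding torsion_mod_def
proof
  interpret cring R by fact
  fix g assume g: "g \<in> a"
  then obtain k :: nat where "(g [^]\<^bsub>R\<^esub> k) \<odot>\<^bsub>M\<^esub> x \<in> K" using x(2) unfolding torsion_mod_def by auto
  then have "f ((g [^]\<^bsub>R\<^esub> k) \<odot>\<^bsub>M\<^esub> x) \<in> K'" using K by auto
  moreover have "g [^]\<^bsub>R\<^esub> k \<in> carrier R" using g a by auto
  ultimately have "(g [^]\<^bsub>R\<^esub> k) \<odot>\<^bsub>N\<^esub> f x \<in> K'" using mod_homD(3)[OF f _ x(1)] by simp
  then show "\<exists>k::nat. (g [^]\<^bsub>R\<^esub> k) \<odot>\<^bsub>N\<^esub> f x \<in> K'" ..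
qed

lemma mod_hom_comp:
  "f \<in> mod_hom R M N \<Longrightarrow> g \<in> mod_hom R N P \<Longrightarrow> (\<lambda>x. g (f x)) \<in> mod_hom R M P"
  by (rule mod_homI) (simp_all add: mod_homD)

lemma mod_hom_difference:
  assumes "module R M" "module R N" and f: "f \<in> mod_hom R M N" and g: "g \<in> mod_hom R M N"
  shows "(\<lambda>x. f x \<ominus>\<^bsub>N\<^esub> g x) \<in> mod_hom R M N"
proof -
  interpret M: module R M by fact
  interpret N: module R N by fact
  show ?thesis
  proof (rule mod_homI)
    fix x y assume xy: "x \<in> carrier M" "y \<in> carrier M"
    have "f x \<oplus>\<^bsub>N\<^esub> f y \<oplus>\<^bsub>N\<^esub> \<ominus>\<^bsub>N\<^esub> (g x \<oplus>\<^bsub>N\<^esub> g y) =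
      (f x \<oplus>\<^bsub>N\<^esub> \<ominus>\<^bsub>N\<^esub> g x) \<oplus>\<^bsub>N\<^esub> (f y \<oplus>\<^bsub>N\<^esub> \<ominus>\<^bsub>N\<^esub> g y)"
      using xy mod_homD(1)[OF f] mod_homD(1)[OF g] by (simp add: N.minus_add N.a_ac)
    then show "f (x \<oplus>\<^bsub>M\<^esub> y) \<ominus>\<^bsub>N\<^esub> g (x \<oplus>\<^bsub>M\<^esub> y) = (f x \<ominus>\<^bsub>N\<^esub> g x) \<oplus>\<^bsub>N\<^esub> (f y \<ominus>\<^bsub>N\<^esub> g y)"
      using xy mod_homD(2)[OF f] mod_homD(2)[OF g] by (simp add: a_minus_def)
  qed (use mod_homD[OF f] mod_homD[OF g] in \<open>auto simp: N.smult_r_diff\<close>)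
qed

locale noetherian_complex = cochain_complex R X d + R?: cring R + R?: noetherian_ring R
  for R :: "('a, 'm) ring_scheme" (structure) and X :: "nat \<Rightarrow> ('a, 'c) module" and d +
  fixes a :: "'a set"
  assumes ideal: "ideal a R"
begin

abbreviation T where "T j \<equiv> torsion_module R a (X j)"

lemma a_subset: "a \<subseteq> carrier R"
  using ideal.Icarr[OF ideal] by blast

lemma base: "noetherian_module_base R (X j)"
  using module by (simp add: noetherian_module_base_def R.noetherian_ring_axioms)

lemma T_iff: "x \<in> carrier (T j) \<longleftrightarrow> x \<in> carrier (X j) \<and> torsion_mod R a (X j) {\<zero>\<^bsub>X j\<^esub>} x"
  using noetherian_module_base.carrier_torsion_module[OF base ideal] by auto

lemma submodule_T: "submodule (carrier (T j)) R (X j)"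
  by (rule noetherian_module_base.submodule_torsion_module[OF base ideal])

lemma module_T: "module R (T j)"
  using submodule.submodule_is_module[OF submodule_T module, of j] by (simp add: torsion_module_def)

lemma hom_T: "f \<in> mod_hom R (X i) (X j) \<Longrightarrow> x \<in> carrier (T i) \<Longrightarrow> f x \<in> carrier (T j)"
  using torsion_mod_hom[of f R "X i" "X j" a x "{\<zero>\<^bsub>X i\<^esub>}" "{\<zero>\<^bsub>X j\<^esub>}"]
    mod_hom_zero[OF module module, of f] mod_homD(1)[of f] R.is_cring a_subset
  by (auto simp: T_iff)

lemma torsion_complex: "cochain_complex R T d"
proof (rule cochain_complex.intro)
  show "d j \<in> mod_hom R (T j) (T (Suc j))" for j
    using mod_homD(2,3)[OF hom] hom_T[OF hom] by (intro mod_homI) (auto simp: T_iff)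
qed (use module_T square in \<open>auto simp: T_iff\<close>)

end

locale injective_complex = noetherian_complex +
  assumes injective: "injective_module R (X j)"
begin

text \<open>If the cohomology of \<open>X\<close> is torsion below degree \<open>j\<close>, then the torsion-free quotient
  \<open>X/\<Gamma>X\<close> is split exact there.  The endomorphism \<open>g = 1 - dh\<close>, with \<open>h\<close> a contracting homotopy of
  that quotient, is built degree by degree: \<open>g\<close> has torsion values on cocycles, hence \<open>\<rho>g\<close>, with \<open>\<rho>\<close> the
  projection along the torsion, factors through the differential, and injectivity extends the
  factor to the next degree.\<close>

lemma homotopy:
  assumes tors: "\<And>i z. i < j \<Longrightarrow> z \<in> cocycles X d i \<Longrightarrow> torsion_mod R a (X i) (coboundaries X d i) z"
  shows "\<exists>g\<in>mod_hom R (X j) (X j). (\<forall>v\<in>carrier (T j). v \<ominus>\<^bsub>X j\<^esub> g v \<in> coboundaries T d j) \<and>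
    (\<forall>w\<in>coboundaries X d j. g w \<in> coboundaries T d j) \<and> (\<forall>v\<in>carrier (X j). d j (g v) = d j v)"
  using tors
proof (induction j)
  case 0
  interpret X0: module R "X 0" by (rule module)
  have "v \<in> carrier (X 0)" if "v \<in> carrier (T 0)" for v using that by (simp add: T_iff)
  then show ?case
    by (intro bexI[of _ "\<lambda>x. x"] mod_homI) (auto simp: coboundaries_def)
next
  case (Suc j)
  interpret M: module R "X j" by (rule module)
  interpret N: module R "X (Suc j)" by (rule module)
  interpret E: injective_module R "X j" by (rule injective)
  interpret NE: noetherian_injective R "X j" by unfold_locales
  interpret TC: cochain_complex R T d by (rule torsion_complex)
  note dD = mod_homD[OF hom[of j]]
  have "\<exists>g\<in>mod_hom R (X j) (X j). (\<forall>v\<in>carrier (T j). v \<ominus>\<^bsub>X j\<^esub> g v \<in> coboundaries T d j) \<and>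
    (\<forall>w\<in>coboundaries X d j. g w \<in> coboundaries T d j) \<and> (\<forall>v\<in>carrier (X j). d j (g v) = d j v)"
    by (rule Suc.IH) (rule Suc.prems, auto)
  then obtain g where g: "g \<in> mod_hom R (X j) (X j)"
    and gB: "\<And>w. w \<in> coboundaries X d j \<Longrightarrow> g w \<in> coboundaries T d j"
    and dg: "\<And>v. v \<in> carrier (X j) \<Longrightarrow> d j (g v) = d j v" by auto
  note gD = mod_homD[OF g]
  note Bmem = N.submodule_mem[OF submodule_coboundaries[of "Suc j"]]
  have BT: "coboundaries T d j \<subseteq> carrier (T j)"
    using TC.coboundaries_le_cocycles[of j] by (auto simp: TC.cocycles_iff)
  have gZ: "g z \<in> carrier (T j)" if z: "z \<in> cocycles X d j" for z
  proof -
    have zc: "z \<in> carrier (X j)" using z by (simp add: cocycles_iff)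
    have "torsion_mod R a (X j) {\<zero>\<^bsub>X j\<^esub>} (g z)"
    proof (rule M.torsion_mod_powers[OF a_subset gD(1)[OF zc]])
      fix f assume f: "f \<in> a"
      then obtain k :: nat where "(f [^] k) \<odot>\<^bsub>X j\<^esub> z \<in> coboundaries X d j"
        using Suc.prems[OF _ z] unfolding torsion_mod_def by auto
      then have "g ((f [^] k) \<odot>\<^bsub>X j\<^esub> z) \<in> carrier (T j)" using gB BT by auto
      moreover have "f [^] k \<in> carrier R" using f a_subset by auto
      ultimately have "torsion_mod R a (X j) {\<zero>\<^bsub>X j\<^esub>} ((f [^] k) \<odot>\<^bsub>X j\<^esub> g z)"
        using gD(3)[OF _ zc] by (simp add: T_iff)
      then show "\<exists>k::nat. torsion_mod R a (X j) {\<zero>\<^bsub>X j\<^esub>} ((f [^] k) \<odot>\<^bsub>X j\<^esub> g z)" ..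
    qed
    then show ?thesis using gD(1)[OF zc] by (simp add: T_iff)
  qed
  obtain \<rho> where \<rho>: "\<rho> \<in> mod_hom R (X j) (X j)"
    and \<rho>0: "\<And>v. v \<in> carrier (T j) \<Longrightarrow> \<rho> v = \<zero>\<^bsub>X j\<^esub>"
    and \<rho>1: "\<And>v. v \<in> carrier (X j) \<Longrightarrow> v \<ominus>\<^bsub>X j\<^esub> \<rho> v \<in> carrier (T j)"
    using NE.torsion_free_projection[OF ideal] by auto
  note \<rho>D = mod_homD[OF \<rho>]
  define lift where "lift y = (SOME z. z \<in> carrier (X j) \<and> d j z = y)" for y
  define \<phi> where "\<phi> y = \<rho> (g (lift y))" for y
  have \<phi>: "\<phi> (d j z) = \<rho> (g z)" if z: "z \<in> carrier (X j)" for z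
  proof -
    have "lift (d j z) \<in> carrier (X j) \<and> d j (lift (d j z)) = d j z"
      unfolding lift_def by (rule someI) (use z in simp)
    then have l: "lift (d j z) \<in> carrier (X j)" "d j (lift (d j z)) = d j z" by auto
    have "d j (lift (d j z) \<ominus>\<^bsub>X j\<^esub> z) = \<zero>\<^bsub>X (Suc j)\<^esub>"
      using mod_hom_diff[OF module module hom l(1) z] l(2) dD(1)[OF z] by simp
    then have "lift (d j z) \<ominus>\<^bsub>X j\<^esub> z \<in> cocycles X d j" using l z by (simp add: cocycles_iff)
    then have "\<rho> (g (lift (d j z) \<ominus>\<^bsub>X j\<^esub> z)) = \<zero>\<^bsub>X j\<^esub>" using gZ \<rho>0 by simp
    then have "\<rho> (g (lift (d j z))) \<ominus>\<^bsub>X j\<^esub> \<rho> (g z) = \<zero>\<^bsub>X j\<^esub>"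
      using mod_hom_diff[OF module module g l(1) z] mod_hom_diff[OF module module \<rho>, of "g (lift (d j z))" "g z"]
        gD(1) l(1) z by simp
    then show ?thesis using gD(1) \<rho>D(1) l(1) z by (simp add: \<phi>_def M.diff_eq_iff)
  qed
  define A where "A = (X (Suc j))\<lparr>carrier := coboundaries X d (Suc j)\<rparr>"
  have B: "coboundaries X d (Suc j) = d j ` carrier (X j)" by (simp add: coboundaries_def)
  have A: "module R A"
    unfolding A_def by (rule submodule.submodule_is_module[OF submodule_coboundaries module])
  have "\<exists>h\<in>mod_hom R (X (Suc j)) (X j). \<forall>y\<in>carrier A. h ((\<lambda>y. y) y) = \<phi> y"
  proof (rule E.extension_any_type[OF A module])
    show "(\<lambda>y. y) \<in> mod_hom R A (X (Suc j))"
      using Bmem(1) by (intro mod_homI) (auto simp: A_def)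
    show "\<phi> \<in> mod_hom R A (X j)"
    proof (rule mod_homI)
      fix y y' assume "y \<in> carrier A" "y' \<in> carrier A"
      then obtain z z' where z: "z \<in> carrier (X j)" "y = d j z" "z' \<in> carrier (X j)" "y' = d j z'"
        by (auto simp: A_def B)
      have "\<phi> (y \<oplus>\<^bsub>A\<^esub> y') = \<phi> (d j (z \<oplus>\<^bsub>X j\<^esub> z'))" using z dD by (simp add: A_def)
      also have "\<dots> = \<phi> y \<oplus>\<^bsub>X j\<^esub> \<phi> y'" using z by (simp add: \<phi> gD \<rho>D)
      finally show "\<phi> (y \<oplus>\<^bsub>A\<^esub> y') = \<phi> y \<oplus>\<^bsub>X j\<^esub> \<phi> y'" .
    next
      fix r y assume r: "r \<in> carrier R" and "y \<in> carrier A"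
      then obtain z where z: "z \<in> carrier (X j)" "y = d j z" by (auto simp: A_def B)
      have "\<phi> (r \<odot>\<^bsub>A\<^esub> y) = \<phi> (d j (r \<odot>\<^bsub>X j\<^esub> z))" using z r dD by (simp add: A_def)
      also have "\<dots> = r \<odot>\<^bsub>X j\<^esub> \<phi> y" using z r by (simp add: \<phi> gD \<rho>D)
      finally show "\<phi> (r \<odot>\<^bsub>A\<^esub> y) = r \<odot>\<^bsub>X j\<^esub> \<phi> y" .
    next
      fix y assume "y \<in> carrier A"
      then show "\<phi> y \<in> carrier (X j)" by (auto simp: A_def B \<phi> gD \<rho>D)
    qed
  qed simp
  then obtain h where h: "h \<in> mod_hom R (X (Suc j)) (X j)"
    and "\<And>y. y \<in> coboundaries X d (Suc j) \<Longrightarrow> h y = \<phi> y" by (auto simp: A_def)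
  then have hd: "h (d j z) = \<rho> (g z)" if "z \<in> carrier (X j)" for z using that \<phi> by (simp add: B)
  note hD = mod_homD[OF h]
  define g' where "g' y = y \<ominus>\<^bsub>X (Suc j)\<^esub> d j (h y)" for y
  have "(\<lambda>y. y) \<in> mod_hom R (X (Suc j)) (X (Suc j))" by (rule mod_homI) auto
  then have g': "g' \<in> mod_hom R (X (Suc j)) (X (Suc j))"
    unfolding g'_def by (rule mod_hom_difference[OF module module _ mod_hom_comp[OF h hom]])
  have BTS: "coboundaries T d (Suc j) = d j ` carrier (T j)" by (simp add: coboundaries_def)
  show ?case
  proof (intro bexI[OF _ g'] conjI ballI)
    fix v assume v: "v \<in> carrier (T (Suc j))"
    then have vc: "v \<in> carrier (X (Suc j))" by (simp add: T_iff)
    have "v \<ominus>\<^bsub>X (Suc j)\<^esub> g' v = d j (h v)"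
      using vc hD(1)[OF vc] dD(1) N.diff_eq_iff[of v "d j (h v)" "v \<ominus>\<^bsub>X (Suc j)\<^esub> d j (h v)"]
      by (subst N.diff_eq_iff) (auto simp: g'_def)
    then show "v \<ominus>\<^bsub>X (Suc j)\<^esub> g' v \<in> coboundaries T d (Suc j)"
      using hom_T[OF h v] by (simp add: BTS)
  next
    fix w assume "w \<in> coboundaries X d (Suc j)"
    then obtain z where z: "z \<in> carrier (X j)" "w = d j z" by (auto simp: B)
    have "g' w = d j (g z \<ominus>\<^bsub>X j\<^esub> \<rho> (g z))"
      using mod_hom_diff[OF module module hom gD(1)[OF z(1)] \<rho>D(1)[OF gD(1)[OF z(1)]]] z
      by (simp add: g'_def hd dg)
    then show "g' w \<in> coboundaries T d (Suc j)"
      using \<rho>1[OF gD(1)[OF z(1)]] by (simp add: BTS)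
  next
    fix v assume v: "v \<in> carrier (X (Suc j))"
    interpret P: module R "X (Suc (Suc j))" by (rule module)
    have "d (Suc j) (g' v) = d (Suc j) v \<ominus>\<^bsub>X (Suc (Suc j))\<^esub> d (Suc j) (d j (h v))"
      unfolding g'_def by (rule mod_hom_diff[OF module module hom v dD(1)[OF hD(1)[OF v]]])
    then show "d (Suc j) (g' v) = d (Suc j) v"
      using square[OF hD(1)[OF v]] mod_homD(1)[OF hom v] P.diff_eq_iff by simp
  qed
qed

text \<open>With \<open>g\<close> as above, \<open>y = (y - gy) + gy\<close>.  The first summand is the coboundary of a torsion element because
  \<open>y\<close> is torsion, the second because \<open>y\<close> is a coboundary.\<close>

lemma torsion_exact:
  assumes tors: "\<And>i z. i < t \<Longrightarrow> z \<in> cocycles X d i \<Longrightarrow> torsion_mod R a (X i) (coboundaries X d i) z"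
    and y: "y \<in> carrier (T t)" "y \<in> coboundaries X d t"
  shows "y \<in> coboundaries T d t"
proof -
  interpret N: module R "X t" by (rule module)
  interpret TN: module R "T t" by (rule module_T)
  interpret TC: cochain_complex R T d by (rule torsion_complex)
  have "\<exists>g\<in>mod_hom R (X t) (X t). (\<forall>v\<in>carrier (T t). v \<ominus>\<^bsub>X t\<^esub> g v \<in> coboundaries T d t) \<and>
    (\<forall>w\<in>coboundaries X d t. g w \<in> coboundaries T d t) \<and> (\<forall>v\<in>carrier (X t). d t (g v) = d t v)"
    by (rule homotopy[OF tors])
  then obtain g where g: "g \<in> mod_hom R (X t) (X t)" "y \<ominus>\<^bsub>X t\<^esub> g y \<in> coboundaries T d t"
    "g y \<in> coboundaries T d t" using y by auto
  have "(y \<ominus>\<^bsub>X t\<^esub> g y) \<oplus>\<^bsub>X t\<^esub> g y \<in> coboundaries T d t"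
    using TN.submodule_mem(3)[OF TC.submodule_coboundaries g(2,3)] by simp
  then show ?thesis using y(1) mod_homD(1)[OF g(1)] by (simp add: T_iff)
qed

end

section \<open>Mapping cones\<close>

text \<open>The mapping cone of multiplication by a ring element consists of direct sums.  So that the cones of
  cones are again complexes over the same type, the elements come from a type that is closed
  under pairing.\<close>

datatype 'c nest = Atom (atom: 'c) | Node (left: "'c nest") (right: "'c nest")

definition atom_module :: "('a, 'c, 'k) module_scheme \<Rightarrow> ('a, 'c nest) module"
  where "atom_module M = \<lparr>carrier = Atom ` carrier M, mult = (\<lambda>_ _. Atom \<zero>\<^bsub>M\<^esub>), one = Atom \<zero>\<^bsub>M\<^esub>,
    zero = Atom \<zero>\<^bsub>M\<^esub>, add = (\<lambda>p q. Atom (atom p \<oplus>\<^bsub>M\<^esub> atom q)),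
    smult = (\<lambda>r p. Atom (r \<odot>\<^bsub>M\<^esub> atom p))\<rparr>"

definition pair_module ::
  "('a, 'c nest) module \<Rightarrow> ('a, 'c nest) module \<Rightarrow> ('a, 'c nest) module"
  where "pair_module M N = \<lparr>carrier = {Node u v | u v. u \<in> carrier M \<and> v \<in> carrier N},
    mult = (\<lambda>_ _. Node \<zero>\<^bsub>M\<^esub> \<zero>\<^bsub>N\<^esub>), one = Node \<zero>\<^bsub>M\<^esub> \<zero>\<^bsub>N\<^esub>, zero = Node \<zero>\<^bsub>M\<^esub> \<zero>\<^bsub>N\<^esub>,
    add = (\<lambda>p q. Node (left p \<oplus>\<^bsub>M\<^esub> left q) (right p \<oplus>\<^bsub>N\<^esub> right q)),
    smult = (\<lambda>r p. Node (r \<odot>\<^bsub>M\<^esub> left p) (r \<odot>\<^bsub>N\<^esub> right p))\<rparr>"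

lemma atom_module_simps [simp]:
  "carrier (atom_module M) = Atom ` carrier M" "\<zero>\<^bsub>atom_module M\<^esub> = Atom \<zero>\<^bsub>M\<^esub>"
  "p \<oplus>\<^bsub>atom_module M\<^esub> q = Atom (atom p \<oplus>\<^bsub>M\<^esub> atom q)"
  "r \<odot>\<^bsub>atom_module M\<^esub> p = Atom (r \<odot>\<^bsub>M\<^esub> atom p)"
  by (simp_all add: atom_module_def)

lemma pair_module_simps [simp]:
  "Node u v \<in> carrier (pair_module M N) \<longleftrightarrow> u \<in> carrier M \<and> v \<in> carrier N"
  "\<zero>\<^bsub>pair_module M N\<^esub> = Node \<zero>\<^bsub>M\<^esub> \<zero>\<^bsub>N\<^esub>"
  "p \<oplus>\<^bsub>pair_module M N\<^esub> q = Node (left p \<oplus>\<^bsub>M\<^esub> left q) (right p \<oplus>\<^bsub>N\<^esub> right q)"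
  "r \<odot>\<^bsub>pair_module M N\<^esub> p = Node (r \<odot>\<^bsub>M\<^esub> left p) (r \<odot>\<^bsub>N\<^esub> right p)"
  by (simp_all add: pair_module_def)

lemma pair_module_memE:
  assumes "p \<in> carrier (pair_module M N)"
  obtains u v where "p = Node u v" "u \<in> carrier M" "v \<in> carrier N"
  using assms by (auto simp: pair_module_def)

lemma module_atom_module:
  assumes "module R M"
  shows "module R (atom_module M)"
proof -
  interpret module R M by fact
  show ?thesis
  proof (rule moduleI)
    show "abelian_group (atom_module M)"
    proof (rule abelian_groupI)
      fix p assume "p \<in> carrier (atom_module M)"
      then obtain u where u: "u \<in> carrier M" "p = Atom u" by auto
      then have "Atom (\<ominus>\<^bsub>M\<^esub> u) \<oplus>\<^bsub>atom_module M\<^esub> p = \<zero>\<^bsub>atom_module M\<^esub>" by (simp add: M.l_neg)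
      then show "\<exists>q\<in>carrier (atom_module M). q \<oplus>\<^bsub>atom_module M\<^esub> p = \<zero>\<^bsub>atom_module M\<^esub>"
        using u by (intro bexI[of _ "Atom (\<ominus>\<^bsub>M\<^esub> u)"]) auto
    qed (auto simp: M.a_ac)
  qed (auto simp: smult_l_distr smult_r_distr smult_assoc1 R.is_cring)
qed

lemma module_pair_module:
  assumes "module R M" "module R N"
  shows "module R (pair_module M N)"
proof -
  interpret M: module R M by fact
  interpret N: module R N by fact
  show ?thesis
  proof (rule moduleI)
    show "abelian_group (pair_module M N)"
    proof (rule abelian_groupI)
      fix p assume "p \<in> carrier (pair_module M N)"
      then obtain u v where uv: "p = Node u v" "u \<in> carrier M" "v \<in> carrier N" by (rule pair_module_memE)
      then have "Node (\<ominus>\<^bsub>M\<^esub> u) (\<ominus>\<^bsub>N\<^esub> v) \<oplus>\<^bsub>pair_module M N\<^esub> p = \<zero>\<^bsub>pair_module M N\<^esub>"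
        by (simp add: M.l_neg N.l_neg)
      then show "\<exists>q\<in>carrier (pair_module M N). q \<oplus>\<^bsub>pair_module M N\<^esub> p = \<zero>\<^bsub>pair_module M N\<^esub>"
        using uv by (intro bexI[of _ "Node (\<ominus>\<^bsub>M\<^esub> u) (\<ominus>\<^bsub>N\<^esub> v)"]) auto
    qed (auto elim!: pair_module_memE simp: M.M.a_ac N.M.a_ac)
  qed (auto elim!: pair_module_memE simp: M.smult_l_distr N.smult_l_distr M.smult_r_distr
      N.smult_r_distr M.smult_assoc1 N.smult_assoc1 M.R.is_cring)
qed

lemma injective_atom_module:
  assumes "injective_module R M"
  shows "injective_module R (atom_module M)"
proof -
  interpret M: injective_module R M by fact
  show ?thesis
  proof (intro injective_module.intro injective_module_axioms.intro)
    show "module R (atom_module M)" by (rule module_atom_module) (rule M.module_axioms)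
    fix A B :: "('a, 'a) module" and f g
    assume *: "module R A" "module R B" "f \<in> mod_hom R A B" "inj_on f (carrier A)"
      and g: "g \<in> mod_hom R A (atom_module M)"
    note gD = mod_homD[OF g]
    have gA: "g x = Atom (atom (g x))" "atom (g x) \<in> carrier M" if "x \<in> carrier A" for x
      using gD(1)[OF that] by auto
    have "(\<lambda>x. atom (g x)) \<in> mod_hom R A M"
      using gA gD(2,3) by (intro mod_homI) auto
    from M.extension[OF * this] obtain h
      where h: "h \<in> mod_hom R B M" "\<forall>x\<in>carrier A. h (f x) = atom (g x)" by (rule bexE)
    have "(\<lambda>y. Atom (h y)) \<in> mod_hom R B (atom_module M)"
      using mod_homD[OF h(1)] by (intro mod_homI) auto
    moreover have "\<forall>x\<in>carrier A. Atom (h (f x)) = g x" using h(2) gA by auto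
    ultimately show "\<exists>h\<in>mod_hom R B (atom_module M). \<forall>x\<in>carrier A. h (f x) = g x"
      by (intro bexI[of _ "\<lambda>y. Atom (h y)"])
  qed
qed

lemma injective_pair_module:
  assumes "injective_module R M" "injective_module R N"
  shows "injective_module R (pair_module M N)"
proof -
  interpret M: injective_module R M by fact
  interpret N: injective_module R N by fact
  show ?thesis
  proof (intro injective_module.intro injective_module_axioms.intro)
    show "module R (pair_module M N)"
      by (rule module_pair_module) (rule M.module_axioms, rule N.module_axioms)
    fix A B :: "('a, 'a) module" and f g
    assume *: "module R A" "module R B" "f \<in> mod_hom R A B" "inj_on f (carrier A)"
      and g: "g \<in> mod_hom R A (pair_module M N)"
    note gD = mod_homD[OF g]
    have gA: "g x = Node (left (g x)) (right (g x))" "left (g x) \<in> carrier M" "right (g x) \<in> carrier N"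
      if "x \<in> carrier A" for x
      using gD(1)[OF that] by (auto elim: pair_module_memE)
    have "(\<lambda>x. left (g x)) \<in> mod_hom R A M"
      using gA gD(2,3) by (intro mod_homI) auto
    from M.extension[OF * this] obtain h1
      where h1: "h1 \<in> mod_hom R B M" "\<forall>x\<in>carrier A. h1 (f x) = left (g x)" by (rule bexE)
    have "(\<lambda>x. right (g x)) \<in> mod_hom R A N"
      using gA gD(2,3) by (intro mod_homI) auto
    from N.extension[OF * this] obtain h2
      where h2: "h2 \<in> mod_hom R B N" "\<forall>x\<in>carrier A. h2 (f x) = right (g x)" by (rule bexE)
    have "(\<lambda>y. Node (h1 y) (h2 y)) \<in> mod_hom R B (pair_module M N)"
      using mod_homD[OF h1(1)] mod_homD[OF h2(1)] by (intro mod_homI) auto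
    moreover have "\<forall>x\<in>carrier A. Node (h1 (f x)) (h2 (f x)) = g x" using h1(2) h2(2) gA by auto
    ultimately show "\<exists>h\<in>mod_hom R B (pair_module M N). \<forall>x\<in>carrier A. h (f x) = g x"
      by (intro bexI[of _ "\<lambda>y. Node (h1 y) (h2 y)"])
  qed
qed

text \<open>In degree \<open>0\<close> the preceding module is \<open>0\<close>, with the inclusion as differential; then the image of
  the preceding differential is \<^const>\<open>coboundaries\<close> in every degree.\<close>

definition prev_module :: "(nat \<Rightarrow> ('a, 'c) module) \<Rightarrow> nat \<Rightarrow> ('a, 'c) module"
  where "prev_module X j = (case j of 0 \<Rightarrow> (X 0)\<lparr>carrier := {\<zero>\<^bsub>X 0\<^esub>}\<rparr> | Suc i \<Rightarrow> X i)"

definition prev_diff :: "(nat \<Rightarrow> 'c \<Rightarrow> 'c) \<Rightarrow> nat \<Rightarrow> 'c \<Rightarrow> 'c"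
  where "prev_diff d j = (case j of 0 \<Rightarrow> (\<lambda>u. u) | Suc i \<Rightarrow> d i)"

lemma prev_simps [simp]:
  "prev_module X (Suc i) = X i" "prev_diff d (Suc i) = d i"
  by (simp_all add: prev_module_def prev_diff_def)

definition cone :: "(nat \<Rightarrow> ('a, 'c nest) module) \<Rightarrow> nat \<Rightarrow> ('a, 'c nest) module"
  where "cone X j = pair_module (X j) (prev_module X j)"

text \<open>The differential is \<open>(u, v) \<mapsto> (du, xu - dv)\<close>.  The sign is written as a scalar, so that the formula
  stays literally the same when \<open>X\<close> is replaced by its torsion subcomplex.\<close>

definition cone_diff ::
  "('a, 'm) ring_scheme \<Rightarrow> 'a \<Rightarrow> (nat \<Rightarrow> ('a, 'c nest) module) \<Rightarrow> (nat \<Rightarrow> 'c nest \<Rightarrow> 'c nest) \<Rightarrow>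
    nat \<Rightarrow> 'c nest \<Rightarrow> 'c nest"
  where "cone_diff R x X d j p =
    Node (d j (left p)) (x \<odot>\<^bsub>X j\<^esub> left p \<oplus>\<^bsub>X j\<^esub> (\<ominus>\<^bsub>R\<^esub> \<one>\<^bsub>R\<^esub>) \<odot>\<^bsub>X j\<^esub> prev_diff d j (right p))"

context cochain_complex
begin

lemma module_prev: "module R (prev_module X j)"
proof (cases j)
  case 0
  have "module R ((X 0)\<lparr>carrier := {\<zero>\<^bsub>X 0\<^esub>}\<rparr>)"
    by (rule submodule.submodule_is_module[OF module.submodule_zero[OF module] module])
  then show ?thesis using 0 by (simp add: prev_module_def)
qed (simp add: module)

lemma hom_prev: "prev_diff d j \<in> mod_hom R (prev_module X j) (X j)"
proof (cases j)
  case 0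
  interpret module R "X 0" by (rule module)
  have "(\<lambda>u. u) \<in> mod_hom R ((X 0)\<lparr>carrier := {\<zero>\<^bsub>X 0\<^esub>}\<rparr>) (X 0)" by (rule mod_homI) auto
  then show ?thesis using 0 by (simp add: prev_module_def prev_diff_def)
qed (simp add: hom)

lemma image_prev: "prev_diff d j ` carrier (prev_module X j) = coboundaries X d j"
  by (cases j) (auto simp: prev_module_def prev_diff_def coboundaries_def)

lemma diff_prev:
  assumes "v \<in> carrier (prev_module X j)"
  shows "d j (prev_diff d j v) = \<zero>\<^bsub>X (Suc j)\<^esub>"
proof -
  from assms have "prev_diff d j v \<in> coboundaries X d j" unfolding image_prev[symmetric] by (rule imageI)
  then have "prev_diff d j v \<in> cocycles X d j" using coboundaries_le_cocycles by (rule subsetD[rotated])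
  then show ?thesis by (simp add: cocycles_iff)
qed

lemma zero_prev: "v \<in> carrier (prev_module X 0) \<Longrightarrow> v = \<zero>\<^bsub>prev_module X 0\<^esub>"
  by (simp add: prev_module_def)

end

lemma injective_zero_module:
  assumes "module R M"
  shows "injective_module R (M\<lparr>carrier := {\<zero>\<^bsub>M\<^esub>}\<rparr>)"
proof -
  interpret M: module R M by fact
  have Z: "module R (M\<lparr>carrier := {\<zero>\<^bsub>M\<^esub>}\<rparr>)"
    by (rule submodule.submodule_is_module[OF M.submodule_zero assms])
  show ?thesis
  proof (intro injective_module.intro injective_module_axioms.intro Z)
    fix A B :: "('a, 'a) module" and f g
    assume g: "g \<in> mod_hom R A (M\<lparr>carrier := {\<zero>\<^bsub>M\<^esub>}\<rparr>)"
    show "\<exists>h\<in>mod_hom R B (M\<lparr>carrier := {\<zero>\<^bsub>M\<^esub>}\<rparr>). \<forall>x\<in>carrier A. h (f x) = g x"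
      using mod_homD(1)[OF g] by (intro bexI[of _ "\<lambda>_. \<zero>\<^bsub>M\<^esub>"] mod_homI) auto
  qed
qed

locale cone_complex = cochain_complex R X d
  for R :: "('a, 'm) ring_scheme" and X :: "nat \<Rightarrow> ('a, 'c nest) module" and d +
  fixes x :: 'a
  assumes x: "x \<in> carrier R"
begin

abbreviation C where "C \<equiv> cone X"
abbreviation D where "D \<equiv> cone_diff R x X d"

lemma cone_diff_Node:
  assumes "u \<in> carrier (X j)" "v \<in> carrier (prev_module X j)"
  shows "D j (Node u v) = Node (d j u) (x \<odot>\<^bsub>X j\<^esub> u \<ominus>\<^bsub>X j\<^esub> prev_diff d j v)"
proof -
  interpret M: module R "X j" by (rule module)
  show ?thesis using mod_homD(1)[OF hom_prev assms(2)]
    by (simp add: cone_diff_def M.smult_l_minus a_minus_def)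
qed

lemma cone_memE:
  assumes "p \<in> carrier (C j)"
  obtains u v where "p = Node u v" "u \<in> carrier (X j)" "v \<in> carrier (prev_module X j)"
  using assms unfolding cone_def by (rule pair_module_memE)

lemma Node_in_cone: "Node u v \<in> carrier (C j) \<longleftrightarrow> u \<in> carrier (X j) \<and> v \<in> carrier (prev_module X j)"
  by (simp add: cone_def)

lemma cone_simps:
  "\<zero>\<^bsub>C j\<^esub> = Node \<zero>\<^bsub>X j\<^esub> \<zero>\<^bsub>prev_module X j\<^esub>"
  "Node u v \<oplus>\<^bsub>C j\<^esub> Node u' v' = Node (u \<oplus>\<^bsub>X j\<^esub> u') (v \<oplus>\<^bsub>prev_module X j\<^esub> v')"
  "r \<odot>\<^bsub>C j\<^esub> Node u v = Node (r \<odot>\<^bsub>X j\<^esub> u) (r \<odot>\<^bsub>prev_module X j\<^esub> v)"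
  by (simp_all add: cone_def)

lemma module_cone: "module R (C j)"
  unfolding cone_def by (rule module_pair_module[OF module module_prev])

sublocale cone: cochain_complex R C D
proof (rule cochain_complex.intro)
  fix j
  interpret M: module R "X j" by (rule module)
  interpret P: module R "prev_module X j" by (rule module_prev)
  interpret N: module R "X (Suc j)" by (rule module)
  note dD = mod_homD[OF hom[of j]] and pD = mod_homD[OF hom_prev[of j]]
  show "module R (C j)" by (rule module_cone)
  show "D j \<in> mod_hom R (C j) (C (Suc j))"
  proof (rule mod_homI)
    fix p assume "p \<in> carrier (C j)"
    then obtain u v where "p = Node u v" "u \<in> carrier (X j)" "v \<in> carrier (prev_module X j)"
      by (rule cone_memE)
    then show "D j p \<in> carrier (C (Suc j))" using dD(1) pD(1) x by (simp add: cone_diff_Node Node_in_cone)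
  next
    fix p q assume "p \<in> carrier (C j)"
    then obtain u v where p: "p = Node u v" "u \<in> carrier (X j)" "v \<in> carrier (prev_module X j)"
      by (rule cone_memE)
    assume "q \<in> carrier (C j)"
    then obtain u' v' where q: "q = Node u' v'" "u' \<in> carrier (X j)" "v' \<in> carrier (prev_module X j)"
      by (rule cone_memE)
    have "x \<odot>\<^bsub>X j\<^esub> (u \<oplus>\<^bsub>X j\<^esub> u') \<ominus>\<^bsub>X j\<^esub> (prev_diff d j v \<oplus>\<^bsub>X j\<^esub> prev_diff d j v') =
      (x \<odot>\<^bsub>X j\<^esub> u \<ominus>\<^bsub>X j\<^esub> prev_diff d j v) \<oplus>\<^bsub>X j\<^esub> (x \<odot>\<^bsub>X j\<^esub> u' \<ominus>\<^bsub>X j\<^esub> prev_diff d j v')"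
      using p q x pD(1) by (simp add: a_minus_def M.smult_r_distr M.M.minus_add M.M.a_ac)
    then show "D j (p \<oplus>\<^bsub>C j\<^esub> q) = D j p \<oplus>\<^bsub>C (Suc j)\<^esub> D j q"
      using p q x dD pD by (simp add: cone_diff_Node cone_simps)
  next
    fix r p assume r: "r \<in> carrier R" and "p \<in> carrier (C j)"
    then obtain u v where p: "p = Node u v" "u \<in> carrier (X j)" "v \<in> carrier (prev_module X j)"
      using cone_memE by blast
    show "D j (r \<odot>\<^bsub>C j\<^esub> p) = r \<odot>\<^bsub>C (Suc j)\<^esub> D j p"
      using p r x dD pD
      by (simp add: cone_diff_Node cone_simps M.smult_r_diff M.smult_commute[of x r])
  qed
next
  fix j p assume "p \<in> carrier (C j)"
  then obtain u v where p: "p = Node u v" "u \<in> carrier (X j)" "v \<in> carrier (prev_module X j)"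
    by (rule cone_memE)
  interpret M: module R "X j" by (rule module)
  interpret P: module R "prev_module X j" by (rule module_prev)
  interpret N: module R "X (Suc j)" by (rule module)
  note dD = mod_homD[OF hom[of j]] and pD = mod_homD[OF hom_prev[of j]]
  have "d j (x \<odot>\<^bsub>X j\<^esub> u \<ominus>\<^bsub>X j\<^esub> prev_diff d j v) = x \<odot>\<^bsub>X (Suc j)\<^esub> d j u"
    using mod_hom_diff[OF module module hom, of "x \<odot>\<^bsub>X j\<^esub> u" j "prev_diff d j v"] p x dD pD
    by (simp add: diff_prev N.diff_eq_iff)
  then show "D (Suc j) (D j p) = \<zero>\<^bsub>C (Suc (Suc j))\<^esub>"
    using p x dD pD square[of u j] by (simp add: cone_diff_Node cone_simps)
qed

lemma cone_cocycles:
  "Node u v \<in> cocycles C D j \<longleftrightarrow>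
    u \<in> cocycles X d j \<and> v \<in> carrier (prev_module X j) \<and> prev_diff d j v = x \<odot>\<^bsub>X j\<^esub> u"
proof -
  interpret M: module R "X j" by (rule module)
  show ?thesis
    using x mod_homD(1)[OF hom_prev, of v j]
    by (auto simp: cone.cocycles_iff cocycles_iff Node_in_cone cone_diff_Node cone_simps M.diff_eq_iff)
qed

lemma cone_coboundariesE:
  assumes "p \<in> coboundaries C D (Suc i)"
  obtains w w' where "w \<in> carrier (X i)" "w' \<in> carrier (prev_module X i)"
    "p = Node (d i w) (x \<odot>\<^bsub>X i\<^esub> w \<ominus>\<^bsub>X i\<^esub> prev_diff d i w')"
proof -
  obtain q where q: "q \<in> carrier (C i)" "p = D i q" using assms by (auto simp: coboundaries_def)
  then show ?thesis using that cone_diff_Node by (auto elim!: cone_memE)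
qed

lemma cone_coboundariesI:
  assumes "w \<in> carrier (X i)" "w' \<in> carrier (prev_module X i)"
  shows "Node (d i w) (x \<odot>\<^bsub>X i\<^esub> w \<ominus>\<^bsub>X i\<^esub> prev_diff d i w') \<in> coboundaries C D (Suc i)"
  unfolding coboundaries_def using assms
  by (auto simp: cone_diff_Node[symmetric] Node_in_cone intro!: imageI)

text \<open>The part of the long exact sequence of the cone that is used: modulo coboundaries, a
  cocycle \<open>(u, v)\<close> with \<open>u\<close> a coboundary comes from a cocycle of \<open>X\<close> one degree lower, and this
  cocycle is determined up to \<open>xH\<^sup>i(X)\<close>.\<close>

definition lower :: "nat \<Rightarrow> 'c nest set"
  where "lower i = {p \<in> cocycles C D (Suc i). left p \<in> coboundaries X d (Suc i)}"

lemma lower_interval: "interval R (C (Suc i)) (coboundaries C D (Suc i)) (lower i)"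
  "interval R (C (Suc i)) (lower i) (cocycles C D (Suc i))"
proof -
  interpret CM: module R "C (Suc i)" by (rule module_cone)
  interpret XM: module R "X (Suc i)" by (rule module)
  note Z = CM.submodule_mem[OF cone.submodule_cocycles]
    and B = XM.submodule_mem[OF submodule_coboundaries[of "Suc i"]]
  have "submodule (lower i) R (C (Suc i))"
    unfolding CM.submodule_iff
  proof (intro conjI ballI)
    show "lower i \<subseteq> carrier (C (Suc i))" using Z(1) by (auto simp: lower_def)
    show "\<zero>\<^bsub>C (Suc i)\<^esub> \<in> lower i" using Z(2) B(2) by (simp add: lower_def cone_simps)
    show "p \<oplus>\<^bsub>C (Suc i)\<^esub> q \<in> lower i" if "p \<in> lower i" "q \<in> lower i" for p q
      using that Z(3) B(3) by (simp add: lower_def) (simp add: cone_def)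
    show "r \<odot>\<^bsub>C (Suc i)\<^esub> p \<in> lower i" if "r \<in> carrier R" "p \<in> lower i" for r p
      using that Z(5) B(5) by (simp add: lower_def) (simp add: cone_def)
  qed
  moreover have "coboundaries C D (Suc i) \<subseteq> lower i"
  proof
    fix p assume p: "p \<in> coboundaries C D (Suc i)"
    then have "p \<in> cocycles C D (Suc i)" using cone.coboundaries_le_cocycles by blast
    moreover have "left p \<in> coboundaries X d (Suc i)"
      using p by (rule cone_coboundariesE) (simp add: coboundaries_def)
    ultimately show "p \<in> lower i" by (simp add: lower_def)
  qed
  ultimately show "interval R (C (Suc i)) (coboundaries C D (Suc i)) (lower i)"
    "interval R (C (Suc i)) (lower i) (cocycles C D (Suc i))"
    using module_cone cone.submodule_coboundaries cone.submodule_cocycles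
    by (auto simp: interval_def lower_def)
qed

text \<open>Write \<open>u = dw\<close> and subtract the coboundary of \<open>(w, 0)\<close>.\<close>

lemma lower_decompose:
  assumes "p \<in> lower i"
  obtains v b where "v \<in> cocycles X d i" "b \<in> coboundaries C D (Suc i)"
    "p = Node \<zero>\<^bsub>X (Suc i)\<^esub> v \<oplus>\<^bsub>C (Suc i)\<^esub> b"
proof -
  interpret M: module R "X i" by (rule module)
  interpret P: module R "prev_module X i" by (rule module_prev)
  interpret N: module R "X (Suc i)" by (rule module)
  note dD = mod_homD[OF hom[of i]]
  have "p \<in> carrier (C (Suc i))" using assms by (simp add: lower_def cone.cocycles_iff)
  then obtain u v where p: "p = Node u v" "u \<in> carrier (X (Suc i))" "v \<in> carrier (X i)"
    by (rule cone_memE) simp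
  have "Node u v \<in> cocycles C D (Suc i)" using assms p by (simp add: lower_def)
  then have uv: "d i v = x \<odot>\<^bsub>X (Suc i)\<^esub> u" by (simp add: cone_cocycles)
  have "u \<in> coboundaries X d (Suc i)" using assms p by (simp add: lower_def)
  then obtain w where w: "w \<in> carrier (X i)" "u = d i w" by (auto simp: coboundaries_def)
  define v' where "v' = v \<ominus>\<^bsub>X i\<^esub> x \<odot>\<^bsub>X i\<^esub> w"
  have v': "v' \<in> carrier (X i)" using p w x by (simp add: v'_def)
  have "d i v' = x \<odot>\<^bsub>X (Suc i)\<^esub> u \<ominus>\<^bsub>X (Suc i)\<^esub> x \<odot>\<^bsub>X (Suc i)\<^esub> u"
    unfolding v'_def using mod_hom_diff[OF module module hom, of v i "x \<odot>\<^bsub>X i\<^esub> w"] p w x uv dD(3)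
    by simp
  then have "v' \<in> cocycles X d i" using v' p x by (simp add: cocycles_iff)
  moreover have "Node (d i w) (x \<odot>\<^bsub>X i\<^esub> w \<ominus>\<^bsub>X i\<^esub> prev_diff d i \<zero>\<^bsub>prev_module X i\<^esub>) \<in> coboundaries C D (Suc i)"
    by (rule cone_coboundariesI[OF w(1)]) simp
  then have "Node u (x \<odot>\<^bsub>X i\<^esub> w) \<in> coboundaries C D (Suc i)"
    using w x mod_hom_zero[OF module_prev module hom_prev, of i] by simp
  moreover have "p = Node \<zero>\<^bsub>X (Suc i)\<^esub> v' \<oplus>\<^bsub>C (Suc i)\<^esub> Node u (x \<odot>\<^bsub>X i\<^esub> w)"
    using p w x by (simp add: cone_simps v'_def)
  ultimately show ?thesis by (rule that)
qed

lemma zero_Node_in_lower: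
  assumes "v \<in> cocycles X d i"
  shows "Node \<zero>\<^bsub>X (Suc i)\<^esub> v \<in> lower i"
proof -
  interpret N: module R "X (Suc i)" by (rule module)
  have "\<zero>\<^bsub>X (Suc i)\<^esub> \<in> cocycles X d (Suc i)" "\<zero>\<^bsub>X (Suc i)\<^esub> \<in> coboundaries X d (Suc i)"
    using N.submodule_mem(2) submodule_cocycles submodule_coboundaries by auto
  then show ?thesis using assms x by (auto simp: lower_def cone_cocycles cocycles_iff)
qed

lemma hom_zero_Node: "(\<lambda>v. Node \<zero>\<^bsub>X (Suc i)\<^esub> v) \<in> mod_hom R (X i) (C (Suc i))"
proof -
  interpret N: module R "X (Suc i)" by (rule module)
  show ?thesis by (rule mod_homI) (auto simp: cone_simps Node_in_cone)
qed

text \<open>The cocycles with class in \<open>xH\<^sup>i(X)\<close>.\<close>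

definition mult_coboundaries :: "nat \<Rightarrow> 'c nest set"
  where "mult_coboundaries i = coboundaries X d i <+>\<^bsub>X i\<^esub> (\<lambda>z. x \<odot>\<^bsub>X i\<^esub> z) ` cocycles X d i"

lemma mult_coboundaries_interval: "interval R (X i) (mult_coboundaries i) (cocycles X d i)"
proof -
  interpret M: module R "X i" by (rule module)
  note Z = submodule_cocycles[of i] and B = submodule_coboundaries[of i]
  have xZ: "submodule ((\<lambda>z. x \<odot>\<^bsub>X i\<^esub> z) ` cocycles X d i) R (X i)"
    by (rule M.submodule_smult_image[OF x Z])
  have "mult_coboundaries i \<subseteq> cocycles X d i" unfolding mult_coboundaries_def
    using coboundaries_le_cocycles M.submodule_mem(5)[OF Z x]
    by (intro M.set_add_least Z) auto
  then show ?thesis using M.submodule_set_add[OF B xZ] Z module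
    by (simp add: interval_def mult_coboundaries_def)
qed

lemma coboundaries_le_mult: "coboundaries X d i \<subseteq> mult_coboundaries i"
  "z \<in> cocycles X d i \<Longrightarrow> x \<odot>\<^bsub>X i\<^esub> z \<in> mult_coboundaries i"
proof -
  interpret M: module R "X i" by (rule module)
  note Z = submodule_cocycles[of i] and B = submodule_coboundaries[of i]
  have xZ: "submodule ((\<lambda>z. x \<odot>\<^bsub>X i\<^esub> z) ` cocycles X d i) R (X i)"
    by (rule M.submodule_smult_image[OF x Z])
  show "coboundaries X d i \<subseteq> mult_coboundaries i"
    unfolding mult_coboundaries_def by (rule M.set_add_ge1[OF B xZ])
  show "x \<odot>\<^bsub>X i\<^esub> z \<in> mult_coboundaries i" if "z \<in> cocycles X d i"
    using that M.set_add_ge2[OF B xZ] unfolding mult_coboundaries_def by blast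
qed

lemma zero_Node_in_coboundaries:
  assumes v: "v \<in> mult_coboundaries i"
  shows "Node \<zero>\<^bsub>X (Suc i)\<^esub> v \<in> coboundaries C D (Suc i)"
proof -
  interpret M: module R "X i" by (rule module)
  interpret P: module R "prev_module X i" by (rule module_prev)
  obtain y y' where y: "y \<in> coboundaries X d i" "y' \<in> (\<lambda>z. x \<odot>\<^bsub>X i\<^esub> z) ` cocycles X d i" "v = y \<oplus>\<^bsub>X i\<^esub> y'"
    using v unfolding mult_coboundaries_def by (rule M.set_addE)
  obtain w where w: "w \<in> carrier (prev_module X i)" "y = prev_diff d i w"
    using y(1) unfolding image_prev[symmetric] by auto
  obtain z where z: "z \<in> cocycles X d i" "y' = x \<odot>\<^bsub>X i\<^esub> z" using y(2) by auto
  have zc: "z \<in> carrier (X i)" "d i z = \<zero>\<^bsub>X (Suc i)\<^esub>" using z by (auto simp: cocycles_iff)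
  note pD = mod_homD[OF hom_prev[of i]]
  have "prev_diff d i (\<zero>\<^bsub>prev_module X i\<^esub> \<ominus>\<^bsub>prev_module X i\<^esub> w) = \<zero>\<^bsub>X i\<^esub> \<ominus>\<^bsub>X i\<^esub> y"
    using mod_hom_diff[OF module_prev module hom_prev, of "\<zero>\<^bsub>prev_module X i\<^esub>" i w] w
      mod_hom_zero[OF module_prev module hom_prev, of i] by simp
  moreover have "y' \<ominus>\<^bsub>X i\<^esub> (\<zero>\<^bsub>X i\<^esub> \<ominus>\<^bsub>X i\<^esub> y) = v"
    using y(3) w z zc x pD(1)[OF w(1)] by (simp add: a_minus_def M.M.a_comm)
  ultimately show "Node \<zero>\<^bsub>X (Suc i)\<^esub> v \<in> coboundaries C D (Suc i)"
    using cone_coboundariesI[OF zc(1), of "\<zero>\<^bsub>prev_module X i\<^esub> \<ominus>\<^bsub>prev_module X i\<^esub> w"] w zc(2) z(2)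
    by simp
qed

text \<open>Via \<open>v \<mapsto> (0, v)\<close>: in the cohomology of the cone, the classes in \<open>lower i\<close> form the image of
  \<open>H\<^sup>i(X)/xH\<^sup>i(X)\<close>.\<close>

lemma subquotient_lower:
  "subquotient R (X i) (mult_coboundaries i) (cocycles X d i)
    (C (Suc i)) (coboundaries C D (Suc i)) (lower i)"
proof -
  interpret M: module R "X i" by (rule module)
  interpret P: module R "prev_module X i" by (rule module_prev)
  interpret N: module R "X (Suc i)" by (rule module)
  interpret CM: module R "C (Suc i)" by (rule module_cone)
  note BD = CM.submodule_mem[OF cone.submodule_coboundaries[of "Suc i"]]
  let ?n = "\<lambda>v. Node \<zero>\<^bsub>X (Suc i)\<^esub> v"
  note nD = mod_homD[OF hom_zero_Node[of i]]
  define G where "G = {(v, ?n v \<oplus>\<^bsub>C (Suc i)\<^esub> b) | v b. v \<in> carrier (X i) \<and> b \<in> coboundaries C D (Suc i)}"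
  show ?thesis
  proof (rule subquotientI[OF mult_coboundaries_interval lower_interval(1)])
    show "lin_rel R (X i) (C (Suc i)) G"
      unfolding lin_rel_def
    proof (intro conjI allI impI ballI)
      show "G \<subseteq> carrier (X i) \<times> carrier (C (Suc i))" using nD(1) BD(1) by (auto simp: G_def)
      have "?n \<zero>\<^bsub>X i\<^esub> = \<zero>\<^bsub>C (Suc i)\<^esub>" by (simp add: cone_simps)
      then have "\<zero>\<^bsub>C (Suc i)\<^esub> = ?n \<zero>\<^bsub>X i\<^esub> \<oplus>\<^bsub>C (Suc i)\<^esub> \<zero>\<^bsub>C (Suc i)\<^esub>" by simp
      then show "(\<zero>\<^bsub>X i\<^esub>, \<zero>\<^bsub>C (Suc i)\<^esub>) \<in> G" unfolding G_def using BD(2) M.zero_closed by blast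
    next
      fix v p v' p' assume "(v, p) \<in> G" "(v', p') \<in> G"
      then obtain b b' where *: "v \<in> carrier (X i)" "v' \<in> carrier (X i)" "b \<in> coboundaries C D (Suc i)"
        "b' \<in> coboundaries C D (Suc i)" "p = ?n v \<oplus>\<^bsub>C (Suc i)\<^esub> b" "p' = ?n v' \<oplus>\<^bsub>C (Suc i)\<^esub> b'"
        unfolding G_def by auto
      then have "p \<oplus>\<^bsub>C (Suc i)\<^esub> p' = ?n (v \<oplus>\<^bsub>X i\<^esub> v') \<oplus>\<^bsub>C (Suc i)\<^esub> (b \<oplus>\<^bsub>C (Suc i)\<^esub> b')"
        using nD(1,2) BD(1) by (simp add: CM.M.a_ac)
      then show "(v \<oplus>\<^bsub>X i\<^esub> v', p \<oplus>\<^bsub>C (Suc i)\<^esub> p') \<in> G"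
        unfolding G_def using * BD(3) M.a_closed by blast
    next
      fix r v p assume r: "r \<in> carrier R" and "(v, p) \<in> G"
      then obtain b where *: "v \<in> carrier (X i)" "b \<in> coboundaries C D (Suc i)"
        "p = ?n v \<oplus>\<^bsub>C (Suc i)\<^esub> b" unfolding G_def by auto
      then have "r \<odot>\<^bsub>C (Suc i)\<^esub> p = ?n (r \<odot>\<^bsub>X i\<^esub> v) \<oplus>\<^bsub>C (Suc i)\<^esub> r \<odot>\<^bsub>C (Suc i)\<^esub> b"
        using r nD(1,3) BD(1) by (simp add: CM.smult_r_distr)
      then show "(r \<odot>\<^bsub>X i\<^esub> v, r \<odot>\<^bsub>C (Suc i)\<^esub> p) \<in> G"
        unfolding G_def using * r BD(5) M.smult_closed by blast
    qed
  next
    fix p assume "p \<in> lower i"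
    then obtain v b where vb: "v \<in> cocycles X d i" "b \<in> coboundaries C D (Suc i)"
      "p = Node \<zero>\<^bsub>X (Suc i)\<^esub> v \<oplus>\<^bsub>C (Suc i)\<^esub> b" by (rule lower_decompose)
    then have "(v, p) \<in> G" by (auto simp: G_def cocycles_iff)
    then show "\<exists>v\<in>cocycles X d i. (v, p) \<in> G" using vb(1) by (rule rev_bexI[rotated])
  next
    fix v p assume "(v, p) \<in> G" and v: "v \<in> mult_coboundaries i"
    then obtain b where b: "b \<in> coboundaries C D (Suc i)" "p = ?n v \<oplus>\<^bsub>C (Suc i)\<^esub> b"
      by (auto simp: G_def)
    have "?n v \<in> coboundaries C D (Suc i)" by (rule zero_Node_in_coboundaries[OF v])
    then show "p \<in> coboundaries C D (Suc i)" using b BD(3) by simp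
  qed
qed

text \<open>Via \<open>(u, v) \<mapsto> u\<close>: modulo that image, the cohomology of the cone embeds into \<open>H\<^sup>i\<^sup>+\<^sup>1(X)\<close>.\<close>

lemma subquotient_upper:
  "subquotient R (X (Suc i)) (coboundaries X d (Suc i)) (cocycles X d (Suc i))
    (C (Suc i)) (lower i) (cocycles C D (Suc i))"
proof -
  interpret M: module R "X i" by (rule module)
  interpret N: module R "X (Suc i)" by (rule module)
  interpret CM: module R "C (Suc i)" by (rule module_cone)
  show ?thesis
  proof (rule subquotientI[OF cohomology_interval lower_interval(2),
        where G = "{(u, Node u v) | u v. u \<in> carrier (X (Suc i)) \<and> v \<in> carrier (X i)}"])
    show "lin_rel R (X (Suc i)) (C (Suc i)) {(u, Node u v) | u v. u \<in> carrier (X (Suc i)) \<and> v \<in> carrier (X i)}"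
      by (auto simp: lin_rel_def cone_simps Node_in_cone)
  next
    fix p assume p: "p \<in> cocycles C D (Suc i)"
    then have "p \<in> carrier (C (Suc i))" by (simp add: cone.cocycles_iff)
    then obtain u v where "p = Node u v" "u \<in> carrier (X (Suc i))" "v \<in> carrier (X i)"
      by (rule cone_memE) simp
    then show "\<exists>u\<in>cocycles X d (Suc i). (u, p) \<in> {(u, Node u v) | u v. u \<in> carrier (X (Suc i)) \<and> v \<in> carrier (X i)}"
      using p by (auto simp: cone_cocycles)
  qed (auto simp: lower_def)
qed

text \<open>Because \<open>x \<in> a\<close>, the ambiguity \<open>xH\<^sup>i(X)\<close> is absorbed by \<open>aH\<^sup>i(X)\<close>.\<close>

lemma subquotient_reduced_lower:
  assumes a: "a \<subseteq> carrier R" and xa: "x \<in> a"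
  shows "subquotient R (C (Suc i)) (ideal_times R (C (Suc i)) a (lower i) <+>\<^bsub>C (Suc i)\<^esub> coboundaries C D (Suc i)) (lower i)
    (X i) (ideal_times R (X i) a (cocycles X d i) <+>\<^bsub>X i\<^esub> coboundaries X d i) (cocycles X d i)"
proof -
  interpret M: module R "X i" by (rule module)
  interpret N: module R "X (Suc i)" by (rule module)
  interpret CM: module R "C (Suc i)" by (rule module_cone)
  let ?n = "\<lambda>v. Node \<zero>\<^bsub>X (Suc i)\<^esub> v"
  note nD = mod_homD[OF hom_zero_Node[of i]]
  let ?BC = "coboundaries C D (Suc i)" and ?aZ = "ideal_times R (X i) a (cocycles X d i)"
    and ?B = "coboundaries X d i"
  have low: "submodule (lower i) R (C (Suc i))" "?BC \<subseteq> lower i"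
    using lower_interval(1) by (auto simp: interval_def)
  note lowD = CM.submodule_mem[OF low(1)]
  note Zs = submodule_cocycles[of i] and Bs = submodule_coboundaries[of i]
    and BCs = cone.submodule_coboundaries[of "Suc i"]
  note ZD = M.submodule_mem[OF Zs] and BCD = CM.submodule_mem[OF BCs]
  note aZ = reduced_interval(1)[OF a, of i] and i1 = reduced_interval(2)[OF a, of i]
  have aL: "submodule (ideal_times R (C (Suc i)) a (lower i)) R (C (Suc i))"
    using a lowD(1) by (intro CM.submodule_ideal_times) auto
  have aLL: "ideal_times R (C (Suc i)) a (lower i) \<subseteq> lower i"
    using a lowD(5) by (intro CM.ideal_times_least low) auto
  have i2: "interval R (C (Suc i)) (ideal_times R (C (Suc i)) a (lower i) <+>\<^bsub>C (Suc i)\<^esub> ?BC) (lower i)"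
    using module_cone CM.submodule_set_add[OF aL BCs] low CM.set_add_least[OF low(1) aLL low(2)]
    by (simp add: interval_def)
  define P where "P = ?n ` ?aZ <+>\<^bsub>C (Suc i)\<^esub> ?BC"
  have naZ: "submodule (?n ` ?aZ) R (C (Suc i))"
    by (rule submodule_image[OF module module_cone hom_zero_Node aZ])
  have Ps: "submodule P R (C (Suc i))" unfolding P_def by (rule CM.submodule_set_add[OF naZ BCs])
  have "ideal_times R (C (Suc i)) a (lower i) \<subseteq> P"
  proof (rule CM.ideal_times_least[OF Ps])
    fix r p assume r: "r \<in> a" and "p \<in> lower i"
    then obtain v b where vb: "v \<in> cocycles X d i" "b \<in> ?BC" "p = ?n v \<oplus>\<^bsub>C (Suc i)\<^esub> b"
      using lower_decompose by metis
    have rc: "r \<in> carrier R" using r a by blast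
    have "r \<odot>\<^bsub>C (Suc i)\<^esub> p = ?n (r \<odot>\<^bsub>X i\<^esub> v) \<oplus>\<^bsub>C (Suc i)\<^esub> r \<odot>\<^bsub>C (Suc i)\<^esub> b"
      using vb rc nD(1,3) ZD(1) BCD(1) by (simp add: CM.smult_r_distr)
    also have "\<dots> \<in> P" unfolding P_def
      using M.ideal_timesI[OF r vb(1)] BCD(5)[OF rc vb(2)] by (intro CM.set_addI imageI)
    finally show "r \<odot>\<^bsub>C (Suc i)\<^esub> p \<in> P" .
  qed
  then have KP: "ideal_times R (C (Suc i)) a (lower i) <+>\<^bsub>C (Suc i)\<^esub> ?BC \<subseteq> P"
    using CM.set_add_ge2[OF naZ BCs] by (intro CM.set_add_least[OF Ps]) (auto simp: P_def)
  show ?thesis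
  proof (rule subquotientI[OF i2 i1, where G = "{(?n v, v) | v. v \<in> carrier (X i)}"])
    show "lin_rel R (C (Suc i)) (X i) {(?n v, v) | v. v \<in> carrier (X i)}"
      using nD(1) by (auto simp: lin_rel_def cone_simps)
  next
    fix v assume v: "v \<in> cocycles X d i"
    have "(?n v, v) \<in> {(?n v, v) | v. v \<in> carrier (X i)}" using ZD(1)[OF v] by blast
    then show "\<exists>p\<in>lower i. (p, v) \<in> {(?n v, v) | v. v \<in> carrier (X i)}"
      using zero_Node_in_lower[OF v] by (rule rev_bexI[rotated])
  next
    fix p v assume "(p, v) \<in> {(?n v, v) | v. v \<in> carrier (X i)}"
      and "p \<in> ideal_times R (C (Suc i)) a (lower i) <+>\<^bsub>C (Suc i)\<^esub> ?BC"
    then have nv: "?n v \<in> P" and vc: "v \<in> carrier (X i)" using KP by auto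
    obtain q b where qb: "q \<in> ?n ` ?aZ" "b \<in> ?BC" "?n v = q \<oplus>\<^bsub>C (Suc i)\<^esub> b"
      using nv unfolding P_def by (rule CM.set_addE)
    obtain v1 where v1: "v1 \<in> ?aZ" "q = ?n v1" using qb(1) by auto
    obtain w w' where w: "w \<in> carrier (X i)" "w' \<in> carrier (prev_module X i)"
      "b = Node (d i w) (x \<odot>\<^bsub>X i\<^esub> w \<ominus>\<^bsub>X i\<^esub> prev_diff d i w')" using qb(2) by (rule cone_coboundariesE)
    have pw': "prev_diff d i w' \<in> ?B" "prev_diff d i w' \<in> carrier (X i)"
      using w(2) image_prev[of i] mod_homD(1)[OF hom_prev] by auto
    have v1c: "v1 \<in> carrier (X i)" using M.submodule_mem(1)[OF aZ v1(1)] .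
    have dw: "d i w = \<zero>\<^bsub>X (Suc i)\<^esub>" and v: "v = v1 \<oplus>\<^bsub>X i\<^esub> (x \<odot>\<^bsub>X i\<^esub> w \<ominus>\<^bsub>X i\<^esub> prev_diff d i w')"
      using qb(3) v1 w mod_homD(1)[OF hom w(1)] by (auto simp: cone_simps)
    have "v = (v1 \<oplus>\<^bsub>X i\<^esub> x \<odot>\<^bsub>X i\<^esub> w) \<oplus>\<^bsub>X i\<^esub> (\<zero>\<^bsub>X i\<^esub> \<ominus>\<^bsub>X i\<^esub> prev_diff d i w')"
      unfolding v using v1c w(1) x pw'(2) by (simp add: a_minus_def M.M.a_ac)
    moreover have "x \<odot>\<^bsub>X i\<^esub> w \<in> ?aZ"
      using dw w(1) by (intro M.ideal_timesI[OF xa]) (simp add: cocycles_iff)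
    then have "v1 \<oplus>\<^bsub>X i\<^esub> x \<odot>\<^bsub>X i\<^esub> w \<in> ?aZ" using M.submodule_mem(3)[OF aZ v1(1)] by simp
    moreover have "\<zero>\<^bsub>X i\<^esub> \<ominus>\<^bsub>X i\<^esub> prev_diff d i w' \<in> ?B"
      using M.submodule_mem(2,4)[OF Bs] pw'(1) by simp
    ultimately show "v \<in> ?aZ <+>\<^bsub>X i\<^esub> ?B" using M.set_addI by simp
  qed
qed

end

section \<open>Torsion of mapping cones\<close>

lemma torsion_pair_module:
  assumes M: "noetherian_module_base R M" and N: "noetherian_module_base R N" and a: "ideal a R"
  shows "torsion_module R a (pair_module M N) = pair_module (torsion_module R a M) (torsion_module R a N)"
proof -
  interpret M: noetherian_module_base R M by fact
  interpret N: noetherian_module_base R N by fact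
  interpret P: module R "pair_module M N" by (rule module_pair_module[OF M.module_axioms N.module_axioms])
  interpret P: noetherian_module_base R "pair_module M N" by unfold_locales
  have ac: "f \<in> carrier R" if "f \<in> a" for f using ideal.Icarr[OF a that] .
  have tors: "torsion_mod R a (pair_module M N) {\<zero>\<^bsub>pair_module M N\<^esub>} (Node u v) \<longleftrightarrow>
    torsion_mod R a M {\<zero>\<^bsub>M\<^esub>} u \<and> torsion_mod R a N {\<zero>\<^bsub>N\<^esub>} v"
    if uv: "u \<in> carrier M" "v \<in> carrier N" for u v
  proof
    assume "torsion_mod R a (pair_module M N) {\<zero>\<^bsub>pair_module M N\<^esub>} (Node u v)"
    then show "torsion_mod R a M {\<zero>\<^bsub>M\<^esub>} u \<and> torsion_mod R a N {\<zero>\<^bsub>N\<^esub>} v"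
      unfolding torsion_mod_def by auto
  next
    assume t: "torsion_mod R a M {\<zero>\<^bsub>M\<^esub>} u \<and> torsion_mod R a N {\<zero>\<^bsub>N\<^esub>} v"
    show "torsion_mod R a (pair_module M N) {\<zero>\<^bsub>pair_module M N\<^esub>} (Node u v)"
      unfolding torsion_mod_def
    proof
      fix f assume f: "f \<in> a"
      have "\<exists>k::nat. (f [^]\<^bsub>R\<^esub> k) \<odot>\<^bsub>M\<^esub> u = \<zero>\<^bsub>M\<^esub>" "\<exists>l::nat. (f [^]\<^bsub>R\<^esub> l) \<odot>\<^bsub>N\<^esub> v = \<zero>\<^bsub>N\<^esub>"
        using t f unfolding torsion_mod_def by auto
      then obtain k l :: nat where kl: "(f [^]\<^bsub>R\<^esub> k) \<odot>\<^bsub>M\<^esub> u = \<zero>\<^bsub>M\<^esub>" "(f [^]\<^bsub>R\<^esub> l) \<odot>\<^bsub>N\<^esub> v = \<zero>\<^bsub>N\<^esub>"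
        by (elim exE)
      have "(f [^]\<^bsub>R\<^esub> (k + l)) \<odot>\<^bsub>M\<^esub> u = (f [^]\<^bsub>R\<^esub> l) \<odot>\<^bsub>M\<^esub> ((f [^]\<^bsub>R\<^esub> k) \<odot>\<^bsub>M\<^esub> u)"
        using ac[OF f] uv by (simp add: M.smult_assoc1[symmetric] M.R.nat_pow_mult add.commute)
      moreover have "(f [^]\<^bsub>R\<^esub> (k + l)) \<odot>\<^bsub>N\<^esub> v = (f [^]\<^bsub>R\<^esub> k) \<odot>\<^bsub>N\<^esub> ((f [^]\<^bsub>R\<^esub> l) \<odot>\<^bsub>N\<^esub> v)"
        using ac[OF f] uv by (simp add: N.smult_assoc1[symmetric] M.R.nat_pow_mult)
      ultimately have "(f [^]\<^bsub>R\<^esub> (k + l)) \<odot>\<^bsub>pair_module M N\<^esub> Node u v \<in> {\<zero>\<^bsub>pair_module M N\<^esub>}"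
        using kl ac[OF f] by simp
      then show "\<exists>k::nat. (f [^]\<^bsub>R\<^esub> k) \<odot>\<^bsub>pair_module M N\<^esub> Node u v \<in> {\<zero>\<^bsub>pair_module M N\<^esub>}" ..
    qed
  qed
  have "carrier (torsion_module R a (pair_module M N)) =
    {Node u v | u v. u \<in> carrier (torsion_module R a M) \<and> v \<in> carrier (torsion_module R a N)}"
    unfolding P.carrier_torsion_module[OF a] M.carrier_torsion_module[OF a] N.carrier_torsion_module[OF a]
    using tors by (auto elim!: pair_module_memE)
  then show ?thesis by (simp add: pair_module_def torsion_module_def)
qed

lemma (in noetherian_complex) torsion_prev_module:
  "torsion_module R a (prev_module X j) = prev_module T j"
proof (cases j)
  case 0
  interpret module R "X 0" by (rule module)
  have "\<forall>r \<in> a [^]\<^bsub>ideals_set R\<^esub> (0::nat). r \<odot>\<^bsub>X 0\<^esub> \<zero>\<^bsub>X 0\<^esub> = \<zero>\<^bsub>X 0\<^esub>"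
    by (simp add: nat_pow_def ideals_set_def)
  then have "\<exists>n::nat. \<forall>r \<in> a [^]\<^bsub>ideals_set R\<^esub> n. r \<odot>\<^bsub>X 0\<^esub> \<zero>\<^bsub>X 0\<^esub> = \<zero>\<^bsub>X 0\<^esub>" ..
  then have "{x \<in> {\<zero>\<^bsub>X 0\<^esub>}. \<exists>n::nat. \<forall>r \<in> a [^]\<^bsub>ideals_set R\<^esub> n. r \<odot>\<^bsub>X 0\<^esub> x = \<zero>\<^bsub>X 0\<^esub>} = {\<zero>\<^bsub>X 0\<^esub>}"
    by auto
  then show ?thesis using 0 by (simp add: prev_module_def torsion_module_def)
qed simp

locale injective_cone = injective_complex R X d a + cone_complex R X d x
  for R :: "('a, 'm) ring_scheme" (structure) and X :: "nat \<Rightarrow> ('a, 'c nest) module" and d and a and x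
begin

lemma torsion_cone: "torsion_module R a (C j) = cone T j"
proof -
  have "noetherian_module_base R (prev_module X j)"
    using module_prev by (simp add: noetherian_module_base_def R.noetherian_ring_axioms)
  then show ?thesis
    using torsion_pair_module[OF base _ ideal] torsion_prev_module[of j] by (simp add: cone_def)
qed

lemma injective_complex_cone: "injective_complex R C D a"
proof (intro injective_complex.intro noetherian_complex.intro injective_complex_axioms.intro
    noetherian_complex_axioms.intro)
  show "injective_module R (C j)" for j
  proof -
    have "injective_module R (prev_module X j)"
      using injective injective_zero_module[OF module] by (cases j) (auto simp: prev_module_def)
    then show ?thesis unfolding cone_def by (rule injective_pair_module[OF injective])
  qed
qed (rule cone.cochain_complex_axioms R.cring_axioms R.noetherian_ring_axioms ideal)+

lemma cone_diff_torsion: "cone_diff R x T d = D"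
  by (intro ext) (simp add: cone_diff_def)

lemma cone_complex_torsion: "cone_complex R T d x"
  by (intro cone_complex.intro cone_complex_axioms.intro torsion_complex x)

text \<open>The cohomology of the cone is torsion up to degree \<open>s\<close>: in the long exact sequence it is
  caught between \<open>H\<^sup>j\<^sup>-\<^sup>1(X)\<close> and the elements of \<open>H\<^sup>j(X)\<close> killed by \<open>x\<close>.\<close>

lemma torsion_cohomology_cone:
  assumes low: "\<And>i z. i < s \<Longrightarrow> z \<in> cocycles X d i \<Longrightarrow> torsion_mod R a (X i) (coboundaries X d i) z"
    and killed: "\<And>z. z \<in> cocycles X d s \<Longrightarrow> x \<odot>\<^bsub>X s\<^esub> z \<in> coboundaries X d s \<Longrightarrow>
      torsion_mod R a (X s) (coboundaries X d s) z"
    and j: "j \<le> s" and p: "p \<in> cocycles C D j"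
  shows "torsion_mod R a (C j) (coboundaries C D j) p"
  unfolding torsion_mod_def
proof
  fix f assume f: "f \<in> a"
  have fc: "f \<in> carrier R" using f a_subset by blast
  interpret M: module R "X j" by (rule module)
  interpret CM: module R "C j" by (rule module_cone)
  have pc: "p \<in> carrier (C j)" using p by (simp add: cone.cocycles_iff)
  then obtain u v where uv: "p = Node u v" "u \<in> carrier (X j)" "v \<in> carrier (prev_module X j)"
    by (rule cone_memE)
  have coc: "u \<in> cocycles X d j" "prev_diff d j v = x \<odot>\<^bsub>X j\<^esub> u"
    using p uv(1) by (auto simp: cone_cocycles)
  have "x \<odot>\<^bsub>X j\<^esub> u \<in> coboundaries X d j" using coc(2) uv(3) image_prev[of j] by force
  then have "torsion_mod R a (X j) (coboundaries X d j) u"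
    using low[OF _ coc(1)] killed coc(1) j by (cases "j = s") auto
  then obtain k :: nat where k: "(f [^] k) \<odot>\<^bsub>X j\<^esub> u \<in> coboundaries X d j"
    using f unfolding torsion_mod_def by auto
  show "\<exists>k::nat. (f [^] k) \<odot>\<^bsub>C j\<^esub> p \<in> coboundaries C D j"
  proof (cases j)
    case 0
    have "(f [^] k) \<odot>\<^bsub>prev_module X 0\<^esub> v \<in> carrier (prev_module X 0)"
      using module.smult_closed[OF module_prev] fc uv(3) 0 by simp
    then have "(f [^] k) \<odot>\<^bsub>C j\<^esub> p = \<zero>\<^bsub>C j\<^esub>"
      using k uv(1) 0 zero_prev by (simp add: cone_simps coboundaries_def)
    then have "(f [^] k) \<odot>\<^bsub>C j\<^esub> p \<in> coboundaries C D j"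
      using 0 by (simp add: coboundaries_def)
    then show ?thesis ..
  next
    case (Suc i)
    interpret CS: module R "C (Suc i)" by (rule module_cone)
    interpret XI: module R "X i" by (rule module)
    note Bmem = CS.submodule_mem[OF cone.submodule_coboundaries[of "Suc i"]]
    have "(f [^] k) \<odot>\<^bsub>C (Suc i)\<^esub> p \<in> lower i"
      unfolding lower_def using k uv(1) Suc p fc
        CM.submodule_mem(5)[OF cone.submodule_cocycles, of "f [^] k" p] by (simp add: cone_simps)
    then obtain v' b where v': "v' \<in> cocycles X d i" "b \<in> coboundaries C D (Suc i)"
      "(f [^] k) \<odot>\<^bsub>C (Suc i)\<^esub> p = Node \<zero>\<^bsub>X (Suc i)\<^esub> v' \<oplus>\<^bsub>C (Suc i)\<^esub> b" by (rule lower_decompose)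
    obtain l :: nat where l: "(f [^] l) \<odot>\<^bsub>X i\<^esub> v' \<in> coboundaries X d i"
      using low[OF _ v'(1)] Suc j f unfolding torsion_mod_def by auto
    note nD = mod_homD[OF hom_zero_Node[of i]]
    have v'c: "v' \<in> carrier (X i)" using v'(1) by (simp add: cocycles_iff)
    have "Node \<zero>\<^bsub>X (Suc i)\<^esub> ((f [^] l) \<odot>\<^bsub>X i\<^esub> v') \<in> coboundaries C D (Suc i)"
      using l coboundaries_le_mult(1) by (intro zero_Node_in_coboundaries) auto
    then have "(f [^] l) \<odot>\<^bsub>C (Suc i)\<^esub> Node \<zero>\<^bsub>X (Suc i)\<^esub> v' \<in> coboundaries C D (Suc i)"
      using nD(3)[OF _ v'c, of "f [^] l"] fc by simp
    moreover have "(f [^] l) \<odot>\<^bsub>C (Suc i)\<^esub> b \<in> coboundaries C D (Suc i)" using Bmem(5)[OF _ v'(2)] fc by simp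
    ultimately have "(f [^] l) \<odot>\<^bsub>C (Suc i)\<^esub> ((f [^] k) \<odot>\<^bsub>C (Suc i)\<^esub> p) \<in> coboundaries C D (Suc i)"
      unfolding v'(3) using Bmem(1,3) v'(2) fc nD(1)[OF v'c] by (simp add: CS.smult_r_distr)
    then have "(f [^] (l + k)) \<odot>\<^bsub>C j\<^esub> p \<in> coboundaries C D j"
      using Suc fc pc by (simp add: CS.smult_assoc1 R.nat_pow_mult[symmetric])
    then show ?thesis ..
  qed
qed

lemma lower_eq_cocycles:
  assumes "cocycles X d (Suc i) \<subseteq> coboundaries X d (Suc i)"
  shows "lower i = cocycles C D (Suc i)"
proof -
  have "left p \<in> coboundaries X d (Suc i)" if p: "p \<in> cocycles C D (Suc i)" for p
  proof -
    have "p \<in> carrier (C (Suc i))" using p by (simp add: cone.cocycles_iff)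
    then obtain u v where "p = Node u v" by (rule cone_memE)
    then show ?thesis using p assms by (auto simp: cone_cocycles)
  qed
  then show ?thesis by (auto simp: lower_def)
qed

lemma exact_cone:
  assumes "cocycles X d i \<subseteq> coboundaries X d i" "cocycles X d (Suc i) \<subseteq> coboundaries X d (Suc i)"
  shows "cocycles C D (Suc i) \<subseteq> coboundaries C D (Suc i)"
proof
  interpret CS: module R "C (Suc i)" by (rule module_cone)
  fix p assume "p \<in> cocycles C D (Suc i)"
  then have "p \<in> lower i" using lower_eq_cocycles[OF assms(2)] by simp
  then obtain v b where vb: "v \<in> cocycles X d i" "b \<in> coboundaries C D (Suc i)"
    "p = Node \<zero>\<^bsub>X (Suc i)\<^esub> v \<oplus>\<^bsub>C (Suc i)\<^esub> b" by (rule lower_decompose)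
  have "Node \<zero>\<^bsub>X (Suc i)\<^esub> v \<in> coboundaries C D (Suc i)"
    using vb(1) assms(1) coboundaries_le_mult(1) by (intro zero_Node_in_coboundaries) auto
  then show "p \<in> coboundaries C D (Suc i)"
    using vb CS.submodule_mem(3)[OF cone.submodule_coboundaries] by simp
qed

end

lemma (in cone_complex) artinian_lower:
  assumes "artinian_between R (X i) (coboundaries X d i) (cocycles X d i)"
  shows "artinian_between R (C (Suc i)) (coboundaries C D (Suc i)) (lower i)"
proof -
  have "subquotient R (X i) (coboundaries X d i) (cocycles X d i) (X i) (mult_coboundaries i) (cocycles X d i)"
    using cohomology_interval mult_coboundaries_interval coboundaries_le_mult(1)
    by (intro subquotient_same) auto
  from artinian_between_subquotient[OF artinian_between_subquotient[OF assms this] subquotient_lower]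
  show ?thesis .
qed

lemma (in cone_complex) artinian_upper:
  assumes "artinian_between R (X (Suc i)) (coboundaries X d (Suc i)) (cocycles X d (Suc i))"
  shows "artinian_between R (C (Suc i)) (lower i) (cocycles C D (Suc i))"
  by (rule artinian_between_subquotient[OF assms subquotient_upper])

section \<open>The theorem for complexes of injective modules\<close>

text \<open>Induction on the bound \<open>n\<close> for chains of primes.  The index \<open>s\<close> marks the only degree in which
  \<open>X\<close> has cohomology that is not torsion; passing to a cone raises both \<open>s\<close> and \<open>t\<close> by one and lowers \<open>n\<close>.\<close>

lemma reduced_torsion_cohomology_artinian:
  fixes X :: "nat \<Rightarrow> ('a, 'c nest) module"
  assumes "injective_complex R X d a" and "s < t"
    and "\<And>i z. i < s \<Longrightarrow> z \<in> cocycles X d i \<Longrightarrow> torsion_mod R a (X i) (coboundaries X d i) z"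
    and "\<And>i. s < i \<Longrightarrow> cocycles X d i \<subseteq> coboundaries X d i"
    and "laskerian_between R (X s) (coboundaries X d s) (cocycles X d s)"
    and "chains_below R a n (X s) (coboundaries X d s) (cocycles X d s)"
    and "\<And>i. t < i \<Longrightarrow> artinian_between R (torsion_module R a (X i))
      (coboundaries (\<lambda>j. torsion_module R a (X j)) d i) (cocycles (\<lambda>j. torsion_module R a (X j)) d i)"
  shows "artinian_between R (torsion_module R a (X t))
    (ideal_times R (torsion_module R a (X t)) a (cocycles (\<lambda>j. torsion_module R a (X j)) d t)
      <+>\<^bsub>torsion_module R a (X t)\<^esub> coboundaries (\<lambda>j. torsion_module R a (X j)) d t)
    (cocycles (\<lambda>j. torsion_module R a (X j)) d t)"
  using assms
proof (induction n arbitrary: X d s t)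
  case 0
  interpret injective_complex R X d a by (rule "0.prems")
  interpret TC: cochain_complex R T d by (rule torsion_complex)
  interpret Xs: noetherian_module_base R "X s" by (rule base)
  interpret Tt: module R "T t" by (rule module_T)
  have supp: "a \<subseteq> p" if "p \<in> supp_between R (X s) (coboundaries X d s) (cocycles X d s)" for p
    using "0.prems"(6) that unfolding chains_below_def by auto
  have tors: "torsion_mod R a (X i) (coboundaries X d i) z" if z: "z \<in> cocycles X d i" for i z
  proof -
    consider "i < s" | "i = s" | "s < i" by linarith
    then show ?thesis
    proof cases
      case 1
      then show ?thesis using "0.prems"(3) z by blast
    next
      case 2
      then show ?thesis
        using Xs.torsion_mod_if_supp[OF submodule_coboundaries submodule_cocycles a_subset supp] z by simp
    next
      case 3
      then have "z \<in> coboundaries X d i" using "0.prems"(4) z by blast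
      then show ?thesis by (rule module.torsion_mod_mem[OF module submodule_coboundaries])
    qed
  qed
  have "cocycles T d t \<subseteq> coboundaries T d t"
  proof
    fix y assume y: "y \<in> cocycles T d t"
    then have yT: "y \<in> carrier (T t)" by (simp add: TC.cocycles_iff)
    moreover have "y \<in> cocycles X d t" using y yT by (auto simp: TC.cocycles_iff cocycles_iff T_iff)
    then have "y \<in> coboundaries X d t" using "0.prems"(2,4) by blast
    ultimately show "y \<in> coboundaries T d t" using torsion_exact[OF tors] by blast
  qed
  then have BZ: "coboundaries T d t = cocycles T d t" using TC.coboundaries_le_cocycles by blast
  let ?aZ = "ideal_times R (T t) a (cocycles T d t)"
  have "?aZ <+>\<^bsub>T t\<^esub> cocycles T d t = cocycles T d t"
    using TC.reduced_interval(2)[OF a_subset, of t] Tt.set_add_ge2[OF TC.reduced_interval(1)[OF a_subset] TC.submodule_cocycles]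
    unfolding BZ interval_def by blast
  then show ?case unfolding BZ by (simp add: artinian_between_same)
next
  case (Suc n)
  interpret injective_complex R X d a by (rule Suc.prems)
  interpret Xs: noetherian_module_base R "X s" by (rule base)
  let ?B = "coboundaries X d s" and ?Z = "cocycles X d s"
  note Bs = submodule_coboundaries[of s] and Zs = submodule_cocycles[of s]
    and BZ = coboundaries_le_cocycles[of s]
  let ?P = "{p \<in> ass_between R (X s) ?B ?Z. \<not> a \<subseteq> p}"
  have "finite (ass_between R (X s) ?B ?Z)"
    using Suc.prems(5) Bs BZ unfolding laskerian_between_def by blast
  then have "finite ?P" by simp
  moreover have "\<And>p. p \<in> ?P \<Longrightarrow> primeideal p R" by (simp add: ass_between_def)
  ultimately obtain x where xa: "x \<in> a" and avoid: "\<And>p. p \<in> ?P \<Longrightarrow> x \<notin> p"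
    using R.prime_avoidance[OF _ _ ideal, of ?P] by blast
  have xc: "x \<in> carrier R" using xa a_subset by blast
  have avoid': "x \<notin> p" if "p \<in> ass_between R (X s) ?B ?Z" "\<not> a \<subseteq> p" for p using avoid that by blast
  interpret cone_complex R X d x
    by (intro cone_complex.intro cone_complex_axioms.intro cochain_complex_axioms xc)
  interpret injective_cone R X d a x ..
  interpret K: cone_complex R T d x by (rule cone_complex_torsion)
  have TC: "(\<lambda>j. torsion_module R a (C j)) = cone T" by (rule ext) (rule torsion_cone)
  note DT = cone_diff_torsion
  have same: "subquotient R (X s) ?B ?Z (X s) (mult_coboundaries s) ?Z"
    using cohomology_interval mult_coboundaries_interval coboundaries_le_mult(1)
    by (intro subquotient_same) auto
  have low: "lower s = cocycles C D (Suc s)"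
    by (rule lower_eq_cocycles[OF Suc.prems(4)]) simp
  note sq = subquotient_lower[of s, unfolded low]
  have "artinian_between R (torsion_module R a (C (Suc t)))
    (ideal_times R (torsion_module R a (C (Suc t))) a (cocycles (\<lambda>j. torsion_module R a (C j)) D (Suc t))
      <+>\<^bsub>torsion_module R a (C (Suc t))\<^esub> coboundaries (\<lambda>j. torsion_module R a (C j)) D (Suc t))
    (cocycles (\<lambda>j. torsion_module R a (C j)) D (Suc t))"
  proof (rule Suc.IH[OF injective_complex_cone])
    show "Suc s < Suc t" using Suc.prems(2) by simp
    show "torsion_mod R a (C i) (coboundaries C D i) z" if "i < Suc s" "z \<in> cocycles C D i" for i z
    proof (rule torsion_cohomology_cone[OF Suc.prems(3)])
      show "i \<le> s" "z \<in> cocycles C D i" using that by auto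
      show "torsion_mod R a (X s) ?B z" if "z \<in> ?Z" "x \<odot>\<^bsub>X s\<^esub> z \<in> ?B" for z
        using Xs.torsion_mod_if_killed[OF Bs Zs BZ a_subset xa avoid' that] .
    qed
    show "cocycles C D i \<subseteq> coboundaries C D i" if "Suc s < i" for i
      using that exact_cone[OF Suc.prems(4) Suc.prems(4)] by (cases i) auto
    show "laskerian_between R (C (Suc s)) (coboundaries C D (Suc s)) (cocycles C D (Suc s))"
      by (rule laskerian_between_subquotient[OF laskerian_between_subquotient[OF Suc.prems(5) same] sq])
    have "chains_below R a n (X s) (mult_coboundaries s) ?Z"
      using coboundaries_le_mult mult_coboundaries_interval
      by (intro Xs.chains_below_quotient[OF Bs Zs BZ a_subset xa avoid' Suc.prems(6)]) (auto simp: interval_def)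
    then show "chains_below R a n (C (Suc s)) (coboundaries C D (Suc s)) (cocycles C D (Suc s))"
      by (rule chains_below_mono) (rule supp_between_subquotient[OF sq])
    show "artinian_between R (torsion_module R a (C i)) (coboundaries (\<lambda>j. torsion_module R a (C j)) D i)
      (cocycles (\<lambda>j. torsion_module R a (C j)) D i)" if i: "Suc t < i" for i
    proof -
      obtain k where k: "i = Suc k" "t < k" using i by (cases i) auto
      have "artinian_between R (K.C (Suc k)) (coboundaries K.C K.D (Suc k)) (cocycles K.C K.D (Suc k))"
        using k(2) by (intro artinian_between_trans[OF K.artinian_lower K.artinian_upper] K.lower_interval Suc.prems(7)) auto
      then show ?thesis unfolding TC torsion_cone k DT .
    qed
  qed
  then have reduced: "artinian_between R (K.C (Suc t))
    (ideal_times R (K.C (Suc t)) a (cocycles K.C K.D (Suc t)) <+>\<^bsub>K.C (Suc t)\<^esub> coboundaries K.C K.D (Suc t))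
    (cocycles K.C K.D (Suc t))"
    unfolding TC torsion_cone DT .
  interpret KM: module R "K.C (Suc t)" by (rule K.module_cone)
  obtain F where F: "F \<subseteq> carrier R" "finite F" "a = Idl\<^bsub>R\<^esub> F" using R.finetely_gen[OF ideal] by blast
  \<comment> \<open>The classes in \<open>lower t\<close> are the copy of \<open>H\<^sup>t(\<Gamma>X)/xH\<^sup>t(\<Gamma>X)\<close> in the cohomology of the cone.\<close>
  have upper: "artinian_between R (K.C (Suc t)) (K.lower t) (cocycles K.C K.D (Suc t))"
    by (intro K.artinian_upper Suc.prems(7)) simp
  have low: "submodule (K.lower t) R (K.C (Suc t))" "K.lower t \<subseteq> cocycles K.C K.D (Suc t)"
    "submodule (coboundaries K.C K.D (Suc t)) R (K.C (Suc t))" "coboundaries K.C K.D (Suc t) \<subseteq> K.lower t"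
    using K.lower_interval[of t] by (auto simp: interval_def)
  have "artinian_between R (K.C (Suc t))
    (ideal_times R (K.C (Suc t)) a (K.lower t) <+>\<^bsub>K.C (Suc t)\<^esub> coboundaries K.C K.D (Suc t)) (K.lower t)"
    by (rule KM.artinian_between_ideal_times[OF K.cone.submodule_cocycles low F(2,1), folded F(3), OF upper reduced])
  from artinian_between_subquotient[OF this K.subquotient_reduced_lower[OF a_subset xa]]
  show ?case .
qed

section \<open>Quotient modules\<close>

context module
begin

lemma coset_add:
  assumes K: "submodule K R M" and "x \<in> carrier M" "y \<in> carrier M"
  shows "(K +>\<^bsub>M\<^esub> x) <+>\<^bsub>M\<^esub> (K +>\<^bsub>M\<^esub> y) = K +>\<^bsub>M\<^esub> (x \<oplus>\<^bsub>M\<^esub> y)"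
proof -
  interpret abelian_subgroup K M
    using submodule.axioms(1)[OF K] M.abelian_group_axioms
    by (intro abelian_subgroupI3) (simp_all add: additive_subgroup_def)
  show ?thesis using assms by (intro a_rcos_sum)
qed

lemma coset_eq_iff:
  assumes K: "submodule K R M" and "x \<in> carrier M" "y \<in> carrier M"
  shows "K +>\<^bsub>M\<^esub> x = K +>\<^bsub>M\<^esub> y \<longleftrightarrow> x \<ominus>\<^bsub>M\<^esub> y \<in> K"
proof -
  note mem = submodule_mem[OF K]
  have *: "u \<in> K +>\<^bsub>M\<^esub> v \<longleftrightarrow> u \<ominus>\<^bsub>M\<^esub> v \<in> K" if "u \<in> carrier M" "v \<in> carrier M" for u v
  proof
    assume "u \<in> K +>\<^bsub>M\<^esub> v"
    then obtain k where "k \<in> K" "u = k \<oplus>\<^bsub>M\<^esub> v" by (auto simp: a_r_coset_def')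
    then show "u \<ominus>\<^bsub>M\<^esub> v \<in> K" using that mem(1) by simp
  next
    assume k: "u \<ominus>\<^bsub>M\<^esub> v \<in> K"
    have "u = (u \<ominus>\<^bsub>M\<^esub> v) \<oplus>\<^bsub>M\<^esub> v" using that by simp
    then show "u \<in> K +>\<^bsub>M\<^esub> v" using k unfolding a_r_coset_def' by blast
  qed
  have sub: "subgroup K (add_monoid M)" using submodule.axioms(1)[OF K] .
  have self: "x \<in> K +>\<^bsub>M\<^esub> x" using *[of x x] assms mem(2) by simp
  show ?thesis
  proof
    assume "K +>\<^bsub>M\<^esub> x = K +>\<^bsub>M\<^esub> y"
    then show "x \<ominus>\<^bsub>M\<^esub> y \<in> K" using self * assms by simp
  next
    assume "x \<ominus>\<^bsub>M\<^esub> y \<in> K"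
    then have "x \<in> K +>\<^bsub>M\<^esub> y" using * assms by simp
    then show "K +>\<^bsub>M\<^esub> x = K +>\<^bsub>M\<^esub> y" using M.a_repr_independence[OF _ assms(3) sub] by simp
  qed
qed

lemma coset_zero_iff:
  assumes K: "submodule K R M" and x: "x \<in> carrier M"
  shows "K +>\<^bsub>M\<^esub> x = K \<longleftrightarrow> x \<in> K"
proof -
  have "K +>\<^bsub>M\<^esub> \<zero>\<^bsub>M\<^esub> = K" using submodule_mem(1)[OF K] by (intro M.a_coset_add_zero) auto
  then show ?thesis using coset_eq_iff[OF K x M.zero_closed] x by simp
qed

lemma quot_module_simps:
  assumes K: "submodule K R M"
  shows "\<zero>\<^bsub>quot_module M K\<^esub> = K"
    "carrier (quot_module M K) = (\<lambda>x. K +>\<^bsub>M\<^esub> x) ` carrier M"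
    "x \<in> carrier M \<Longrightarrow> y \<in> carrier M \<Longrightarrow>
      (K +>\<^bsub>M\<^esub> x) \<oplus>\<^bsub>quot_module M K\<^esub> (K +>\<^bsub>M\<^esub> y) = K +>\<^bsub>M\<^esub> (x \<oplus>\<^bsub>M\<^esub> y)"
    "r \<in> carrier R \<Longrightarrow> x \<in> carrier M \<Longrightarrow>
      r \<odot>\<^bsub>quot_module M K\<^esub> (K +>\<^bsub>M\<^esub> x) = K +>\<^bsub>M\<^esub> (r \<odot>\<^bsub>M\<^esub> x)"
proof -
  note mem = submodule_mem[OF K]
  show "\<zero>\<^bsub>quot_module M K\<^esub> = K" by (simp add: quot_module_def)
  show "carrier (quot_module M K) = (\<lambda>x. K +>\<^bsub>M\<^esub> x) ` carrier M"
    by (auto simp: quot_module_def A_RCOSETS_def')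
  show "(K +>\<^bsub>M\<^esub> x) \<oplus>\<^bsub>quot_module M K\<^esub> (K +>\<^bsub>M\<^esub> y) = K +>\<^bsub>M\<^esub> (x \<oplus>\<^bsub>M\<^esub> y)"
    if "x \<in> carrier M" "y \<in> carrier M"
    using coset_add[OF K that] by (simp add: quot_module_def)
  show "r \<odot>\<^bsub>quot_module M K\<^esub> (K +>\<^bsub>M\<^esub> x) = K +>\<^bsub>M\<^esub> (r \<odot>\<^bsub>M\<^esub> x)"
    if r: "r \<in> carrier R" and x: "x \<in> carrier M"
  proof -
    have "K +>\<^bsub>M\<^esub> (r \<odot>\<^bsub>M\<^esub> y) = K +>\<^bsub>M\<^esub> (r \<odot>\<^bsub>M\<^esub> x)" if y: "y \<in> K +>\<^bsub>M\<^esub> x" for y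
    proof -
      obtain k where k: "k \<in> K" "y = k \<oplus>\<^bsub>M\<^esub> x" using y by (auto simp: a_r_coset_def')
      then have yc: "y \<in> carrier M" using mem(1) x by simp
      have "r \<odot>\<^bsub>M\<^esub> y \<ominus>\<^bsub>M\<^esub> r \<odot>\<^bsub>M\<^esub> x = r \<odot>\<^bsub>M\<^esub> k"
        using k mem(1) x r by (simp add: smult_r_distr)
      then show ?thesis using coset_eq_iff[OF K] yc x r mem(5)[OF r k(1)] by simp
    qed
    moreover have "x \<in> K +>\<^bsub>M\<^esub> x"
    proof -
      have "x = \<zero>\<^bsub>M\<^esub> \<oplus>\<^bsub>M\<^esub> x" using x by simp
      then show ?thesis using mem(2) unfolding a_r_coset_def' by blast
    qed
    ultimately have "(\<Union>y\<in>K +>\<^bsub>M\<^esub> x. K +>\<^bsub>M\<^esub> (r \<odot>\<^bsub>M\<^esub> y)) = K +>\<^bsub>M\<^esub> (r \<odot>\<^bsub>M\<^esub> x)" by blast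
    then show ?thesis by (simp add: quot_module_def)
  qed
qed

lemma module_quot_module:
  assumes K: "submodule K R M"
  shows "module R (quot_module M K)"
proof (rule moduleI)
  note q = quot_module_simps[OF K]
  show "cring R" by (rule R.is_cring)
  show "abelian_group (quot_module M K)"
  proof (rule abelian_groupI)
    show "\<zero>\<^bsub>quot_module M K\<^esub> \<in> carrier (quot_module M K)"
      unfolding q(1,2) using coset_zero_iff[OF K M.zero_closed] submodule_mem(2)[OF K]
      by (intro image_eqI[of _ _ "\<zero>\<^bsub>M\<^esub>"]) auto
    fix A assume "A \<in> carrier (quot_module M K)"
    then obtain x where x: "x \<in> carrier M" "A = K +>\<^bsub>M\<^esub> x" using q(2) by auto
    have z: "K = K +>\<^bsub>M\<^esub> \<zero>\<^bsub>M\<^esub>" using coset_zero_iff[OF K M.zero_closed] submodule_mem(2)[OF K] by simp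
    show "\<zero>\<^bsub>quot_module M K\<^esub> \<oplus>\<^bsub>quot_module M K\<^esub> A = A"
      using q(1) q(3)[OF M.zero_closed x(1)] z x by simp
    have "(K +>\<^bsub>M\<^esub> (\<ominus>\<^bsub>M\<^esub> x)) \<oplus>\<^bsub>quot_module M K\<^esub> A = \<zero>\<^bsub>quot_module M K\<^esub>"
      using q(1) q(3)[OF M.a_inv_closed[OF x(1)] x(1)] z x by (simp add: M.l_neg)
    then show "\<exists>B\<in>carrier (quot_module M K). B \<oplus>\<^bsub>quot_module M K\<^esub> A = \<zero>\<^bsub>quot_module M K\<^esub>"
      using q(2) x(1) by (intro bexI[of _ "K +>\<^bsub>M\<^esub> (\<ominus>\<^bsub>M\<^esub> x)"]) auto
    fix B assume "B \<in> carrier (quot_module M K)"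
    then obtain y where y: "y \<in> carrier M" "B = K +>\<^bsub>M\<^esub> y" using q(2) by auto
    show "A \<oplus>\<^bsub>quot_module M K\<^esub> B \<in> carrier (quot_module M K)"
      unfolding x(2) y(2) using x(1) y(1) by (simp add: q)
    show "A \<oplus>\<^bsub>quot_module M K\<^esub> B = B \<oplus>\<^bsub>quot_module M K\<^esub> A"
      unfolding x(2) y(2) using x(1) y(1) by (simp add: q M.a_comm)
    fix C assume "C \<in> carrier (quot_module M K)"
    then obtain z where z: "z \<in> carrier M" "C = K +>\<^bsub>M\<^esub> z" using q(2) by auto
    show "A \<oplus>\<^bsub>quot_module M K\<^esub> B \<oplus>\<^bsub>quot_module M K\<^esub> C =
      A \<oplus>\<^bsub>quot_module M K\<^esub> (B \<oplus>\<^bsub>quot_module M K\<^esub> C)"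
      unfolding x(2) y(2) z(2) using x(1) y(1) z(1) by (simp add: q M.a_assoc)
  qed
qed (auto simp: quot_module_simps[OF K] smult_l_distr smult_r_distr smult_assoc1)

lemma coset_hom:
  assumes K: "submodule K R M"
  shows "(\<lambda>x. K +>\<^bsub>M\<^esub> x) \<in> mod_hom R M (quot_module M K)"
  using quot_module_simps[OF K] by (intro mod_homI) auto

lemma artinian_between_zero_carrier:
  "artinian_module R M \<longleftrightarrow> artinian_between R M {\<zero>\<^bsub>M\<^esub>} (carrier M)"
proof
  assume "artinian_module R M"
  then interpret artinian_module R M .
  show "artinian_between R M {\<zero>\<^bsub>M\<^esub>} (carrier M)"
    unfolding artinian_between_def using descending_chain_condition by blast
next
  assume art: "artinian_between R M {\<zero>\<^bsub>M\<^esub>} (carrier M)"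
  show "artinian_module R M"
  proof (intro artinian_module.intro artinian_module_axioms.intro module_axioms)
    fix K :: "nat \<Rightarrow> _" assume "\<And>n. submodule (K n) R M" "\<And>n. K (Suc n) \<subseteq> K n"
    then show "\<exists>n. \<forall>m\<ge>n. K m = K n"
      using art submodule_iff unfolding artinian_between_def by simp
  qed
qed

lemma submodule_ideal_smult:
  assumes a: "ideal a R"
  shows "submodule (ideal_smult a M) R M"
proof -
  let ?G = "{r \<odot>\<^bsub>M\<^esub> x | r x. r \<in> a \<and> x \<in> carrier M}"
  have ac: "\<And>r. r \<in> a \<Longrightarrow> r \<in> carrier R" using ideal.Icarr[OF a] .
  have G: "?G \<subseteq> carrier M" using ac by auto
  have sub: "subgroup (ideal_smult a M) (add_monoid M)"
    unfolding ideal_smult_def using M.add.generate_is_subgroup G by simp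
  have sm: "s \<odot>\<^bsub>M\<^esub> y \<in> ideal_smult a M" if s: "s \<in> carrier R" and y: "y \<in> ideal_smult a M" for s y
    using y unfolding ideal_smult_def
  proof (induction rule: generate.induct)
    case one
    then show ?case using s generate.one[of "add_monoid M"] by simp
  next
    case (incl h)
    then obtain r x where rx: "r \<in> a" "x \<in> carrier M" "h = r \<odot>\<^bsub>M\<^esub> x" by auto
    then have "s \<odot>\<^bsub>M\<^esub> h = (s \<otimes> r) \<odot>\<^bsub>M\<^esub> x" using s ac by (simp add: smult_assoc1)
    then show ?case using rx s ideal.I_l_closed[OF a] by (intro generate.incl) auto
  next
    case (inv h)
    then obtain r x where rx: "r \<in> a" "x \<in> carrier M" "h = r \<odot>\<^bsub>M\<^esub> x" by auto
    have "inv\<^bsub>add_monoid M\<^esub> h = \<ominus>\<^bsub>M\<^esub> h" by (simp add: a_inv_def)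
    then have "s \<odot>\<^bsub>M\<^esub> (inv\<^bsub>add_monoid M\<^esub> h) = (s \<otimes> r) \<odot>\<^bsub>M\<^esub> (\<ominus>\<^bsub>M\<^esub> x)"
      using rx s ac by (simp add: smult_assoc1 smult_r_minus)
    moreover have "s \<otimes> r \<in> a" "\<ominus>\<^bsub>M\<^esub> x \<in> carrier M" using rx s ideal.I_l_closed[OF a] by auto
    then have "(s \<otimes> r) \<odot>\<^bsub>M\<^esub> (\<ominus>\<^bsub>M\<^esub> x) \<in> ?G" by blast
    ultimately show ?case by (simp only: generate.incl)
  next
    case (eng h1 h2)
    have "h1 \<in> carrier M" "h2 \<in> carrier M"
      using M.add.generate_in_carrier[of ?G] G eng.hyps by simp_all
    then have "s \<odot>\<^bsub>M\<^esub> (h1 \<otimes>\<^bsub>add_monoid M\<^esub> h2) = (s \<odot>\<^bsub>M\<^esub> h1) \<otimes>\<^bsub>add_monoid M\<^esub> (s \<odot>\<^bsub>M\<^esub> h2)"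
      using s by (simp add: smult_r_distr)
    then show ?case using generate.eng[OF eng.IH] by (simp only:)
  qed
  show ?thesis using sub sm by (intro submodule.intro submodule_axioms.intro)
qed

lemma ideal_smultI: "r \<in> a \<Longrightarrow> x \<in> carrier M \<Longrightarrow> r \<odot>\<^bsub>M\<^esub> x \<in> ideal_smult a M"
  unfolding ideal_smult_def by (intro generate.incl) auto

end

lemma lin_rel_graph:
  assumes i: "interval R M K L" and N: "module R N" and f: "f \<in> mod_hom R (M\<lparr>carrier := L\<rparr>) N"
  shows "lin_rel R M N {(x, f x) | x. x \<in> L}" and "lin_rel R N M {(f x, x) | x. x \<in> L}"
proof -
  have L: "module R M" "submodule L R M" using i by (auto simp: interval_def)
  note Lmem = module.submodule_mem[OF L] and fD = mod_homD[OF f]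
  have 0: "f \<zero>\<^bsub>M\<^esub> = \<zero>\<^bsub>N\<^esub>"
    using mod_hom_zero[OF submodule.submodule_is_module[OF L(2,1)] N f] by simp
  have "\<exists>z. f x \<oplus>\<^bsub>N\<^esub> f y = f z \<and> x \<oplus>\<^bsub>M\<^esub> y = z \<and> z \<in> L" if "x \<in> L" "y \<in> L" for x y
    using that fD(2)[of x y] Lmem(3) by simp
  moreover have "\<exists>z. r \<odot>\<^bsub>N\<^esub> f x = f z \<and> r \<odot>\<^bsub>M\<^esub> x = z \<and> z \<in> L" if "r \<in> carrier R" "x \<in> L" for r x
    using that fD(3)[of r x] Lmem(5) by simp
  ultimately show "lin_rel R M N {(x, f x) | x. x \<in> L}" "lin_rel R N M {(f x, x) | x. x \<in> L}"
    unfolding lin_rel_def using 0 Lmem(1,2) fD(1) by auto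
qed

lemma mod_hom_restrict:
  "f \<in> mod_hom R M N \<Longrightarrow> L \<subseteq> carrier M \<Longrightarrow> f \<in> mod_hom R (M\<lparr>carrier := L\<rparr>) N"
  by (rule mod_homI) (auto simp: mod_homD subset_iff)

lemma subquotient_image:
  assumes f: "f \<in> mod_hom R (M\<lparr>carrier := L\<rparr>) N" and i: "interval R M K L" "interval R N K' L'"
    and L: "L' \<subseteq> f ` L" and K: "\<And>x. x \<in> K \<Longrightarrow> f x \<in> L' \<Longrightarrow> f x \<in> K'"
  shows "subquotient R M K L N K' L'"
proof (rule subquotientI[OF i])
  show "lin_rel R M N {(x, f x) | x. x \<in> L}" by (rule lin_rel_graph(1)[OF i(1) _ f]) (use i in \<open>simp add: interval_def\<close>)
qed (use L K in auto)

lemma subquotient_preimage: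
  assumes f: "f \<in> mod_hom R (M\<lparr>carrier := L\<rparr>) N" and i: "interval R N K' L'" "interval R M K L"
    and L: "f ` L \<subseteq> L'" and K: "\<And>x. x \<in> L \<Longrightarrow> f x \<in> K' \<Longrightarrow> x \<in> K"
  shows "subquotient R N K' L' M K L"
proof (rule subquotientI[OF i])
  show "lin_rel R N M {(f x, x) | x. x \<in> L}" by (rule lin_rel_graph(2)[OF i(2) _ f]) (use i in \<open>simp add: interval_def\<close>)
qed (use L K in auto)

lemma quotient_of_interval:
  fixes M :: "('a, 'b) module"
  assumes i: "interval R M K L" and Q: "Q = quot_module (M\<lparr>carrier := L\<rparr>) K"
  shows "module R Q" and "\<exists>\<pi>\<in>mod_hom R (M\<lparr>carrier := L\<rparr>) Q. \<pi> ` L = carrier Q \<and>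
    (\<forall>z\<in>L. \<pi> z = \<zero>\<^bsub>Q\<^esub> \<longleftrightarrow> z \<in> K)"
proof -
  have i': "module R M" "submodule K R M" "submodule L R M" "K \<subseteq> L" using i by (auto simp: interval_def)
  interpret M: module R M by fact
  interpret L: module R "M\<lparr>carrier := L\<rparr>" by (rule submodule.submodule_is_module[OF i'(3,1)])
  have K: "submodule K R (M\<lparr>carrier := L\<rparr>)"
    using M.submodule_mem[OF i'(2)] i'(4) by (simp add: L.submodule_iff)
  let ?\<pi> = "\<lambda>z. K +>\<^bsub>M\<lparr>carrier := L\<rparr>\<^esub> z"
  show "module R Q" unfolding Q by (rule L.module_quot_module[OF K])
  have "?\<pi> ` L = carrier Q" using L.quot_module_simps(2)[OF K] by (simp add: Q)
  moreover have "\<forall>z\<in>L. ?\<pi> z = \<zero>\<^bsub>Q\<^esub> \<longleftrightarrow> z \<in> K"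
    using L.quot_module_simps(1)[OF K] L.coset_zero_iff[OF K] by (simp add: Q)
  moreover have "?\<pi> \<in> mod_hom R (M\<lparr>carrier := L\<rparr>) Q" unfolding Q by (rule L.coset_hom[OF K])
  ultimately show "\<exists>\<pi>\<in>mod_hom R (M\<lparr>carrier := L\<rparr>) Q. \<pi> ` L = carrier Q \<and>
    (\<forall>z\<in>L. \<pi> z = \<zero>\<^bsub>Q\<^esub> \<longleftrightarrow> z \<in> K)" by blast
qed

section \<open>Local cohomology from an injective resolution\<close>

lemma artinian_if_cohomology:
  assumes C: "cochain_complex R C d" and art: "artinian_module R (cohomology C d i)"
  shows "artinian_between R (C i) (coboundaries C d i) (cocycles C d i)"
proof -
  interpret cochain_complex R C d by fact
  let ?H = "cohomology C d i"
  note q = quotient_of_interval[OF cohomology_interval[of i] cohomology_def[of C d i]]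
  obtain \<pi> where \<pi>: "\<pi> \<in> mod_hom R ((C i)\<lparr>carrier := cocycles C d i\<rparr>) ?H"
    "\<pi> ` cocycles C d i = carrier ?H"
    "\<And>z. z \<in> cocycles C d i \<Longrightarrow> \<pi> z = \<zero>\<^bsub>?H\<^esub> \<longleftrightarrow> z \<in> coboundaries C d i"
    using q(2) by auto
  interpret H: module R ?H by (rule q(1))
  have "interval R ?H {\<zero>\<^bsub>?H\<^esub>} (carrier ?H)"
    using q(1) H.submodule_zero H.carrier_is_submodule by (simp add: interval_def)
  from subquotient_preimage[OF \<pi>(1) this cohomology_interval]
  have "subquotient R ?H {\<zero>\<^bsub>?H\<^esub>} (carrier ?H) (C i) (coboundaries C d i) (cocycles C d i)"
    using \<pi>(2,3) by auto
  moreover have "artinian_between R ?H {\<zero>\<^bsub>?H\<^esub>} (carrier ?H)"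
    using art by (simp add: H.artinian_between_zero_carrier)
  ultimately show ?thesis by (rule artinian_between_subquotient[rotated])
qed

lemma reduced_cohomology_artinian:
  assumes C: "cochain_complex R C d" and a: "ideal a R"
    and art: "artinian_between R (C i)
      (ideal_times R (C i) a (cocycles C d i) <+>\<^bsub>C i\<^esub> coboundaries C d i) (cocycles C d i)"
  shows "artinian_module R (quot_module (cohomology C d i) (ideal_smult a (cohomology C d i)))"
proof -
  interpret cochain_complex R C d by fact
  interpret M: module R "C i" by (rule module)
  let ?Z = "cocycles C d i" and ?B = "coboundaries C d i" and ?H = "cohomology C d i"
  let ?aH = "ideal_smult a ?H" and ?aZ = "ideal_times R (C i) a ?Z"
  let ?Q = "quot_module ?H ?aH"
  note q = quotient_of_interval[OF cohomology_interval[of i] cohomology_def[of C d i]]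
  obtain \<pi> where \<pi>: "\<pi> \<in> mod_hom R ((C i)\<lparr>carrier := ?Z\<rparr>) ?H"
    "\<pi> ` ?Z = carrier ?H" "\<And>z. z \<in> ?Z \<Longrightarrow> \<pi> z = \<zero>\<^bsub>?H\<^esub> \<longleftrightarrow> z \<in> ?B"
    using q(2) by auto
  interpret H: module R ?H by (rule q(1))
  have aH: "submodule ?aH R ?H" by (rule H.submodule_ideal_smult[OF a])
  have iH: "interval R ?H ?aH (carrier ?H)"
    using q(1) aH H.carrier_is_submodule H.submodule_mem(1)[OF aH] by (auto simp: interval_def)
  have q': "?Q = quot_module (?H\<lparr>carrier := carrier ?H\<rparr>) ?aH" by simp
  note Qm = quotient_of_interval[OF iH q']
  obtain \<pi>' where \<pi>': "\<pi>' \<in> mod_hom R (?H\<lparr>carrier := carrier ?H\<rparr>) ?Q"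
    "\<pi>' ` carrier ?H = carrier ?Q" "\<And>h. h \<in> carrier ?H \<Longrightarrow> \<pi>' h = \<zero>\<^bsub>?Q\<^esub> \<longleftrightarrow> h \<in> ?aH"
    using Qm(2) by auto
  interpret Q: module R ?Q by (rule Qm(1))
  note \<pi>D = mod_homD[OF \<pi>(1)] and aHD = H.submodule_mem[OF aH]
  note ZD = M.submodule_mem[OF submodule_cocycles[of i]]
  have ac: "a \<subseteq> carrier R" using ideal.Icarr[OF a] by blast
  have \<pi>c: "\<pi> z \<in> carrier ?H" if "z \<in> ?Z" for z using \<pi>D(1) that by simp
  have \<pi>0: "\<pi> b = \<zero>\<^bsub>?H\<^esub>" "b \<in> ?Z" if "b \<in> ?B" for b
    using \<pi>(3) coboundaries_le_cocycles that by auto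
  have "\<pi> \<zero>\<^bsub>C i\<^esub> = \<zero>\<^bsub>?H\<^esub>" using \<pi>0(1) M.submodule_mem(2)[OF submodule_coboundaries] by blast
  then have P: "submodule {z \<in> ?Z. \<pi> z \<in> ?aH} R (C i)"
    unfolding M.submodule_iff using ZD \<pi>D(2,3) aHD by auto
  have "?aZ \<subseteq> {z \<in> ?Z. \<pi> z \<in> ?aH}"
  proof (rule M.ideal_times_least[OF P])
    fix r z assume r: "r \<in> a" and z: "z \<in> ?Z"
    have "r \<odot>\<^bsub>?H\<^esub> \<pi> z \<in> ?aH" using H.ideal_smultI[OF r \<pi>c[OF z]] .
    then show "r \<odot>\<^bsub>C i\<^esub> z \<in> {z \<in> ?Z. \<pi> z \<in> ?aH}" using r z ac ZD(5) \<pi>D(3)[of r z] by auto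
  qed
  moreover have "?B \<subseteq> {z \<in> ?Z. \<pi> z \<in> ?aH}" using \<pi>0 aHD(2) by auto
  ultimately have KP: "?aZ <+>\<^bsub>C i\<^esub> ?B \<subseteq> {z \<in> ?Z. \<pi> z \<in> ?aH}" by (rule M.set_add_least[OF P])
  have iQ: "interval R ?Q {\<zero>\<^bsub>?Q\<^esub>} (carrier ?Q)"
    using Qm(1) Q.submodule_zero Q.carrier_is_submodule by (simp add: interval_def)
  have "(\<lambda>z. \<pi>' (\<pi> z)) \<in> mod_hom R ((C i)\<lparr>carrier := ?Z\<rparr>) ?Q"
    using mod_hom_comp[OF \<pi>(1)] \<pi>'(1) by simp
  then have "subquotient R (C i) (?aZ <+>\<^bsub>C i\<^esub> ?B) ?Z ?Q {\<zero>\<^bsub>?Q\<^esub>} (carrier ?Q)"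
  proof (rule subquotient_image[OF _ reduced_interval(2)[OF ac] iQ])
    show "carrier ?Q \<subseteq> (\<lambda>z. \<pi>' (\<pi> z)) ` ?Z" using \<pi>(2) \<pi>'(2) by (metis image_image order_refl)
    show "\<pi>' (\<pi> z) \<in> {\<zero>\<^bsub>?Q\<^esub>}" if "z \<in> ?aZ <+>\<^bsub>C i\<^esub> ?B" for z
      using that KP \<pi>'(3) \<pi>c by auto
  qed
  from artinian_between_subquotient[OF art this] show ?thesis
    by (simp add: Q.artinian_between_zero_carrier)
qed

lemma laskerian_between_zero_carrier:
  assumes "module R N" "weakly_laskerian R N"
  shows "laskerian_between R N {\<zero>\<^bsub>N\<^esub>} (carrier N)"
  unfolding laskerian_between_def
proof (intro allI impI)
  interpret N: module R N by fact
  fix S assume S: "submodule S R N"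
  note q = N.quot_module_simps[OF S]
  have "colon R N S x = {r \<in> carrier R. r \<odot>\<^bsub>quot_module N S\<^esub> (S +>\<^bsub>N\<^esub> x) = \<zero>\<^bsub>quot_module N S\<^esub>}"
    if "x \<in> carrier N" for x
    using that by (simp add: colon_def q N.coset_zero_iff[OF S] cong: conj_cong)
  then have "ass_between R N S (carrier N) = assoc_primes R (quot_module N S)"
    unfolding ass_between_def assoc_primes_def q(2) by auto
  then show "finite (ass_between R N S (carrier N))"
    using assms(2) S by (simp add: weakly_laskerian_def)
qed

text \<open>If \<open>x/1 = 0/1\<close> in the localization at \<open>p\<close>, some \<open>u \<notin> p\<close> annihilates \<open>x\<close>.\<close>

lemma supp_between_zero_carrier:
  assumes "module R N"
  shows "supp_between R N {\<zero>\<^bsub>N\<^esub>} (carrier N) \<subseteq> supp R N"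
proof
  interpret N: module R N by fact
  fix p assume "p \<in> supp_between R N {\<zero>\<^bsub>N\<^esub>} (carrier N)"
  then obtain x where p: "primeideal p R" and x: "x \<in> carrier N" "colon R N {\<zero>\<^bsub>N\<^esub>} x \<subseteq> p"
    by (auto simp: supp_between_def)
  interpret p: primeideal p R by fact
  have one: "\<one>\<^bsub>R\<^esub> \<in> carrier R - p" using p.I_notcarr p.one_imp_carrier by auto
  have "frac_rel R N p `` {(x, \<one>\<^bsub>R\<^esub>)} \<noteq> localization_zero R N p"
  proof
    assume eq: "frac_rel R N p `` {(x, \<one>\<^bsub>R\<^esub>)} = localization_zero R N p"
    have "(x, \<one>\<^bsub>R\<^esub>) \<in> frac_rel R N p `` {(x, \<one>\<^bsub>R\<^esub>)}" using x one by (auto simp: frac_rel_def)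
    then have "((\<zero>\<^bsub>N\<^esub>, \<one>\<^bsub>R\<^esub>), (x, \<one>\<^bsub>R\<^esub>)) \<in> frac_rel R N p" unfolding eq localization_zero_def by simp
    then obtain u where "u \<in> carrier R - p" "u \<odot>\<^bsub>N\<^esub> x = \<zero>\<^bsub>N\<^esub>" using x by (auto simp: frac_rel_def)
    then show False using x(2) by (auto simp: colon_def)
  qed
  moreover have "frac_rel R N p `` {(x, \<one>\<^bsub>R\<^esub>)} \<in> localization R N p"
    unfolding localization_def using x one by (intro quotientI) auto
  ultimately show "p \<in> supp R N" using p by (auto simp: supp_def)
qed

lemma chains_below_if_finite_dim:
  assumes "module R N" and dim: "module_dim R N < \<infinity>"
  shows "\<exists>n. chains_below R a n N {\<zero>\<^bsub>N\<^esub>} (carrier N)"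
proof (rule ccontr)
  assume no: "\<nexists>n. chains_below R a n N {\<zero>\<^bsub>N\<^esub>} (carrier N)"
  have "ereal (real n) \<le> module_dim R N" for n
    unfolding module_dim_def
  proof (rule SUP_upper, rule CollectI)
    have "\<not> chains_below R a n N {\<zero>\<^bsub>N\<^esub>} (carrier N)" using no by simp
    then obtain p where "\<forall>i\<le>n. p i \<in> supp_between R N {\<zero>\<^bsub>N\<^esub>} (carrier N)" "\<forall>i<n. p i \<subset> p (Suc i)"
      unfolding chains_below_def by auto
    then show "\<exists>p. (\<forall>i\<le>n. p i \<in> supp R N) \<and> (\<forall>i<n. p i \<subset> p (Suc i))"
      using supp_between_zero_carrier[OF assms(1)] by (intro exI[of _ p]) auto
  qed
  moreover obtain n where "module_dim R N \<le> ereal (real n)"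
  proof (cases "module_dim R N")
    case (real r)
    then show thesis using that real_arch_simple[of r] by auto
  qed (use dim that in auto)
  ultimately have "ereal (real (Suc n)) \<le> ereal (real n)" by (meson order_trans)
  then show False by simp
qed

lemma torsion_atom_module:
  fixes M :: "('a, 'c) module"
  shows "torsion_module R a (atom_module M) = atom_module (torsion_module R a M)"
proof -
  have "{p \<in> Atom ` A. Q (atom p)} = Atom ` {u \<in> A. Q u}" for A :: "'c set" and Q by auto
  from this[of "carrier M" "\<lambda>u. \<exists>n::nat. \<forall>r \<in> a [^]\<^bsub>ideals_set R\<^esub> n. r \<odot>\<^bsub>M\<^esub> u = \<zero>\<^bsub>M\<^esub>"]
  show ?thesis by (simp add: torsion_module_def atom_module_def)
qed

lemma cocycles_atom:
  "cocycles (\<lambda>j. atom_module (C j)) (\<lambda>j p. Atom (d j (atom p))) i = Atom ` cocycles C d i"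
  by (auto simp: a_kernel_def')

lemma coboundaries_atom:
  "coboundaries (\<lambda>j. atom_module (C j)) (\<lambda>j p. Atom (d j (atom p))) i = Atom ` coboundaries C d i"
  by (cases i) (simp_all add: coboundaries_def image_image)

lemma Atom_hom: "Atom \<in> mod_hom R M (atom_module M)"
  by (rule mod_homI) auto

lemma cochain_complex_atom:
  assumes "cochain_complex R C d"
  shows "cochain_complex R (\<lambda>j. atom_module (C j)) (\<lambda>j p. Atom (d j (atom p)))"
proof -
  interpret cochain_complex R C d by fact
  show ?thesis
  proof (rule cochain_complex.intro)
    show "(\<lambda>p. Atom (d j (atom p))) \<in> mod_hom R (atom_module (C j)) (atom_module (C (Suc j)))" for j
      using mod_homD[OF hom[of j]] by (intro mod_homI) auto
  qed (use square module_atom_module[OF module] in auto)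
qed

theorem corollary3p2:
  fixes R :: "('a, 'm) ring_scheme" and N :: "('a, 'b, 'n) module_scheme"
    and E :: "nat \<Rightarrow> ('a, 'c) module" and d :: "nat \<Rightarrow> 'c \<Rightarrow> 'c" and \<epsilon> :: "'b \<Rightarrow> 'c"
    and a :: "'a set" and t :: nat
  assumes "cring R" and "noetherian_ring R"
    and "ideal a R"
    and "module R N" and "weakly_laskerian R N" and "module_dim R N < \<infinity>"
    and "injective_resolution R N E d \<epsilon>"
    and "t > 0"
    and "\<And>i. i > t \<Longrightarrow> artinian_module R (local_cohomology R a E d i)"
  shows "artinian_module R
    (quot_module (local_cohomology R a E d t) (ideal_smult a (local_cohomology R a E d t)))"
proof -
  interpret res: injective_resolution R N E d \<epsilon> by fact
  have Emod: "module R (E j)" for j using res.injective[of j] by (simp add: injective_module_def)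
  have d0: "d (Suc j) (d j x) = \<zero>\<^bsub>E (Suc (Suc j))\<^esub>" if "x \<in> carrier (E j)" for j x
  proof -
    have "d j x \<in> a_kernel (E (Suc j)) (E (Suc (Suc j))) (d (Suc j))" using that res.exact_Suc by simp
    then show ?thesis by (simp add: a_kernel_def')
  qed
  have Ecx: "cochain_complex R E d"
    by (intro cochain_complex.intro Emod res.differential_hom d0)
  interpret EC: noetherian_complex R E d a
    by (intro noetherian_complex.intro noetherian_complex_axioms.intro Ecx assms(1-3))
  let ?T = "\<lambda>j. torsion_module R a (E j)"
  have Tcx: "cochain_complex R ?T d" by (rule EC.torsion_complex)
  interpret T: cochain_complex R ?T d by (rule Tcx)
  interpret Tt: module R "?T t" by (rule EC.module_T)
  define X where "X j = atom_module (E j)" for j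
  define D where "D = (\<lambda>j p. Atom (d j (atom p)))"
  have Xcx: "cochain_complex R X D"
    unfolding X_def D_def by (rule cochain_complex_atom[OF Ecx])
  interpret X: injective_complex R X D a
    by (intro injective_complex.intro injective_complex_axioms.intro noetherian_complex.intro
        noetherian_complex_axioms.intro Xcx assms(1-3))
      (simp add: X_def injective_atom_module res.injective)
  interpret XT: cochain_complex R X.T D by (rule X.torsion_complex)
  have TX: "X.T j = atom_module (?T j)" for j by (simp add: X_def torsion_atom_module)
  have TX': "X.T = (\<lambda>j. atom_module (?T j))" using TX by auto
  have ZT: "cocycles X.T D i = Atom ` cocycles ?T d i" for i
    using cocycles_atom[where C = ?T and d = d and i = i] by (simp add: TX D_def)
  have BT: "coboundaries X.T D i = Atom ` coboundaries ?T d i" for i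
    unfolding TX' D_def by (rule coboundaries_atom)
  have Z: "cocycles X D i = Atom ` cocycles E d i" for i
    using cocycles_atom[where C = E and d = d and i = i] by (simp add: X_def D_def)
  have B: "coboundaries X D i = Atom ` coboundaries E d i" for i
    unfolding X_def D_def by (rule coboundaries_atom)
  have hom: "Atom \<in> mod_hom R (?T i) (X.T i)" for i unfolding TX by (rule Atom_hom)
  have hom': "Atom \<in> mod_hom R ((?T i)\<lparr>carrier := cocycles ?T d i\<rparr>) (X.T i)" for i
    using hom by (rule mod_hom_restrict) (auto simp: T.cocycles_iff)
  have cohom: "local_cohomology R a E d i = cohomology ?T d i" for i by (simp add: local_cohomology_def)
  have art: "artinian_between R (X.T i) (coboundaries X.T D i) (cocycles X.T D i)" if "t < i" for i
  proof -
    have "artinian_between R (?T i) (coboundaries ?T d i) (cocycles ?T d i)"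
      using artinian_if_cohomology[OF Tcx] assms(9)[OF that] by (simp add: cohom)
    moreover have "subquotient R (?T i) (coboundaries ?T d i) (cocycles ?T d i)
      (X.T i) (coboundaries X.T D i) (cocycles X.T D i)"
      by (rule subquotient_image[OF hom' T.cohomology_interval XT.cohomology_interval]) (auto simp: ZT BT)
    ultimately show ?thesis by (rule artinian_between_subquotient)
  qed
  have iN: "interval R N {\<zero>\<^bsub>N\<^esub>} (carrier N)"
    using assms(4) res.N.submodule_zero res.N.carrier_is_submodule by (simp add: interval_def)
  have \<epsilon>: "(\<lambda>x. Atom (\<epsilon> x)) \<in> mod_hom R N (X 0)"
    using mod_hom_comp[OF res.augmentation_hom Atom_hom] by (simp add: X_def)
  then have \<epsilon>': "(\<lambda>x. Atom (\<epsilon> x)) \<in> mod_hom R (N\<lparr>carrier := carrier N\<rparr>) (X 0)"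
    by (rule mod_hom_restrict) simp
  have sqN: "subquotient R N {\<zero>\<^bsub>N\<^esub>} (carrier N) (X 0) (coboundaries X D 0) (cocycles X D 0)"
  proof (rule subquotient_image[OF \<epsilon>' iN X.cohomology_interval])
    show "cocycles X D 0 \<subseteq> (\<lambda>x. Atom (\<epsilon> x)) ` carrier N" unfolding Z using res.exact_0 by auto
    show "Atom (\<epsilon> x) \<in> coboundaries X D 0" if "x \<in> {\<zero>\<^bsub>N\<^esub>}" for x
      using that mod_hom_zero[OF assms(4) X.module \<epsilon>] by (simp add: coboundaries_def)
  qed
  obtain n where n: "chains_below R a n N {\<zero>\<^bsub>N\<^esub>} (carrier N)"
    using chains_below_if_finite_dim[OF assms(4,6)] by blast
  have reduced: "artinian_between R (X.T t)
    (ideal_times R (X.T t) a (cocycles X.T D t) <+>\<^bsub>X.T t\<^esub> coboundaries X.T D t) (cocycles X.T D t)"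
  proof (rule reduced_torsion_cohomology_artinian[OF X.injective_complex_axioms assms(8)])
    show "cocycles X D i \<subseteq> coboundaries X D i" if "0 < i" for i
      using that res.exact_Suc unfolding Z B by (cases i) (simp_all add: coboundaries_def)
    show "laskerian_between R (X 0) (coboundaries X D 0) (cocycles X D 0)"
      by (rule laskerian_between_subquotient[OF laskerian_between_zero_carrier[OF assms(4,5)] sqN])
    show "chains_below R a n (X 0) (coboundaries X D 0) (cocycles X D 0)"
      by (rule chains_below_mono[OF n supp_between_subquotient[OF sqN]])
  qed (use art in auto)
  let ?aZ = "ideal_times R (?T t) a (cocycles ?T d t)"
  let ?K = "?aZ <+>\<^bsub>?T t\<^esub> coboundaries ?T d t"
  note aZ = T.reduced_interval(1)[OF EC.a_subset, of t] and Bs = T.submodule_coboundaries[of t]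
    and iK = T.reduced_interval(2)[OF EC.a_subset, of t]
  have K: "submodule ?K R (?T t)" using iK by (simp add: interval_def)
  interpret XTt: module R "X.T t" by (rule X.module_T)
  let ?aZX = "ideal_times R (X.T t) a (cocycles X.T D t)"
  note iKX = XT.reduced_interval(2)[OF EC.a_subset, of t]
  have AK: "submodule (Atom ` ?K) R (X.T t)"
    by (rule submodule_image[OF EC.module_T X.module_T hom K])
  have "?aZX \<subseteq> Atom ` ?K"
  proof (rule XTt.ideal_times_least[OF AK])
    fix r p assume r: "r \<in> a" and "p \<in> cocycles X.T D t"
    then obtain z where z: "z \<in> cocycles ?T d t" "p = Atom z" by (auto simp: ZT)
    have "r \<odot>\<^bsub>?T t\<^esub> z \<in> ?K" using Tt.set_add_ge1[OF aZ Bs] Tt.ideal_timesI[OF r z(1)] by blast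
    then show "r \<odot>\<^bsub>X.T t\<^esub> p \<in> Atom ` ?K" using z(2) by (simp add: X_def)
  qed
  moreover have "coboundaries X.T D t \<subseteq> Atom ` ?K"
    unfolding BT by (rule image_mono[OF Tt.set_add_ge2[OF aZ Bs]])
  ultimately have KX: "?aZX <+>\<^bsub>X.T t\<^esub> coboundaries X.T D t \<subseteq> Atom ` ?K"
    by (rule XTt.set_add_least[OF AK])
  have "subquotient R (X.T t) (?aZX <+>\<^bsub>X.T t\<^esub> coboundaries X.T D t) (cocycles X.T D t)
    (?T t) ?K (cocycles ?T d t)"
    by (rule subquotient_preimage[OF hom' iKX iK]) (use KX in \<open>auto simp: ZT\<close>)
  from artinian_between_subquotient[OF reduced this]
  show ?thesis unfolding cohom by (rule reduced_cohomology_artinian[OF Tcx assms(3)])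
qed

end
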